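(* Let $\xi(s)=\tfrac12 s(s-1)\pi^{-s/2}\Gamma(s/2)\zeta(s)$ be the Riemann $\xi$-function. For real $h$ and $0\le\theta<2\pi$ define the entire functions $$A_{h,\theta}(s)=\tfrac12(\cos\theta)\big(\xi(s+h)+\xi(s-h)\big)-\tfrac1{2i}(\sin\theta)\big(\xi(s+h)-\xi(s-h)\big),$$ $$B_{h,\theta}(s)=-\tfrac12(\sin\theta)\big(\xi(s+h)+\xi(s-h)\big)-\tfrac1{2i}(\cos\theta)\big(\xi(s+h)-\xi(s-h)\big).$$ (1) For every real $h$ with $|h|\ge\tfrac12$ and every $0\le\theta<2\pi$, the functions $A_{h,\theta}(s)$ and $B_{h,\theta}(s)$ have all their zeros on the critical line $\Re(s)=\tfrac12$. These zeros are all simple zeros, and the zeros of $A_{h,\theta}$ and $B_{h,\theta}$ interlace. (2) Assume the Riemann hypothesis. Then for every real $h$ with $0<|h|<\tfrac12$ and every $0\le\theta<2\pi$, the functions $A_{h,\theta}(s)$ and $B_{h,\theta}(s)$ have all their zeros on the critical line $\Re(s)=\tfrac12$. These zeros are all simple zeros, and the zeros of $A_{h,\theta}$ and $B_{h,\theta}$ interlace.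
   Context: Interlacing: for two entire functions $A,B$ with all zeros on $\Re(s)=\tfrac12$, the zeros interlace if there is a numbering of their zeros, $\tfrac12+i\gamma_n(A)$ and $\tfrac12+i\gamma_n(B)$ respectively, counted with multiplicity and with imaginary parts in increasing order, such that $\gamma_n(A)\le\gamma_n(B)\le\gamma_{n+1}(A)$ holds for all allowed indices $n$. *)

theory Defs
  imports "HOL-Complex_Analysis.Complex_Analysis"
begin

text \<open>
  The Riemann zeta function is the analytic continuation of its Dirichlet series to the
  plane punctured at 1.  The clause \<open>f 1 = 0\<close> only fixes the otherwise
  arbitrary value at the pole, so that the description determines a unique function.
\<close>
definition zeta :: "complex \<Rightarrow> complex" where
  "zeta = (THE f. f holomorphic_on - {1} \<and>
                  (\<forall>s. Re s > 1 \<longrightarrow> (\<lambda>n. of_nat (Suc n) powr (- s)) sums f s) \<and>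
                  f 1 = 0)"

text \<open>
  The defining formula has removable singularities at 0, at 1 and at the negative even
  integers, where the totalised values of Gamma and zeta are meaningless;
  \<open>remove_sings\<close> replaces the value at every point by the limit at that point.
\<close>
definition riemann_xi :: "complex \<Rightarrow> complex" where
  "riemann_xi = remove_sings
     (\<lambda>s. 1 / 2 * s * (s - 1) * of_real pi powr (- s / 2) * Gamma (s / 2) * zeta s)"

definition riemann_hypothesis :: bool where
  "riemann_hypothesis \<longleftrightarrow>
     (\<forall>s. zeta s = 0 \<and> 0 < Re s \<and> Re s < 1 \<longrightarrow> Re s = 1 / 2)"

definition A_fun :: "real \<Rightarrow> real \<Rightarrow> complex \<Rightarrow> complex" where
  "A_fun h \<theta> s =
     1 / 2 * of_real (cos \<theta>) * (riemann_xi (s + of_real h) + riemann_xi (s - of_real h))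
     - 1 / (2 * \<i>) * of_real (sin \<theta>) * (riemann_xi (s + of_real h) - riemann_xi (s - of_real h))"

definition B_fun :: "real \<Rightarrow> real \<Rightarrow> complex \<Rightarrow> complex" where
  "B_fun h \<theta> s =
     - 1 / 2 * of_real (sin \<theta>) * (riemann_xi (s + of_real h) + riemann_xi (s - of_real h))
     - 1 / (2 * \<i>) * of_real (cos \<theta>) * (riemann_xi (s + of_real h) - riemann_xi (s - of_real h))"

definition zeros_on_critical_line :: "(complex \<Rightarrow> complex) \<Rightarrow> bool" where
  "zeros_on_critical_line F \<longleftrightarrow> (\<forall>s. F s = 0 \<longrightarrow> Re s = 1 / 2)"

definition all_zeros_simple :: "(complex \<Rightarrow> complex) \<Rightarrow> bool" where
  "all_zeros_simple F \<longleftrightarrow> (\<forall>s. F s = 0 \<longrightarrow> zorder F s = 1)"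

text \<open>
  \<open>\<gamma>\<close> lists the zeros \<open>1/2 + i \<gamma> n\<close> of \<open>F\<close> in (weakly) increasing order of the
  imaginary part, each as often as its multiplicity; the indices form a block \<open>I\<close> of
  consecutive integers, which may be finite or infinite in either direction.  Finiteness of
  the index sets is required explicitly because the cardinality of an infinite set is 0.
\<close>
definition zero_numbering :: "(complex \<Rightarrow> complex) \<Rightarrow> int set \<Rightarrow> (int \<Rightarrow> real) \<Rightarrow> bool" where
  "zero_numbering F I \<gamma> \<longleftrightarrow>
     (\<forall>m\<in>I. \<forall>n\<in>I. {m..n} \<subseteq> I) \<and> mono_on I \<gamma> \<and>
     (\<forall>z. finite {n\<in>I. Complex (1 / 2) (\<gamma> n) = z} \<and>
          card {n\<in>I. Complex (1 / 2) (\<gamma> n) = z} = (if F z = 0 then nat (zorder F z) else 0))"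

text \<open>
  The first two conditions on \<open>I\<close> and \<open>J\<close> say that between two consecutively numbered zeros
  of one function the other function has a zero with the matching number.  They hold
  automatically for sequences unbounded in both directions (\<open>I = J = UNIV\<close>);
  otherwise they exclude numberings so far apart that the inequalities would be vacuous.
\<close>
definition zeros_interlace :: "(complex \<Rightarrow> complex) \<Rightarrow> (complex \<Rightarrow> complex) \<Rightarrow> bool" where
  "zeros_interlace A B \<longleftrightarrow>
     (\<exists>I J \<alpha> \<beta>. zero_numbering A I \<alpha> \<and> zero_numbering B J \<beta> \<and>
        (\<forall>n. n \<in> I \<and> n + 1 \<in> I \<longrightarrow> n \<in> J) \<and>
        (\<forall>n. n \<in> J \<and> n + 1 \<in> J \<longrightarrow> n + 1 \<in> I) \<and>
        (\<forall>n. n \<in> I \<and> n \<in> J \<longrightarrow> \<alpha> n \<le> \<beta> n) \<and>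
        (\<forall>n. n \<in> J \<and> n + 1 \<in> I \<longrightarrow> \<beta> n \<le> \<alpha> (n + 1)))"

end

theory Submission
  imports Defs "HOL-Number_Theory.Prime_Powers" "HOL-Real_Asymp.Real_Asymp"
begin

text \<open>
  Write \<open>F z = \<xi> (1/2 + z)\<close>.  It is an even entire function, real on the real axis, and it is
  \<open>1/2 + (z\<^sup>2 - 1/4) / 2\<close> times a power series in \<open>z\<^sup>2\<close> with nonnegative coefficients, by
  Riemann's theta function argument; the theta functional equation is obtained from binomial
  sums by Polya's method.

  Both combinations of \<open>F (z + h)\<close> and \<open>F (z - h)\<close> have the form
  \<open>(cis \<phi> F (z + h) + cis (-\<phi>) F (z - h)) / 2\<close>, so it suffices that \<open>\<bar>F (z + h)\<bar> > \<bar>F (z - h)\<bar>\<close> for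
  \<open>Re z > 0\<close>, with a positive rate at \<open>Re z = 0\<close>.  This holds factor by factor in the product
  over the zeros of \<open>F\<close>, which lie in \<open>\<bar>Re \<rho>\<bar> \<le> h\<close>.  Since \<open>F\<close> is even and grows more slowly than
  \<open>exp (\<epsilon> \<bar>z\<bar>\<^sup>2)\<close>, the finite products over \<open>\<bar>\<rho>\<bar> < R\<close> converge to \<open>F\<close> without convergence factors:
  the logarithm of the remaining factor has a double zero at \<open>0\<close> and a real part that is
  \<open>o(R\<^sup>2)\<close> on the disc of radius \<open>R\<close>.  On the line, the argument \<open>p\<close> of \<open>F (h + i y)\<close> is then
  strictly increasing, the zeros are the points where \<open>p + \<phi>\<close> is an odd multiple of \<open>\<pi>/2\<close>, and
  they interlace.
\<close>

section \<open>The theta functional equation\<close>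

text \<open>The line \<open>Re s = 1\<close> matters because of \<open>\<bar>h\<bar> = 1/2\<close>:
  a continuous argument of \<open>F\<close> along \<open>Re z = h\<close> requires that
  \<open>F\<close> has no zeros there, and for \<open>h = 1/2\<close> this is the nonvanishing of
  zeta on \<open>Re s = 1\<close>, hence the 3-4-1 inequality. Nonnegative coefficients keep the
  analysis of the completed zeta function on the real axis: a power series with such coefficients
  that converges at every \<open>r > 1/2\<close> is entire, and on a disc its modulus is largest at
  the positive real point. Continuation, functional equation (evenness) and growth thus all come
  from one identity for real \<open>s > 1\<close>. The factorwise comparison yields only a weak
  inequality in the limit. One zero of \<open>F\<close> is therefore kept apart; its exact gain,
  linear in \<open>Re z\<close>, survives the limit, gives strictness for \<open>Re z > 0\<close>,
  and on differentiation becomes the positive rate at \<open>Re z = 0\<close>.\<close>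

lemma sum_cis_root_of_unity:
  fixes l :: nat and d :: int
  assumes "l > 0"
  shows "(\<Sum>j<l. cis (2 * pi * of_int d / of_nat l) ^ j) = (if int l dvd d then of_nat l else 0)"
proof -
  define z where "z = cis (2 * pi * of_int d / of_nat l)"
  have zl: "z ^ l = 1"
    using assms by (simp add: z_def Complex.DeMoivre cis_multiple_2pi)
  have "z = 1 \<longleftrightarrow> int l dvd d"
  proof
    assume "z = 1"
    hence "cos (2 * pi * of_int d / of_nat l) = 1"
      by (simp add: z_def complex_eq_iff)
    then obtain n :: int where n: "2 * pi * of_int d / of_nat l = of_int n * 2 * pi"
      unfolding cos_one_2pi_int by blast
    hence "real_of_int d = of_int n * of_nat l"
      using assms by (simp add: field_simps)
    hence "d = n * int l"
      by (metis of_int_eq_iff of_int_mult of_int_of_nat_eq)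
    thus "int l dvd d" by simp
  next
    assume "int l dvd d"
    then obtain n where "d = int l * n" by (auto elim: dvdE)
    thus "z = 1" using assms cis_multiple_2pi[of "of_int n"] by (simp add: z_def mult_ac)
  qed
  moreover have "z \<noteq> 1 \<Longrightarrow> (\<Sum>j<l. z ^ j) = 0"
    using zl by (simp add: geometric_sum)
  ultimately show ?thesis
    unfolding z_def[symmetric] by (cases "z = 1") auto
qed

text \<open>The indices \<open>m + d\<close> and \<open>m - d\<close> with \<open>l dvd d\<close>
  contribute equally by the symmetry of the binomial coefficients. Writing
  \<open>d = Suc k * l\<close> gives a series in \<open>k\<close> whose terms are eventually zero,
  the shape required for a termwise limit.\<close>

lemma sum_choose_residue:
  assumes "l > 0"
  shows "(\<Sum>r | r \<le> 2 * m \<and> int l dvd int r - int m. real (2 * m choose r)) =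
           real (2 * m choose m) + 2 * (\<Sum>k. real (2 * m choose (m + Suc k * l)))"
proof -
  let ?S = "{r. r \<le> 2 * m \<and> int l dvd int r - int m}"
  define U where "U = {d. 1 \<le> d \<and> d \<le> m \<and> l dvd d}"
  have fin: "finite U" by (rule finite_subset[of _ "{..m}"]) (auto simp: U_def)
  have S: "?S = insert m ((\<lambda>d. m + d) ` U \<union> (\<lambda>d. m - d) ` U)"
  proof (intro set_eqI iffI)
    fix r assume r: "r \<in> ?S"
    consider "r = m" | "r > m" | "r < m" by linarith
    thus "r \<in> insert m ((\<lambda>d. m + d) ` U \<union> (\<lambda>d. m - d) ` U)"
    proof cases
      case 2
      hence "int l dvd int (r - m)" using r by (simp add: of_nat_diff)
      hence "l dvd r - m" by (simp only: of_nat_dvd_iff)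
      hence "r - m \<in> U" using r 2 by (auto simp: U_def)
      thus ?thesis using 2 by (auto intro!: image_eqI[of _ _ "r - m"])
    next
      case 3
      have "int l dvd int (m - r)" using r 3 by (simp add: of_nat_diff dvd_diff_commute)
      hence "l dvd m - r" by (simp only: of_nat_dvd_iff)
      hence "m - r \<in> U" using r 3 by (auto simp: U_def)
      thus ?thesis using 3 by (auto intro!: image_eqI[of _ _ "m - r"])
    qed auto
  next
    fix r assume "r \<in> insert m ((\<lambda>d. m + d) ` U \<union> (\<lambda>d. m - d) ` U)"
    thus "r \<in> ?S" by (auto simp: U_def of_nat_diff)
  qed
  have "(\<Sum>r\<in>?S. real (2 * m choose r)) = real (2 * m choose m) +
      ((\<Sum>r\<in>(\<lambda>d. m + d) ` U. real (2 * m choose r)) + (\<Sum>r\<in>(\<lambda>d. m - d) ` U. real (2 * m choose r)))"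
    unfolding S using fin
    by (subst sum.insert, (auto simp: U_def)[2], subst sum.union_disjoint) (auto simp: U_def)
  also have "(\<Sum>r\<in>(\<lambda>d. m + d) ` U. real (2 * m choose r)) = (\<Sum>d\<in>U. real (2 * m choose (m + d)))"
    by (subst sum.reindex) (auto simp: inj_on_def)
  also have "(\<Sum>r\<in>(\<lambda>d. m - d) ` U. real (2 * m choose r)) = (\<Sum>d\<in>U. real (2 * m choose (m - d)))"
    by (subst sum.reindex) (auto simp: inj_on_def U_def)
  also have "\<dots> = (\<Sum>d\<in>U. real (2 * m choose (m + d)))"
  proof (rule sum.cong)
    fix d assume "d \<in> U"
    hence "2 * m - (m + d) = m - d" "m + d \<le> 2 * m" by (auto simp: U_def)
    thus "real (2 * m choose (m - d)) = real (2 * m choose (m + d))"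
      using binomial_symmetric[of "m + d" "2 * m"] by simp
  qed auto
  also have "(\<Sum>d\<in>U. real (2 * m choose (m + d))) = (\<Sum>k | Suc k * l \<le> m. real (2 * m choose (m + Suc k * l)))"
  proof (rule sum.reindex_bij_witness[of _ "\<lambda>k. Suc k * l" "\<lambda>d. d div l - 1"])
    fix d assume "d \<in> U"
    hence "d div l \<ge> 1" "d div l * l = d" using assms
      by (auto simp: U_def Suc_le_eq div_greater_zero_iff dvd_imp_le)
    thus "Suc (d div l - 1) * l = d" by simp
    thus "d div l - 1 \<in> {k. Suc k * l \<le> m}"
      using \<open>d \<in> U\<close> by (simp add: U_def del: mult_Suc)
    show "real (2 * m choose (m + Suc (d div l - 1) * l)) = real (2 * m choose (m + d))"
      using \<open>Suc (d div l - 1) * l = d\<close> by simp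
  next
    fix k assume "k \<in> {k. Suc k * l \<le> m}"
    thus "Suc k * l \<in> U" using assms unfolding U_def
      by (auto simp del: mult_Suc simp: Suc_le_eq)
    show "Suc k * l div l - 1 = k" using assms by (simp del: mult_Suc)
  qed
  also have "\<dots> = (\<Sum>k. real (2 * m choose (m + Suc k * l)))"
  proof (rule suminf_finite[symmetric])
    have "k \<le> Suc k * l" for k using assms by (cases l) auto
    hence "{k. Suc k * l \<le> m} \<subseteq> {..m}" using order_trans by blast
    thus "finite {k. Suc k * l \<le> m}" by (rule finite_subset) auto
    fix k assume "k \<notin> {k. Suc k * l \<le> m}"
    hence "2 * m < m + Suc k * l" by (simp del: mult_Suc)
    thus "real (2 * m choose (m + Suc k * l)) = 0" by (simp del: mult_Suc)
  qed
  finally show ?thesis by simp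
qed

text \<open>A finite form of Poisson summation: expand \<open>(cis t + cis (- t)) ^ (2 * m)\<close>
  by the binomial theorem at the points \<open>t = pi * j / l\<close>; summation over
  \<open>j\<close> keeps only the exponents \<open>r\<close> congruent to \<open>m\<close> modulo
  \<open>l\<close>.\<close>

lemma sum_cos_power_eq_binomial:
  fixes l m :: nat
  assumes "l > 0"
  shows "4 ^ m * (\<Sum>j<l. cos (pi * j / l) ^ (2 * m)) =
     l * (real (2 * m choose m) + 2 * (\<Sum>k. real (2 * m choose (m + Suc k * l))))"
proof -
  have "complex_of_real (4 ^ m * cos (pi * j / l) ^ (2 * m)) =
      (\<Sum>r\<le>2*m. of_nat (2 * m choose r) * cis (2 * pi * of_int (int r - int m) / of_nat l) ^ j)" for j :: nat
  proof -
    define t where "t = pi * j / l"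
    have "complex_of_real (4 ^ m * cos t ^ (2 * m)) = (of_real (2 * cos t)) ^ (2 * m)"
      by (simp add: power_mult power_mult_distrib)
    also have "of_real (2 * cos t) = cis t + cis (- t)"
      by (simp add: complex_eq_iff)
    also have "(cis t + cis (- t)) ^ (2 * m) =
        (\<Sum>r\<le>2*m. of_nat (2 * m choose r) * cis t ^ r * cis (- t) ^ (2 * m - r))"
      by (rule binomial_ring)
    also have "\<dots> = (\<Sum>r\<le>2*m. of_nat (2 * m choose r) * cis (2 * pi * of_int (int r - int m) / of_nat l) ^ j)"
    proof (rule sum.cong)
      fix r assume r: "r \<in> {..2*m}"
      have "cis t ^ r * cis (- t) ^ (2 * m - r) = cis (r * t - (2 * m - r) * t)"
        by (simp add: Complex.DeMoivre cis_mult)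
      also have "real r * t - real (2 * m - r) * t = j * (2 * pi * of_int (int r - int m) / of_nat l)"
        using r assms by (simp add: t_def of_nat_diff field_simps)
      also have "cis \<dots> = cis (2 * pi * of_int (int r - int m) / of_nat l) ^ j"
        by (simp only: Complex.DeMoivre)
      finally show "of_nat (2 * m choose r) * cis t ^ r * cis (- t) ^ (2 * m - r) =
          of_nat (2 * m choose r) * cis (2 * pi * of_int (int r - int m) / of_nat l) ^ j"
        by (simp add: mult.assoc)
    qed auto
    finally show ?thesis by (simp add: t_def)
  qed
  hence "complex_of_real (4 ^ m * (\<Sum>j<l. cos (pi * j / l) ^ (2 * m))) =
      (\<Sum>j<l. \<Sum>r\<le>2*m. of_nat (2 * m choose r) * cis (2 * pi * of_int (int r - int m) / of_nat l) ^ j)"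
    by (simp add: sum_distrib_left)
  also have "\<dots> = (\<Sum>r\<le>2*m. of_nat (2 * m choose r) * (\<Sum>j<l. cis (2 * pi * of_int (int r - int m) / of_nat l) ^ j))"
    by (subst sum.swap) (simp add: sum_distrib_left)
  also have "\<dots> = (\<Sum>r\<le>2*m. if int l dvd int r - int m then of_nat (2 * m choose r) * of_nat l else 0)"
    by (intro sum.cong refl) (subst sum_cis_root_of_unity[OF assms], auto)
  also have "\<dots> = (\<Sum>r | r \<le> 2 * m \<and> int l dvd int r - int m. of_nat (2 * m choose r) * of_nat l)"
    by (subst sum.inter_filter[symmetric]) (auto intro: sum.cong)
  also have "\<dots> = complex_of_real (l * (\<Sum>r | r \<le> 2 * m \<and> int l dvd int r - int m. real (2 * m choose r)))"
    by (simp add: sum_distrib_left mult_ac)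
  finally show ?thesis
    unfolding of_real_eq_iff sum_choose_residue[OF assms] .
qed

text \<open>The reflection of \<open>j\<close> to \<open>2 * q + 1 - j\<close> changes the sign of
  the cosine, which the even power ignores. All remaining angles lie below \<open>pi / 2\<close>,
  where the cosine has a Gaussian majorant.\<close>

lemma sum_cos_power_symmetric:
  "(\<Sum>j<2*q+1. cos (pi * real j / real (2 * q + 1)) ^ (2 * m)) =
     1 + 2 * (\<Sum>j<q. cos (pi * real (Suc j) / real (2 * q + 1)) ^ (2 * m))"
proof -
  define f where "f j = cos (pi * real j / real (2 * q + 1)) ^ (2 * m)" for j :: nat
  have refl: "f (2 * q + 1 - j) = f j" if "j \<le> 2 * q + 1" for j
  proof -
    have "pi * real (2 * q + 1 - j) / real (2 * q + 1) = pi - pi * real j / real (2 * q + 1)"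
      using that by (simp add: of_nat_diff field_simps)
    thus ?thesis by (simp add: f_def cos_diff)
  qed
  have "(\<Sum>j<2*q+1. f j) = f 0 + (\<Sum>j<2*q. f (Suc j))"
    using sum.lessThan_Suc_shift[of f "2 * q"] by simp
  also have "{..<2*q} = {..<q} \<union> {q..<2*q}" by auto
  also have "(\<Sum>j\<in>{..<q} \<union> {q..<2*q}. f (Suc j)) = (\<Sum>j<q. f (Suc j)) + (\<Sum>j=q..<2*q. f (Suc j))"
    by (rule sum.union_disjoint) auto
  also have "(\<Sum>j=q..<2*q. f (Suc j)) = (\<Sum>j<q. f (Suc j))"
  proof (rule sum.reindex_bij_witness[of _ "\<lambda>j. 2 * q - 1 - j" "\<lambda>j. 2 * q - 1 - j"])
    fix j assume j: "j \<in> {q..<2*q}"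
    hence "Suc (2 * q - 1 - j) = 2 * q + 1 - Suc j" by auto
    thus "f (Suc (2 * q - 1 - j)) = f (Suc j)" using refl[of "Suc j"] j by auto
  qed auto
  finally show ?thesis by (simp add: f_def)
qed

text \<open>
  With \<open>m \<approx> x l\<^sup>2 / \<pi>\<close> and \<open>l = 2 q + 1 \<rightarrow> \<infinity>\<close>, the two sides become the theta series
  at \<open>x\<close> and at \<open>1 / x\<close>.
\<close>
lemma Polya_identity:
  "1 + 2 * (\<Sum>j<q. cos (pi * real (Suc j) / real (2 * q + 1)) ^ (2 * m)) =
     real (2 * q + 1) * real (2 * m choose m) / 4 ^ m *
       (1 + 2 * (\<Sum>k. real (2 * m choose (m + Suc k * (2 * q + 1))) / real (2 * m choose m)))"
proof -
  let ?l = "2 * q + 1" and ?c = "\<lambda>k. real (2 * m choose (m + Suc k * (2 * q + 1)))"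
  have summ: "summable ?c"
  proof (rule summable_finite[of "{..m}"])
    fix k assume "k \<notin> {..m}"
    hence "2 * m < m + Suc k * (2 * q + 1)" by auto
    thus "?c k = 0" by (simp del: mult_Suc mult_Suc_right add_Suc_right)
  qed auto
  have pos: "real (2 * m choose m) > 0" by simp
  have "(\<Sum>k. ?c k / real (2 * m choose m)) = (\<Sum>k. ?c k) / real (2 * m choose m)"
    by (rule suminf_divide[OF summ])
  moreover have "4 ^ m * (1 + 2 * (\<Sum>j<q. cos (pi * real (Suc j) / real (2 * q + 1)) ^ (2 * m))) =
      real ?l * (real (2 * m choose m) + 2 * (\<Sum>k. ?c k))"
    using sum_cos_power_eq_binomial[of ?l m] sum_cos_power_symmetric[of q m] by simp
  ultimately show ?thesis using pos by (simp add: field_simps)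
qed

text \<open>Wallis' product: by \<open>W\<close>, the square of the normalised central binomial
  coefficient times \<open>2 * n + 1\<close> is the reciprocal of the \<open>n\<close>-th partial
  product, whose limit is \<open>pi / 2\<close>.\<close>

lemma central_binomial_asymptotic:
  "(\<lambda>n. sqrt n * real (2 * n choose n) / 4 ^ n) \<longlonglongrightarrow> 1 / sqrt pi"
proof -
  have rec: "real (2 * Suc n choose Suc n) / 4 ^ Suc n =
      real (2 * n choose n) / 4 ^ n * (real (2 * n + 1) / real (2 * n + 2))" for n
  proof -
    have "Suc n * (2 * Suc n choose Suc n) = 2 * Suc n * (2 * n + 1 choose n)"
      using Suc_times_binomial_eq[of "2 * n + 1" n] by (simp add: mult_ac)
    hence 1: "(2 * Suc n choose Suc n) = 2 * (2 * n + 1 choose n)"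
      by (metis mult.assoc mult.left_commute mult_cancel_left nat.distinct(1))
    have "(2 * n + 1) * (2 * n choose n) = (2 * n + 1 choose Suc n) * Suc n"
      using Suc_times_binomial_eq[of "2 * n" n] by simp
    moreover have "(2 * n + 1 choose Suc n) = (2 * n + 1 choose n)"
      using binomial_symmetric[of n "2 * n + 1"] by simp
    ultimately have "real (2 * n + 1) * real (2 * n choose n) = real (2 * n + 1 choose n) * real (Suc n)"
      by (metis of_nat_mult)
    hence "real (2 * n + 1 choose n) = real (2 * n + 1) * real (2 * n choose n) / real (Suc n)"
      by (simp add: field_simps)
    hence eq: "real (2 * Suc n choose Suc n) = 2 * (real (2 * n + 1) * real (2 * n choose n) / real (Suc n))"
      unfolding 1 by (simp only: of_nat_mult of_nat_numeral)
    have "2 * (real (2 * n + 1) * c / real (Suc n)) / 4 ^ Suc n = c / 4 ^ n * (real (2 * n + 1) / real (2 * n + 2))" for c :: real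
      by (simp add: divide_simps)
    thus ?thesis unfolding eq .
  qed
  have W: "(real (2 * n choose n) / 4 ^ n)\<^sup>2 * (2 * n + 1) * (\<Prod>k=1..n. (4*real k^2) / (4*real k^2 - 1)) = 1" for n
  proof (induction n)
    case (Suc n)
    let ?P = "\<Prod>k=1..n. (4*real k^2) / (4*real k^2 - 1)"
    let ?a = "real (2 * n choose n) / 4 ^ n"
    have f: "4 * (real (Suc n))\<^sup>2 - 1 = (2 * n + 1) * (2 * n + 3)"
      by (simp add: power2_eq_square algebra_simps)
    have "(?a * ((2 * n + 1) / (2 * n + 2)))\<^sup>2 * (2 * Suc n + 1) *
            (?P * ((4 * (real (Suc n))\<^sup>2) / (4 * (real (Suc n))\<^sup>2 - 1)))
        = (?a\<^sup>2 * (2 * n + 1) * ?P) *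
          (((2 * n + 1) * (2 * Suc n + 1) * (4 * (real (Suc n))\<^sup>2)) / ((2 * n + 2)\<^sup>2 * (4 * (real (Suc n))\<^sup>2 - 1)))"
    proof -
      have "(a * (b / c))\<^sup>2 * s * (p * (x / y)) = (a\<^sup>2 * b * p) * ((b * s * x) / (c\<^sup>2 * y))"
        for a b c s p x y :: real
        by (simp add: power2_eq_square)
      thus ?thesis unfolding of_nat_mult of_nat_power by blast
    qed
    also have "((2 * n + 1) * (2 * Suc n + 1) * (4 * (real (Suc n))\<^sup>2)) / ((2 * n + 2)\<^sup>2 * (4 * (real (Suc n))\<^sup>2 - 1)) = 1"
    proof -
      have g: "4 * (real (Suc n))\<^sup>2 = real ((2 * n + 2)\<^sup>2)"
        by (simp add: power2_eq_square algebra_simps)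
      have e: "2 * Suc n + 1 = 2 * n + 3" by simp
      have "a * b / (b * a) = 1" if "a \<noteq> 0" "b \<noteq> 0" for a b :: real
        using that by simp
      thus ?thesis unfolding f unfolding g e by this (simp only: of_nat_eq_0_iff, simp)+
    qed
    finally have step: "(?a * ((2 * n + 1) / (2 * n + 2)))\<^sup>2 * (2 * Suc n + 1) *
            (?P * ((4 * (real (Suc n))\<^sup>2) / (4 * (real (Suc n))\<^sup>2 - 1))) = ?a\<^sup>2 * (2 * n + 1) * ?P * 1" .
    have P: "(\<Prod>k=1..Suc n. (4*real k^2) / (4*real k^2 - 1)) = ?P * ((4 * (real (Suc n))\<^sup>2) / (4 * (real (Suc n))\<^sup>2 - 1))"
      by simp
    show ?case
      unfolding rec P step using Suc.IH by (simp only: mult_1_right)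
  qed auto
  have "(\<lambda>n. (real n / (2 * n + 1)) * inverse (\<Prod>k=1..n. (4*real k^2) / (4*real k^2 - 1))) \<longlonglongrightarrow> 1 / 2 * inverse (pi / 2)"
    by (intro tendsto_mult tendsto_inverse wallis) (real_asymp | simp)+
  moreover have "real n / real (2 * n + 1) * inverse (\<Prod>k=1..n. (4*real k^2) / (4*real k^2 - 1)) =
      (sqrt (real n) * real (2 * n choose n) / 4 ^ n)\<^sup>2" for n :: nat
  proof -
    have inv: "inverse (\<Prod>k=1..n. (4*real k^2) / (4*real k^2 - 1)) = (real (2 * n choose n) / 4 ^ n)\<^sup>2 * real (2 * n + 1)"
      by (rule inverse_unique) (use W[of n] in \<open>simp only: mult.commute\<close>)
    have cancel: "real n / real (2 * n + 1) * (c * real (2 * n + 1)) = real n * c" for c :: real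
      by simp
    show ?thesis
      unfolding inv cancel by (simp only: power_mult_distrib power_divide real_sqrt_pow2 of_nat_0_le_iff times_divide_eq_right)
  qed
  ultimately have "(\<lambda>n. (sqrt (real n) * real (2 * n choose n) / 4 ^ n)\<^sup>2) \<longlonglongrightarrow> 1 / 2 * inverse (pi / 2)"
    by (simp only:)
  hence "(\<lambda>n. sqrt ((sqrt n * real (2 * n choose n) / 4 ^ n)\<^sup>2)) \<longlonglongrightarrow> sqrt (1 / 2 * inverse (pi / 2))"
    by (rule tendsto_real_sqrt)
  thus ?thesis by (simp add: real_sqrt_mult real_sqrt_divide field_simps)
qed

text \<open>Sandwich by exponentials: \<open>- u - 2 * u\<^sup>2 \<le> ln (1 - u) \<le> - u\<close>
  for small \<open>u\<close>, and the quadratic term accumulates to \<open>2 * (N * u) * u\<close>,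
  which tends to 0.\<close>

lemma power_one_minus_tendsto_exp:
  fixes u :: "nat \<Rightarrow> real" and N :: "nat \<Rightarrow> nat"
  assumes "u \<longlonglongrightarrow> 0" and lim: "(\<lambda>q. N q * u q) \<longlonglongrightarrow> L" and "\<And>q. u q \<ge> 0"
  shows "(\<lambda>q. (1 - u q) ^ N q) \<longlonglongrightarrow> exp (- L)"
proof (rule tendsto_sandwich)
  have le: "(\<lambda>q. - (N q * u q) - 2 * (N q * u q) * u q) \<longlonglongrightarrow> - L - 2 * L * 0"
    by (intro tendsto_intros lim assms)
  show "(\<lambda>q. exp (- (N q * u q) - 2 * (N q * u q) * u q)) \<longlonglongrightarrow> exp (- L)"
    using tendsto_exp[OF le] by simp
  show "(\<lambda>q. exp (- (N q * u q))) \<longlonglongrightarrow> exp (- L)"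
    by (intro tendsto_intros lim)
  have ev: "eventually (\<lambda>q. u q < 1 / 2) sequentially"
    using assms(1) by (rule order_tendstoD) auto
  show "eventually (\<lambda>q. exp (- (N q * u q) - 2 * (N q * u q) * u q) \<le> (1 - u q) ^ N q) sequentially"
    using ev
  proof eventually_elim
    case (elim q)
    have "- u q - 2 * (u q)\<^sup>2 \<le> ln (1 - u q)"
      using elim assms(3)[of q] by (intro ln_one_minus_pos_lower_bound) auto
    hence "exp (- u q - 2 * (u q)\<^sup>2) \<le> 1 - u q"
      using elim by (subst (asm) ln_ge_iff) auto
    hence "exp (- u q - 2 * (u q)\<^sup>2) ^ N q \<le> (1 - u q) ^ N q"
      by (rule power_mono) auto
    thus ?case
      by (simp add: exp_of_nat_mult[symmetric] algebra_simps power2_eq_square)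
  qed
  show "eventually (\<lambda>q. (1 - u q) ^ N q \<le> exp (- (N q * u q))) sequentially"
    using ev
  proof eventually_elim
    case (elim q)
    have "(1 - u q) ^ N q \<le> exp (- u q) ^ N q"
      using elim exp_ge_add_one_self[of "- u q"] by (intro power_mono) auto
    thus ?case by (simp add: exp_of_nat_mult[symmetric])
  qed
qed

text \<open>The quotient of the two sides decreases, because its derivative has the sign of
  \<open>t * cos t - sin t\<close>. This supplies the majorant on the cosine side of the
  limit.\<close>

lemma cos_le_exp_neg_square:
  fixes t :: real
  assumes "0 \<le> t" "t \<le> pi / 2"
  shows "cos t \<le> exp (- (t\<^sup>2 / 2))"
proof -
  have sin: "x * cos x \<le> sin x" if "0 \<le> x" "x \<le> pi / 2" for x :: real
  proof -
    have "sin 0 - 0 * cos 0 \<le> sin x - x * cos x"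
    proof (rule DERIV_nonneg_imp_nondecreasing[OF that(1)])
      fix y assume "0 \<le> y" "y \<le> x"
      hence "y * sin y \<ge> 0" using that sin_ge_zero[of y] by auto
      moreover have "((\<lambda>x. sin x - x * cos x) has_real_derivative y * sin y) (at y)"
        by (auto intro!: derivative_eq_intros)
      ultimately show "\<exists>d. ((\<lambda>x. sin x - x * cos x) has_real_derivative d) (at y) \<and> 0 \<le> d" by blast
    qed
    thus ?thesis by simp
  qed
  have "cos t * exp (t\<^sup>2 / 2) \<le> cos 0 * exp (0\<^sup>2 / 2)"
  proof (rule DERIV_nonpos_imp_nonincreasing[OF assms(1)])
    fix y assume y: "0 \<le> y" "y \<le> t"
    have "(y * cos y - sin y) * exp (y\<^sup>2 / 2) \<le> 0"
      using sin[of y] y assms by (intro mult_nonpos_nonneg) auto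
    moreover have "((\<lambda>x. cos x * exp (x\<^sup>2 / 2)) has_real_derivative (y * cos y - sin y) * exp (y\<^sup>2 / 2)) (at y)"
      by (auto intro!: derivative_eq_intros simp: algebra_simps)
    ultimately show "\<exists>d. ((\<lambda>x. cos x * exp (x\<^sup>2 / 2)) has_real_derivative d) (at y) \<and> d \<le> 0" by blast
  qed
  thus ?thesis by (simp add: exp_minus field_simps)
qed

text \<open>The ratio is the product of \<open>(m + 1 - i) / (m + i)\<close>. Reversing the order of
  the numerators makes the factors \<open>1 - r / (m + i)\<close>, which lie between those at
  \<open>i = 1\<close> and \<open>i = r\<close>.\<close>

lemma binomial_ratio_bounds:
  fixes m r :: nat
  assumes "r \<le> m"
  defines "b \<equiv> real (2 * m choose (m + r)) / real (2 * m choose m)"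
  shows "(1 - r / (m + 1)) ^ r \<le> b" "b \<le> (1 - r / (m + r)) ^ r"
proof -
  have b: "b = (\<Prod>i=1..r. 1 - r / (m + i))"
  proof -
    have "real (2 * m choose (m + k)) / real (2 * m choose m) = (\<Prod>i=1..k. (m + 1 - i) / (m + i))" if "k \<le> m" for k
      using that
    proof (induction k)
      case (Suc k)
      have "(2 * m choose (m + k)) * (2 * m - (m + k)) = (2 * m choose Suc (m + k)) * Suc (m + k)"
        using binomial_absorb_comp[of "2 * m" "m + k"] binomial_absorption[of "m + k" "2 * m"]
        by (metis (no_types, opaque_lifting) mult.commute)
      hence "real (2 * m choose (m + k)) * real (m - k) = real (2 * m choose (m + Suc k)) * real (m + Suc k)"
        by (metis add_Suc_right add_diff_cancel_left mult_2 of_nat_mult)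
      hence "real (2 * m choose (m + Suc k)) = real (2 * m choose (m + k)) * ((m + 1 - Suc k) / (m + Suc k))"
        using Suc.prems by (simp add: field_simps of_nat_diff)
      hence "real (2 * m choose (m + Suc k)) / real (2 * m choose m) =
          real (2 * m choose (m + k)) / real (2 * m choose m) * ((m + 1 - Suc k) / (m + Suc k))"
        by (simp only: times_divide_eq_left)
      also have "\<dots> = (\<Prod>i=1..k. (m + 1 - i) / (m + i)) * ((m + 1 - Suc k) / (m + Suc k))"
        using Suc by simp
      finally show ?case by (simp only: prod.cl_ivl_Suc) auto
    qed auto
    hence "b = (\<Prod>i=1..r. (m + 1 - i) / (m + i))"
      using assms by (simp add: b_def)
    also have "\<dots> = (\<Prod>i=1..r. real (m + 1 - i)) / (\<Prod>i=1..r. real (m + i))"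
      by (simp add: prod_dividef)
    also have "(\<Prod>i=1..r. real (m + 1 - i)) = (\<Prod>i=1..r. real (m + i - r))"
      by (rule prod.reindex_bij_witness[of _ "\<lambda>i. r + 1 - i" "\<lambda>i. r + 1 - i"])
        (use assms in \<open>auto intro!: arg_cong[of _ _ real]\<close>)
    also have "(\<Prod>i=1..r. real (m + i - r)) / (\<Prod>i=1..r. real (m + i)) = (\<Prod>i=1..r. real (m + i - r) / real (m + i))"
      by (simp add: prod_dividef)
    also have "\<dots> = (\<Prod>i=1..r. 1 - r / (m + i))"
      using assms by (intro prod.cong) (auto simp: of_nat_diff field_simps)
    finally show ?thesis .
  qed
  have "(\<Prod>i=1..r. 1 - real r / (m + 1)) \<le> b"
    unfolding b using assms by (intro prod_mono conjI diff_left_mono divide_left_mono) (auto simp: divide_simps)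
  thus "(1 - r / (m + 1)) ^ r \<le> b" by simp
  have "b \<le> (\<Prod>i=1..r. 1 - real r / (m + r))"
    unfolding b using assms by (intro prod_mono conjI diff_left_mono divide_left_mono) (auto simp: divide_simps)
  thus "b \<le> (1 - r / (m + r)) ^ r" by simp
qed

text \<open>The upper product bound with \<open>m + r \<le> 2 * m\<close>; beyond
  \<open>r = m\<close> the binomial coefficient vanishes. The estimate holds for all
  \<open>r\<close> at once and so supplies the majorant on the binomial side.\<close>

lemma binomial_ratio_le_exp:
  fixes m r :: nat
  shows "real (2 * m choose (m + r)) / real (2 * m choose m) \<le> exp (- (real r ^ 2 / (2 * m)))"
proof (cases "r \<le> m")
  case True
  show ?thesis
  proof (cases "m = 0")
    case False
    have "real (2 * m choose (m + r)) / real (2 * m choose m) \<le> (1 - r / (m + r)) ^ r"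
      by (rule binomial_ratio_bounds(2)[OF True])
    also have "\<dots> \<le> exp (- (r / (m + r))) ^ r"
      using exp_ge_add_one_self[of "- (r / (m + r))"] False by (intro power_mono) (auto simp: divide_simps)
    also have "\<dots> = exp (- (real r ^ 2 / (m + r)))"
      by (simp add: exp_of_nat_mult[symmetric] power2_eq_square)
    also have "\<dots> \<le> exp (- (real r ^ 2 / (2 * m)))"
      using True False by (auto intro!: divide_left_mono)
    finally show ?thesis .
  qed (use True in auto)
qed (auto simp: binomial_eq_0)

text \<open>Jacobi's theta series over all integers is \<open>1 + 2 * theta_tail x\<close>.\<close>

definition theta_tail :: "real \<Rightarrow> real" where
  "theta_tail x = (\<Sum>k. exp (- (pi * real (Suc k) ^ 2 * x)))"

lemma exp_neg_square_le:
  assumes "d > 0"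
  shows "exp (- (d * real (Suc k) ^ 2)) \<le> exp (- d) ^ Suc k"
proof -
  have "real (Suc k) \<le> real (Suc k) ^ 2" by (simp add: power2_eq_square)
  hence "d * real (Suc k) \<le> d * real (Suc k) ^ 2" using assms by (intro mult_left_mono) auto
  thus ?thesis
    by (simp only: exp_of_nat_mult[symmetric] exp_le_cancel_iff) (simp add: algebra_simps)
qed

lemma summable_exp_neg: "d > 0 \<Longrightarrow> summable (\<lambda>k. exp (- d :: real) ^ Suc k)"
  by (subst summable_Suc_iff) (rule summable_geometric, auto)

section \<open>The limit of the binomial identity\<close>

context
  fixes x :: real and m :: "nat \<Rightarrow> nat" and l :: "nat \<Rightarrow> real"
  assumes x: "x > 0"
  defines "l \<equiv> \<lambda>q. real (2 * q + 1)"
  defines "m \<equiv> \<lambda>q. nat \<lfloor>x / pi * l q ^ 2\<rfloor>"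
begin

private lemma l_pos: "l q > 0" by (simp add: l_def)

private lemma m_le: "real (m q) \<le> x / pi * l q ^ 2"
  unfolding m_def using x by (intro of_nat_floor) auto

private lemma m_ge: "real (m q) \<ge> x / pi * l q ^ 2 - 1"
  unfolding m_def by linarith

private lemma m_lim: "(\<lambda>q. real (m q) / l q ^ 2) \<longlonglongrightarrow> x / pi"
proof (rule tendsto_sandwich)
  show "eventually (\<lambda>q. x / pi - 1 / l q ^ 2 \<le> real (m q) / l q ^ 2) sequentially"
  proof (intro always_eventually allI)
    fix q
    have "x / pi - 1 / l q ^ 2 = (x / pi * l q ^ 2 - 1) / l q ^ 2"
      using l_pos[of q] by (simp add: diff_divide_distrib)
    also have "\<dots> \<le> real (m q) / l q ^ 2"
      by (intro divide_right_mono m_ge) auto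
    finally show "x / pi - 1 / l q ^ 2 \<le> real (m q) / l q ^ 2" .
  qed
  show "eventually (\<lambda>q. real (m q) / l q ^ 2 \<le> x / pi) sequentially"
    by (intro always_eventually allI, subst pos_divide_le_eq) (rule zero_less_power[OF l_pos], rule m_le)
  show "(\<lambda>q. x / pi - 1 / l q ^ 2) \<longlonglongrightarrow> x / pi"
    unfolding l_def by real_asymp
qed auto

private lemma m_at_top: "filterlim m at_top sequentially"
proof -
  have "filterlim (\<lambda>q. x / pi * l q ^ 2 - 1) at_top sequentially"
    unfolding l_def using x by real_asymp
  hence "filterlim (\<lambda>q. real (m q)) at_top sequentially"
    by (rule filterlim_at_top_mono) (use m_ge in auto)
  thus ?thesis by (simp add: filterlim_sequentially_iff_filterlim_real)
qed

text \<open>Since \<open>m\<close> is asymptotic to \<open>x / pi * l\<^sup>2\<close>, the quotient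
  \<open>l / sqrt m\<close> tends to \<open>sqrt (pi / x)\<close>, and \<open>sqrt pi\<close>
  cancels against the central binomial asymptotic.\<close>

private lemma prefactor_lim: "(\<lambda>q. l q * real (2 * m q choose m q) / 4 ^ m q) \<longlonglongrightarrow> 1 / sqrt x"
proof -
  have "(\<lambda>q. sqrt (m q) * real (2 * m q choose m q) / 4 ^ m q) \<longlonglongrightarrow> 1 / sqrt pi"
    by (rule filterlim_compose[OF central_binomial_asymptotic m_at_top])
  moreover have "(\<lambda>q. 1 / sqrt (real (m q) / l q ^ 2)) \<longlonglongrightarrow> 1 / sqrt (x / pi)"
    using x by (intro tendsto_intros m_lim) auto
  ultimately have "(\<lambda>q. 1 / sqrt (real (m q) / l q ^ 2) * (sqrt (m q) * real (2 * m q choose m q) / 4 ^ m q))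
      \<longlonglongrightarrow> 1 / sqrt (x / pi) * (1 / sqrt pi)"
    by (intro tendsto_mult)
  also have "1 / sqrt (x / pi) * (1 / sqrt pi) = 1 / sqrt x"
    by (simp add: real_sqrt_divide)
  finally show ?thesis
  proof (rule Lim_transform_eventually)
    show "eventually (\<lambda>q. 1 / sqrt (real (m q) / l q ^ 2) * (sqrt (m q) * real (2 * m q choose m q) / 4 ^ m q) =
        l q * real (2 * m q choose m q) / 4 ^ m q) sequentially"
      using eventually_compose_filterlim[OF eventually_gt_at_top[of 0] m_at_top]
      by eventually_elim (use l_pos in \<open>simp add: real_sqrt_divide less_imp_le\<close>)
  qed
qed

private lemma m_ratio_ge: "eventually (\<lambda>q. real (m q) / l q ^ 2 \<ge> x / (2 * pi)) sequentially"
proof -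
  have "eventually (\<lambda>q. real (m q) / l q ^ 2 > x / (2 * pi)) sequentially"
    by (rule order_tendstoD(1)[OF m_lim]) (use x in \<open>auto simp: field_simps\<close>)
  thus ?thesis by eventually_elim auto
qed

text \<open>With \<open>K = Suc j\<close>, \<open>1 - cos (pi * K / l)\<close> behaves like
  \<open>pi\<^sup>2 * K\<^sup>2 / (2 * l\<^sup>2)\<close>; times \<open>2 * m\<close> this tends to
  the theta exponent. Tannery's theorem passes from the terms to the sum.\<close>

private lemma cos_sum_lim:
  "(\<lambda>q. \<Sum>j<q. cos (pi * real (Suc j) / l q) ^ (2 * m q)) \<longlonglongrightarrow> theta_tail x"
proof -
  define a where "a j q = (if j < q then cos (pi * real (Suc j) / l q) ^ (2 * m q) else 0)" for j q
  \<comment> \<open>Half of the limiting rate \<open>x * pi\<close>, because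
    \<open>m / l\<^sup>2\<close> is eventually at least half of its limit.\<close>
  define d where "d = x * pi / 2"
  have d: "d > 0" using x by (simp add: d_def)
  have "(\<lambda>q. \<Sum>j. a j q) \<longlonglongrightarrow> (\<Sum>j. exp (- (pi * real (Suc j) ^ 2 * x)))"
  proof (rule conjunct2[OF conjunct2[OF tannerys_theorem]])
    fix j
    define K where "K = real (Suc j)"
    have K: "K > 0" by (simp add: K_def)
    define u where "u q = 1 - cos (pi * K / l q)" for q
    have "(\<lambda>q. l q ^ 2 * u q) \<longlonglongrightarrow> pi ^ 2 * K ^ 2 / 2"
      unfolding l_def u_def using K by real_asymp (simp add: power2_eq_square)
    hence "(\<lambda>q. 2 * (real (m q) / l q ^ 2) * (l q ^ 2 * u q)) \<longlonglongrightarrow> 2 * (x / pi) * (pi ^ 2 * K ^ 2 / 2)"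
      by (intro tendsto_intros m_lim)
    also have "(\<lambda>q. 2 * (real (m q) / l q ^ 2) * (l q ^ 2 * u q)) = (\<lambda>q. real (2 * m q) * u q)"
      using l_pos by (auto simp: fun_eq_iff less_imp_neq[symmetric])
    also have "2 * (x / pi) * (pi ^ 2 * K ^ 2 / 2) = pi * K ^ 2 * x"
      by (simp add: power2_eq_square)
    finally have lim: "(\<lambda>q. real (2 * m q) * u q) \<longlonglongrightarrow> pi * K ^ 2 * x" .
    have u0: "u \<longlonglongrightarrow> 0"
      unfolding u_def l_def by real_asymp
    have "(\<lambda>q. (1 - u q) ^ (2 * m q)) \<longlonglongrightarrow> exp (- (pi * K ^ 2 * x))"
      by (rule power_one_minus_tendsto_exp[OF u0 lim]) (simp add: u_def)
    hence "(\<lambda>q. (1 - u q) ^ (2 * m q)) \<longlonglongrightarrow> exp (- (pi * real (Suc j) ^ 2 * x))"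
      by (simp add: K_def)
    thus "(\<lambda>q. a j q) \<longlonglongrightarrow> exp (- (pi * real (Suc j) ^ 2 * x))"
    proof (rule Lim_transform_eventually)
      show "eventually (\<lambda>q. (1 - u q) ^ (2 * m q) = a j q) sequentially"
        using eventually_gt_at_top[of j] by eventually_elim (simp add: a_def u_def K_def)
    qed
  next
    have bound: "norm (a j q) \<le> exp (- d) ^ Suc j" if q: "real (m q) / l q ^ 2 \<ge> x / (2 * pi)" for j q
    proof (cases "j < q")
      case True
      define t where "t = pi * real (Suc j) / l q"
      have t: "0 \<le> t" "t \<le> pi / 2" using True l_pos[of q] by (auto simp: t_def l_def divide_simps)
      have "norm (a j q) = cos t ^ (2 * m q)"
        using True t cos_ge_zero[of t] by (simp add: a_def t_def)
      also have "\<dots> \<le> exp (- (t\<^sup>2 / 2)) ^ (2 * m q)"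
        using t by (intro power_mono cos_le_exp_neg_square cos_ge_zero) auto
      also have "\<dots> = exp (- (real (m q) / l q ^ 2 * (pi\<^sup>2 * real (Suc j) ^ 2)))"
        by (simp add: exp_of_nat_mult[symmetric] t_def power_divide power_mult_distrib)
      also have "\<dots> \<le> exp (- (x / (2 * pi) * (pi\<^sup>2 * real (Suc j) ^ 2)))"
        unfolding exp_le_cancel_iff neg_le_iff_le by (intro mult_right_mono q) auto
      also have "\<dots> = exp (- (d * real (Suc j) ^ 2))"
        by (simp add: d_def power2_eq_square)
      also have "\<dots> \<le> exp (- d) ^ Suc j" by (rule exp_neg_square_le[OF d])
      finally show ?thesis .
    qed (auto simp: a_def)
    show "eventually (\<lambda>(j,q). norm (a j q) \<le> exp (- d) ^ Suc j) (at_top \<times>\<^sub>F sequentially)"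
      by (rule eventually_mono[OF eventually_prodI[OF eventually_True m_ratio_ge]])
        (auto simp: case_prod_beta simp del: power_Suc real_norm_def intro!: bound)
  qed (use summable_exp_neg[OF d] in auto)
  also have "(\<lambda>q. \<Sum>j. a j q) = (\<lambda>q. \<Sum>j<q. cos (pi * real (Suc j) / l q) ^ (2 * m q))"
  proof
    fix q
    have "(\<Sum>j. a j q) = (\<Sum>j<q. a j q)" by (rule suminf_finite) (auto simp: a_def)
    thus "(\<Sum>j. a j q) = (\<Sum>j<q. cos (pi * real (Suc j) / l q) ^ (2 * m q))" by (simp add: a_def)
  qed
  finally show ?thesis by (simp add: theta_tail_def)
qed

text \<open>Here \<open>r = K * l\<close> has order \<open>l\<close> while \<open>m\<close> has
  order \<open>l\<^sup>2\<close>, so \<open>r\<^sup>2 / (m + 1)\<close> and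
  \<open>r\<^sup>2 / (m + r)\<close> have the same limit \<open>K\<^sup>2 * pi / x\<close>, and the
  two product bounds enclose each term.\<close>

private lemma binomial_sum_lim:
  "(\<lambda>q. \<Sum>k. real (2 * m q choose (m q + Suc k * (2 * q + 1))) / real (2 * m q choose m q))
     \<longlonglongrightarrow> theta_tail (1 / x)"
proof -
  define b where "b k q = real (2 * m q choose (m q + Suc k * (2 * q + 1))) / real (2 * m q choose m q)" for k q
  \<comment> \<open>Half of the limiting rate \<open>pi / x\<close>: the loss comes from the
    estimate \<open>m + r \<le> 2 * m\<close> in \<open>binomial_ratio_le_exp\<close>.\<close>
  define d where "d = pi / (2 * x)"
  have d: "d > 0" using x by (simp add: d_def)
  have "(\<lambda>q. \<Sum>k. b k q) \<longlonglongrightarrow> (\<Sum>k. exp (- (pi * real (Suc k) ^ 2 * (1 / x))))"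
  proof (rule conjunct2[OF conjunct2[OF tannerys_theorem]])
    fix k
    define K where "K = real (Suc k)"
    have K: "K > 0" by (simp add: K_def)
    define r where "r q = Suc k * (2 * q + 1)" for q
    have r: "real (r q) = K * l q" for q by (simp add: r_def K_def l_def algebra_simps)
    have l_inv: "(\<lambda>q. 1 / l q) \<longlonglongrightarrow> 0" "(\<lambda>q. 1 / l q ^ 2) \<longlonglongrightarrow> 0"
      unfolding l_def by real_asymp+
    have x': "x / pi \<noteq> 0" using x by simp
    have "(\<lambda>q. K ^ 2 / (real (m q) / l q ^ 2 + 1 / l q ^ 2)) \<longlonglongrightarrow> K ^ 2 / (x / pi + 0)"
      using x' by (intro tendsto_intros m_lim l_inv) auto
    also have "(\<lambda>q. K ^ 2 / (real (m q) / l q ^ 2 + 1 / l q ^ 2)) = (\<lambda>q. r q * (r q / (m q + 1)))"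
      unfolding r add_divide_distrib[symmetric] by (simp add: power2_eq_square mult_ac add_ac)
    finally have lim1: "(\<lambda>q. r q * (r q / (m q + 1))) \<longlonglongrightarrow> K ^ 2 / (x / pi)" by simp
    have "(\<lambda>q. K ^ 2 / (real (m q) / l q ^ 2 + K * (1 / l q))) \<longlonglongrightarrow> K ^ 2 / (x / pi + K * 0)"
      using x' by (intro tendsto_intros m_lim l_inv) auto
    also have "(\<lambda>q. K ^ 2 / (real (m q) / l q ^ 2 + K * (1 / l q))) = (\<lambda>q. r q * (r q / (m q + r q)))"
    proof
      fix q
      have "real (m q) / l q ^ 2 + K * (1 / l q) = (m q + K * l q) / l q ^ 2"
        using l_pos[of q] by (simp add: field_simps power2_eq_square)
      thus "K ^ 2 / (real (m q) / l q ^ 2 + K * (1 / l q)) = r q * (r q / (m q + r q))"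
        unfolding of_nat_add r by (simp add: power2_eq_square mult_ac)
    qed
    finally have lim2: "(\<lambda>q. r q * (r q / (m q + r q))) \<longlonglongrightarrow> K ^ 2 / (x / pi)" by simp
    have r_inv: "(\<lambda>q. 1 / real (r q)) \<longlonglongrightarrow> 0"
      using tendsto_mult[OF tendsto_const[of "1 / K"] l_inv(1)] by (simp add: r)
    have rpos: "r q \<noteq> 0" for q by (simp add: r_def)
    have u1: "(\<lambda>q. r q / (m q + 1)) \<longlonglongrightarrow> 0"
      using tendsto_mult[OF r_inv lim1] by (simp add: rpos)
    have u2: "(\<lambda>q. r q / (m q + r q)) \<longlonglongrightarrow> 0"
      using tendsto_mult[OF r_inv lim2] by (simp add: rpos)
    have ev: "eventually (\<lambda>q. r q \<le> m q) sequentially"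
    proof -
      have "eventually (\<lambda>q. r q / (m q + 1) < 1) sequentially"
        by (rule order_tendstoD(2)[OF u1]) auto
      thus ?thesis by eventually_elim (simp add: divide_simps)
    qed
    have "b k \<longlonglongrightarrow> exp (- (K ^ 2 / (x / pi)))"
    proof (rule tendsto_sandwich)
      show "(\<lambda>q. (1 - r q / (m q + 1)) ^ r q) \<longlonglongrightarrow> exp (- (K ^ 2 / (x / pi)))"
        by (rule power_one_minus_tendsto_exp[OF u1 lim1]) auto
      show "(\<lambda>q. (1 - r q / (m q + r q)) ^ r q) \<longlonglongrightarrow> exp (- (K ^ 2 / (x / pi)))"
        by (rule power_one_minus_tendsto_exp[OF u2 lim2]) auto
      show "eventually (\<lambda>q. (1 - r q / (m q + 1)) ^ r q \<le> b k q) sequentially"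
        using ev by eventually_elim (use binomial_ratio_bounds(1) in \<open>simp only: b_def r_def\<close>)
      show "eventually (\<lambda>q. b k q \<le> (1 - r q / (m q + r q)) ^ r q) sequentially"
        using ev by eventually_elim (use binomial_ratio_bounds(2) in \<open>simp only: b_def r_def\<close>)
    qed
    thus "(\<lambda>q. b k q) \<longlonglongrightarrow> exp (- (pi * real (Suc k) ^ 2 * (1 / x)))"
      by (simp add: K_def mult_ac)
  next
    have bound: "norm (b k q) \<le> exp (- d) ^ Suc k" if q: "m q > 0" for k q
    proof -
      have "norm (b k q) = b k q" by (simp add: b_def)
      also have "\<dots> \<le> exp (- (real (Suc k * (2 * q + 1)) ^ 2 / (2 * m q)))"
        unfolding b_def by (rule binomial_ratio_le_exp)
      also have "\<dots> \<le> exp (- (d * real (Suc k) ^ 2))"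
      proof -
        have "d * real (m q) \<le> l q ^ 2 / 2"
          using mult_left_mono[OF m_le[of q] less_imp_le[OF d]] x by (simp add: d_def)
        hence "d \<le> l q ^ 2 / (2 * m q)" using q by (simp add: field_simps)
        hence "d * real (Suc k) ^ 2 \<le> l q ^ 2 / (2 * m q) * real (Suc k) ^ 2"
          by (rule mult_right_mono) auto
        also have "\<dots> = real (Suc k * (2 * q + 1)) ^ 2 / (2 * m q)"
          unfolding of_nat_mult power_mult_distrib l_def by simp
        finally show ?thesis by (simp only: exp_le_cancel_iff neg_le_iff_le)
      qed
      also have "\<dots> \<le> exp (- d) ^ Suc k" by (rule exp_neg_square_le[OF d])
      finally show ?thesis .
    qed
    show "eventually (\<lambda>(k,q). norm (b k q) \<le> exp (- d) ^ Suc k) (at_top \<times>\<^sub>F sequentially)"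
      by (rule eventually_mono[OF eventually_prodI[OF eventually_True
            eventually_compose_filterlim[OF eventually_gt_at_top[of 0] m_at_top]]])
        (auto simp: case_prod_beta simp del: power_Suc real_norm_def intro!: bound)
  qed (use summable_exp_neg[OF d] in auto)
  thus ?thesis by (simp only: theta_tail_def b_def)
qed

theorem theta_functional_equation: "1 + 2 * theta_tail x = (1 + 2 * theta_tail (1 / x)) / sqrt x"
proof (rule LIMSEQ_unique)
  show "(\<lambda>q. 1 + 2 * (\<Sum>j<q. cos (pi * real (Suc j) / l q) ^ (2 * m q))) \<longlonglongrightarrow> 1 + 2 * theta_tail x"
    by (intro tendsto_intros cos_sum_lim)
  have "(\<lambda>q. l q * real (2 * m q choose m q) / 4 ^ m q *
       (1 + 2 * (\<Sum>k. real (2 * m q choose (m q + Suc k * (2 * q + 1))) / real (2 * m q choose m q))))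
     \<longlonglongrightarrow> 1 / sqrt x * (1 + 2 * theta_tail (1 / x))"
    by (intro tendsto_mult tendsto_add tendsto_const prefactor_lim binomial_sum_lim)
  thus "(\<lambda>q. 1 + 2 * (\<Sum>j<q. cos (pi * real (Suc j) / l q) ^ (2 * m q)))
      \<longlonglongrightarrow> (1 + 2 * theta_tail (1 / x)) / sqrt x"
    by (simp only: l_def Polya_identity) simp
qed

end

section \<open>The completed zeta function\<close>

lemma has_integral_Ici_imp_Ioi:
  fixes f :: "real \<Rightarrow> real"
  assumes "(f has_integral I) {a..}"
  shows "(f has_integral I) {a<..}"
  by (rule has_integral_spike_set_eq[THEN iffD1, OF _ _ assms])
    (auto intro!: negligible_subset[OF negligible_sing[of a]])

text \<open>Euler's integral after the substitution \<open>c * exp t\<close>. In the logarithmic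
  variable the inversion of \<open>x\<close> in the theta equation becomes a sign change of
  \<open>t\<close>, and as an integral in \<open>ennreal\<close> it may be exchanged freely with
  sums.\<close>

lemma Gamma_exp_integral:
  fixes a c :: real
  assumes "a > 0" "c > 0"
  shows "(\<integral>\<^sup>+t. ennreal (exp (a * t) * exp (- (c * exp t))) \<partial>lborel) = ennreal (Gamma a * c powr (- a))"
proof -
  define f where "f t = t powr (a - 1) / exp t" for t :: real
  have "(f has_integral Gamma a) {0..}"
    unfolding f_def by (rule Gamma_integral_real[OF assms(1)])
  hence f: "(f has_integral Gamma a) {0<..}"
    by (rule has_integral_Ici_imp_Ioi)
  hence "f absolutely_integrable_on {0<..}"
    by (intro nonnegative_absolutely_integrable_1) (auto simp: f_def has_integral_iff)
  moreover have img: "(\<lambda>t. c * exp t) ` UNIV = ({0<..} :: real set)"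
  proof (intro equalityI subsetI)
    fix y :: real assume "y \<in> {0<..}"
    hence "y = c * exp (ln (y / c))" using assms by simp
    thus "y \<in> (\<lambda>t. c * exp t) ` UNIV" by blast
  qed (use assms in auto)
  moreover have "integral {0<..} f = Gamma a" using f by (rule integral_unique)
  moreover have "(\<lambda>t. \<bar>c * exp t\<bar> * f (c * exp t)) absolutely_integrable_on UNIV \<and>
      integral UNIV (\<lambda>t. \<bar>c * exp t\<bar> * f (c * exp t)) = Gamma a \<longleftrightarrow>
      f absolutely_integrable_on range (\<lambda>t. c * exp t) \<and> integral (range (\<lambda>t. c * exp t)) f = Gamma a"
    by (rule has_absolute_integral_change_of_variables_1')
      (use assms in \<open>auto intro!: derivative_eq_intros simp: inj_on_def\<close>)
  ultimately have *: "(\<lambda>t. \<bar>c * exp t\<bar> * f (c * exp t)) absolutely_integrable_on UNIV"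
      "integral UNIV (\<lambda>t. \<bar>c * exp t\<bar> * f (c * exp t)) = Gamma a"
    by metis+
  have "\<bar>c * exp t\<bar> * f (c * exp t) = c powr a * (exp (a * t) * exp (- (c * exp t)))" for t
  proof -
    have "(c * exp t) * (c * exp t) powr (a - 1) = (c * exp t) powr a"
      using assms by (simp add: powr_diff)
    also have "\<dots> = c powr a * exp (a * t)"
      using assms by (simp add: powr_def ln_mult distrib_left exp_add mult.commute)
    finally show ?thesis
      using assms by (simp add: f_def exp_minus field_simps)
  qed
  hence "((\<lambda>t. c powr a * (exp (a * t) * exp (- (c * exp t)))) has_integral Gamma a) UNIV"
    using * by (simp add: has_integral_iff set_lebesgue_integral_eq_integral(1))
  hence "((\<lambda>t. c powr (-a) * (c powr a * (exp (a * t) * exp (- (c * exp t))))) has_integral c powr (-a) * Gamma a) UNIV"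
    by (rule has_integral_mult_right)
  also have "(\<lambda>t. c powr (-a) * (c powr a * (exp (a * t) * exp (- (c * exp t))))) =
      (\<lambda>t. exp (a * t) * exp (- (c * exp t)))"
    using assms by (simp add: powr_minus fun_eq_iff)
  finally have "integral\<^sup>N lborel (\<lambda>t. ennreal (indicator UNIV t * (exp (a * t) * exp (- (c * exp t))))) =
      ennreal (c powr (-a) * Gamma a)"
    by (intro nn_integral_has_integral_lebesgue) auto
  thus ?thesis by (simp add: mult.commute)
qed

lemma theta_tail_sums:
  assumes "x > 0"
  shows "summable (\<lambda>k. exp (- (pi * real (Suc k) ^ 2 * x)))"
proof (rule summable_comparison_test')
  show "summable (\<lambda>k. exp (- (pi * x)) ^ Suc k)"
    by (rule summable_exp_neg) (use assms in auto)
  show "norm (exp (- (pi * real (Suc k) ^ 2 * x))) \<le> exp (- (pi * x)) ^ Suc k" for k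
    using exp_neg_square_le[of "pi * x" k] assms by (simp add: mult_ac)
qed

lemma theta_tail_nonneg: "x > 0 \<Longrightarrow> theta_tail x \<ge> 0"
  unfolding theta_tail_def by (intro suminf_nonneg theta_tail_sums) auto

lemma theta_tail_measurable [measurable]: "theta_tail \<in> borel_measurable borel"
  unfolding theta_tail_def[abs_def] by measurable

definition real_zeta :: "real \<Rightarrow> real" where
  "real_zeta s = (\<Sum>n. real (Suc n) powr - s)"

lemma real_zeta_sums: "s > 1 \<Longrightarrow> (\<lambda>n. real (Suc n) powr - s) sums real_zeta s"
  unfolding real_zeta_def using summable_real_powr_iff[of "- s"]
  by (subst (asm) summable_Suc_iff[symmetric]) (auto intro: summable_sums)

definition completed_zeta :: "real \<Rightarrow> real" where
  "completed_zeta s = pi powr (- s / 2) * Gamma (s / 2) * real_zeta s"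

lemma theta_tail_Mellin:
  assumes s: "s > 1"
  shows "(\<integral>\<^sup>+t. ennreal (theta_tail (exp t) * exp (s / 2 * t)) \<partial>lborel) = ennreal (completed_zeta s)"
proof -
  have "ennreal (theta_tail (exp t) * exp (s / 2 * t)) =
      (\<Sum>k. ennreal (exp (s / 2 * t) * exp (- (pi * real (Suc k) ^ 2 * exp t))))" for t
  proof -
    have "(\<lambda>k. exp (s / 2 * t) * exp (- (pi * real (Suc k) ^ 2 * exp t))) sums (exp (s / 2 * t) * theta_tail (exp t))"
      unfolding theta_tail_def by (intro sums_mult summable_sums theta_tail_sums) auto
    thus ?thesis
      by (subst suminf_ennreal2) (auto simp: sums_iff mult.commute)
  qed
  hence "(\<integral>\<^sup>+t. ennreal (theta_tail (exp t) * exp (s / 2 * t)) \<partial>lborel) =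
     (\<integral>\<^sup>+t. (\<Sum>k. ennreal (exp (s / 2 * t) * exp (- (pi * real (Suc k) ^ 2 * exp t)))) \<partial>lborel)"
    by simp
  also have "\<dots> = (\<Sum>k. \<integral>\<^sup>+t. ennreal (exp (s / 2 * t) * exp (- (pi * real (Suc k) ^ 2 * exp t))) \<partial>lborel)"
    by (rule nn_integral_suminf) auto
  also have "\<dots> = (\<Sum>k. ennreal (Gamma (s / 2) * (pi * real (Suc k) ^ 2) powr (- (s / 2))))"
    using s by (intro suminf_cong Gamma_exp_integral) auto
  also have "\<dots> = (\<Sum>k. ennreal (pi powr (- s / 2) * Gamma (s / 2) * real (Suc k) powr - s))"
  proof (intro suminf_cong arg_cong[of _ _ ennreal])
    fix k
    have "(real (Suc k) ^ 2) powr (- (s / 2)) = (real (Suc k) powr 2) powr (- (s / 2))"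
      by (simp add: powr_realpow)
    also have "\<dots> = real (Suc k) powr - s" by (simp only: powr_powr) simp
    finally show "Gamma (s / 2) * (pi * real (Suc k) ^ 2) powr (- (s / 2)) =
        pi powr (- s / 2) * Gamma (s / 2) * real (Suc k) powr - s"
      by (simp add: powr_mult)
  qed
  also have "\<dots> = ennreal (completed_zeta s)"
    using s sums_mult[OF real_zeta_sums[OF s], of "pi powr (- s / 2) * Gamma (s / 2)"]
    by (subst suminf_ennreal2) (auto simp: sums_iff completed_zeta_def less_imp_le)
  finally show ?thesis .
qed

lemma nn_integral_fold:
  fixes g :: "real \<Rightarrow> ennreal"
  assumes [measurable]: "g \<in> borel_measurable borel"
  shows "(\<integral>\<^sup>+t. g t \<partial>lborel) = (\<integral>\<^sup>+t. indicator {0<..} t * (g t + g (- t)) \<partial>lborel)"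
proof -
  have "(\<integral>\<^sup>+t. g t \<partial>lborel) = (\<integral>\<^sup>+t. indicator {0<..} t * g t + indicator {..<0} t * g t \<partial>lborel)"
  proof (rule nn_integral_cong_AE)
    have "AE t in lborel. t \<noteq> (0 :: real)" by (rule AE_lborel_singleton)
    thus "AE t in lborel. g t = indicator {0<..} t * g t + indicator {..<0} t * g t"
      by eventually_elim (auto simp: indicator_def)
  qed
  also have "\<dots> = (\<integral>\<^sup>+t. indicator {0<..} t * g t \<partial>lborel) + (\<integral>\<^sup>+t. indicator {..<0} t * g t \<partial>lborel)"
    by (rule nn_integral_add) auto
  also have "(\<integral>\<^sup>+t. indicator {..<0} t * g t \<partial>lborel) =
      (\<integral>\<^sup>+t. indicator {0<..} t * g (- t) \<partial>lborel)"
    by (subst nn_integral_real_affine[of _ "-1" 0]) (auto simp: indicator_def intro!: nn_integral_cong)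
  also have "(\<integral>\<^sup>+t. indicator {0<..} t * g t \<partial>lborel) + (\<integral>\<^sup>+t. indicator {0<..} t * g (- t) \<partial>lborel) =
      (\<integral>\<^sup>+t. indicator {0<..} t * (g t + g (- t)) \<partial>lborel)"
    by (subst nn_integral_add[symmetric]) (auto simp: distrib_left)
  finally show ?thesis .
qed

lemma theta_tail_reflect:
  "theta_tail (exp (- t)) = exp (t / 2) * theta_tail (exp t) + (exp (t / 2) - 1) / 2"
proof -
  have "sqrt (exp t) = exp (t / 2)"
    by (rule real_sqrt_unique) (simp_all add: exp_double[symmetric])
  hence "1 + 2 * theta_tail (exp t) = (1 + 2 * theta_tail (exp (- t))) / exp (t / 2)"
    using theta_functional_equation[of "exp t"] by (simp add: exp_minus inverse_eq_divide)
  hence "1 + 2 * theta_tail (exp (- t)) = exp (t / 2) * (1 + 2 * theta_tail (exp t))"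
    by (simp add: field_simps)
  thus ?thesis by (simp add: field_simps)
qed

text \<open>Riemann's argument: fold the Mellin integral at \<open>t = 0\<close> and reflect the
  negative half by the theta equation. The two exponentials combine to a \<open>cosh\<close>, which
  is even in \<open>r\<close>; this is the symmetry between \<open>s\<close> and
  \<open>1 - s\<close> for \<open>s = r + 1/2\<close>.\<close>

lemma completed_zeta_cosh:
  assumes r: "r > 1 / 2"
  shows "ennreal (completed_zeta (r + 1 / 2)) =
    (\<integral>\<^sup>+t. indicator {0<..} t * ennreal (2 * exp (t / 4) * theta_tail (exp t) * cosh (r * t / 2)) \<partial>lborel)
      + ennreal (1 / (r ^ 2 - 1 / 4))"
proof -
  let ?s = "r + 1 / 2"
  have s: "?s > 1" using r by simp
  \<comment> \<open>The summand \<open>(exp (t / 2) - 1) / 2\<close> of the reflection formula times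
    the Mellin kernel at \<open>- t\<close>. Its integral \<open>1 / (r\<^sup>2 - 1/4)\<close> is
    \<open>1 / (s * (s - 1))\<close> and carries the poles.\<close>
  define u where "u t = (exp (- ((r - 1 / 2) / 2) * t) - exp (- ((r + 1 / 2) / 2) * t)) / 2" for t :: real
  have u_nonneg: "u t \<ge> 0" if "t > 0" for t using that by (simp add: u_def)
  have "ennreal (completed_zeta ?s) = (\<integral>\<^sup>+t. ennreal (theta_tail (exp t) * exp (?s / 2 * t)) \<partial>lborel)"
    by (rule theta_tail_Mellin[OF s, symmetric])
  also have "\<dots> = (\<integral>\<^sup>+t. indicator {0<..} t * (ennreal (theta_tail (exp t) * exp (?s / 2 * t)) +
      ennreal (theta_tail (exp (- t)) * exp (?s / 2 * (- t)))) \<partial>lborel)"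
    by (rule nn_integral_fold) auto
  also have "\<dots> = (\<integral>\<^sup>+t. indicator {0<..} t * ennreal (2 * exp (t / 4) * theta_tail (exp t) * cosh (r * t / 2))
      + indicator {0<..} t * ennreal (u t) \<partial>lborel)"
  proof (rule nn_integral_cong)
    fix t :: real
    show "indicator {0<..} t * (ennreal (theta_tail (exp t) * exp (?s / 2 * t)) +
        ennreal (theta_tail (exp (- t)) * exp (?s / 2 * (- t)))) =
      indicator {0<..} t * ennreal (2 * exp (t / 4) * theta_tail (exp t) * cosh (r * t / 2))
        + indicator {0<..} t * ennreal (u t)"
    proof (cases "t > 0")
      case True
      have e1: "exp (?s / 2 * t) = exp (t / 4) * exp (r * t / 2)"
        by (simp flip: exp_add add: field_simps)
      have e2: "exp (t / 2) * exp (?s / 2 * (- t)) = exp (t / 4) * exp (- (r * t / 2))"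
        by (simp flip: exp_add add: field_simps)
      have e3: "exp (t / 2) * exp (?s / 2 * (- t)) = exp (- ((r - 1 / 2) / 2) * t)"
        by (simp flip: exp_add add: field_simps)
      have e4: "exp (?s / 2 * (- t)) = exp (- ((r + 1 / 2) / 2) * t)"
        by (simp add: algebra_simps)
      have "theta_tail (exp (- t)) * exp (?s / 2 * (- t)) =
          theta_tail (exp t) * (exp (t / 2) * exp (?s / 2 * (- t))) +
          (exp (t / 2) * exp (?s / 2 * (- t)) - exp (?s / 2 * (- t))) / 2"
        unfolding theta_tail_reflect by (simp only: ring_distribs add_divide_distrib diff_divide_distrib) simp
      also have "\<dots> = theta_tail (exp t) * (exp (t / 4) * exp (- (r * t / 2))) + u t"
        unfolding e2 unfolding e2[symmetric] unfolding e3 unfolding e4 u_def by simp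
      finally have "theta_tail (exp t) * exp (?s / 2 * t) + theta_tail (exp (- t)) * exp (?s / 2 * (- t)) =
          2 * exp (t / 4) * theta_tail (exp t) * cosh (r * t / 2) + u t"
        unfolding e1 cosh_def by (simp add: algebra_simps)
      thus ?thesis
        using True u_nonneg[OF True] theta_tail_nonneg[of "exp t"] theta_tail_nonneg[of "exp (- t)"]
        by (simp flip: ennreal_plus)
    qed auto
  qed
  also have "\<dots> = (\<integral>\<^sup>+t. indicator {0<..} t * ennreal (2 * exp (t / 4) * theta_tail (exp t) * cosh (r * t / 2)) \<partial>lborel)
      + (\<integral>\<^sup>+t. indicator {0<..} t * ennreal (u t) \<partial>lborel)"
    unfolding u_def cosh_def by (rule nn_integral_add) auto
  also have "(\<integral>\<^sup>+t. indicator {0<..} t * ennreal (u t) \<partial>lborel) = ennreal (1 / (r ^ 2 - 1 / 4))"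
  proof -
    have pos: "(r - 1/2) / 2 > 0" "(r + 1/2) / 2 > 0" using r by auto
    have "(u has_integral (exp (- ((r - 1/2) / 2) * 0) / ((r - 1/2) / 2) - exp (- ((r + 1/2) / 2) * 0) / ((r + 1/2) / 2)) / 2) {0..}"
      unfolding u_def
      by (intro has_integral_divide has_integral_diff has_integral_exp_minus_to_infinity pos)
    also have "(exp (- ((r - 1/2) / 2) * 0) / ((r - 1/2) / 2) - exp (- ((r + 1/2) / 2) * 0) / ((r + 1/2) / 2)) / 2 = 1 / (r ^ 2 - 1 / 4)"
    proof -
      have "r * (r * 4) > 1" using r mult_strict_mono[of "1 / 2" r "1 / 2" r] by simp
      thus ?thesis using r by (simp add: divide_simps power2_eq_square) (simp add: algebra_simps)
    qed
    finally have "(u has_integral 1 / (r ^ 2 - 1 / 4)) {0<..}"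
      by (rule has_integral_Ici_imp_Ioi)
    hence "integral\<^sup>N lborel (\<lambda>t. ennreal (indicator {0<..} t * u t)) = ennreal (1 / (r ^ 2 - 1 / 4))"
      by (intro nn_integral_has_integral_lebesgue) (auto intro: u_nonneg)
    moreover have "ennreal (indicator {0<..} t * u t) = indicator {0<..} t * ennreal (u t)" for t
      by (auto simp: indicator_def)
    ultimately show ?thesis by simp
  qed
  finally show ?thesis .
qed

section \<open>The centred xi function as a power series\<close>

lemma cosh_sums_even: "(\<lambda>k. x ^ (2 * k) / fact (2 * k)) sums cosh (x :: real)"
proof -
  have "(\<lambda>k. if even (2 * k) then x ^ (2 * k) /\<^sub>R fact (2 * k) else 0) sums cosh x"
    by (subst sums_mono_reindex[of "\<lambda>k. 2 * k" "\<lambda>n. if even n then x ^ n /\<^sub>R fact n else 0"])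
      (use cosh_converges in \<open>auto simp: strict_mono_def elim!: evenE\<close>)
  thus ?thesis by (simp add: divide_inverse mult.commute)
qed

lemma completed_zeta_nonneg:
  assumes "s > 1"
  shows "completed_zeta s \<ge> 0"
  using sums_le[OF _ sums_zero real_zeta_sums[OF assms]] assms
  by (auto simp: completed_zeta_def intro!: mult_nonneg_nonneg less_imp_le[OF Gamma_real_pos])

text \<open>Expanding the \<open>cosh\<close> makes the coefficients integrals of nonnegative
  functions. In \<open>ennreal\<close> the exchange of sum and integral is unconditional, and each
  coefficient is finite because the whole series is finite at \<open>r = 1\<close>.\<close>

lemma completed_zeta_power_series:
  "\<exists>a :: nat \<Rightarrow> real. (\<forall>k. a k \<ge> 0) \<and>
     (\<forall>r>1/2. (\<lambda>k. a k * r ^ (2 * k)) sums (completed_zeta (r + 1 / 2) - 1 / (r ^ 2 - 1 / 4)))"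
proof -
  define A where "A k = (\<integral>\<^sup>+t. indicator {0<..} t *
     ennreal (2 * exp (t / 4) * theta_tail (exp t) * ((t / 2) ^ (2 * k) / fact (2 * k))) \<partial>lborel)" for k :: nat
  have eq: "ennreal (completed_zeta (r + 1 / 2)) = (\<Sum>k. A k * ennreal (r ^ (2 * k))) + ennreal (1 / (r ^ 2 - 1 / 4))"
    if r: "r > 1 / 2" for r
  proof -
    have "indicator {0<..} t * ennreal (2 * exp (t / 4) * theta_tail (exp t) * cosh (r * t / 2)) =
        (\<Sum>k. indicator {0<..} t * ennreal (2 * exp (t / 4) * theta_tail (exp t) * ((t / 2) ^ (2 * k) / fact (2 * k))) * ennreal (r ^ (2 * k)))" for t
    proof (cases "t > 0")
      case True
      let ?c = "2 * exp (t / 4) * theta_tail (exp t)"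
      have c: "?c \<ge> 0" using theta_tail_nonneg[of "exp t"] by simp
      have "(\<lambda>k. ?c * ((r * t / 2) ^ (2 * k) / fact (2 * k))) sums (?c * cosh (r * t / 2))"
        by (intro sums_mult cosh_sums_even)
      hence "(\<lambda>k. ennreal (?c * ((r * t / 2) ^ (2 * k) / fact (2 * k)))) sums ennreal (?c * cosh (r * t / 2))"
        using c True r by (subst sums_ennreal) (auto intro!: mult_nonneg_nonneg)
      moreover have "ennreal (?c * ((r * t / 2) ^ (2 * k) / fact (2 * k))) =
          indicator {0<..} t * ennreal (?c * ((t / 2) ^ (2 * k) / fact (2 * k))) * ennreal (r ^ (2 * k))" for k
      proof -
        have "?c * ((r * t / 2) ^ (2 * k) / fact (2 * k)) = ?c * ((t / 2) ^ (2 * k) / fact (2 * k)) * r ^ (2 * k)"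
          by (simp add: power_mult_distrib power_divide)
        thus ?thesis
          using True r c by (simp only:) (subst ennreal_mult, auto intro!: mult_nonneg_nonneg)
      qed
      ultimately show ?thesis using True by (simp add: sums_iff)
    qed auto
    hence "(\<integral>\<^sup>+t. indicator {0<..} t * ennreal (2 * exp (t / 4) * theta_tail (exp t) * cosh (r * t / 2)) \<partial>lborel) =
       (\<Sum>k. \<integral>\<^sup>+t. indicator {0<..} t * ennreal (2 * exp (t / 4) * theta_tail (exp t) * ((t / 2) ^ (2 * k) / fact (2 * k))) * ennreal (r ^ (2 * k)) \<partial>lborel)"
      by (simp only:) (rule nn_integral_suminf, measurable)
    also have "\<dots> = (\<Sum>k. A k * ennreal (r ^ (2 * k)))"
      unfolding A_def by (intro suminf_cong nn_integral_multc) measurable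
    finally show ?thesis using completed_zeta_cosh[OF r] by simp
  qed
  define a where "a k = enn2real (A k)" for k
  have "A k \<noteq> top" for k
  proof -
    have "A k * ennreal (1 ^ (2 * k)) \<le> (\<Sum>k. A k * ennreal (1 ^ (2 * k)))"
      using sum_le_suminf[of "\<lambda>k. A k * ennreal (1 ^ (2 * k))" "{k}"] by simp
    also have "\<dots> \<le> (\<Sum>k. A k * ennreal (1 ^ (2 * k))) + ennreal (1 / (1 ^ 2 - 1 / 4))"
      by simp
    also have "\<dots> = ennreal (completed_zeta (1 + 1 / 2))"
      by (rule eq[symmetric]) simp
    finally show ?thesis by (auto simp: top_unique)
  qed
  hence A: "A k = ennreal (a k)" "a k \<ge> 0" for k
    by (auto simp: a_def less_top[symmetric] ennreal_enn2real)
  have "(\<lambda>k. a k * r ^ (2 * k)) sums (completed_zeta (r + 1 / 2) - 1 / (r ^ 2 - 1 / 4))" if r: "r > 1 / 2" for r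
  proof -
    have r2: "r ^ 2 > 1 / 4" using power_strict_mono[OF r, of 2] by (simp add: power2_eq_square)
    have pos: "completed_zeta (r + 1 / 2) \<ge> 0" using r by (intro completed_zeta_nonneg) auto
    \<comment> \<open>Subtraction in \<open>ennreal\<close> is truncated at zero; this inequality
      makes the difference a genuine one on returning to the reals.\<close>
    have le: "1 / (r ^ 2 - 1 / 4) \<le> completed_zeta (r + 1 / 2)"
    proof -
      have "ennreal (1 / (r ^ 2 - 1 / 4)) \<le> ennreal (completed_zeta (r + 1 / 2))"
        unfolding eq[OF r] by simp
      thus ?thesis using pos by (simp add: ennreal_le_iff)
    qed
    have mul: "ennreal (a k * r ^ (2 * k)) = A k * ennreal (r ^ (2 * k))" for k
      unfolding A(1) using A(2) r by (simp add: ennreal_mult)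
    have "ennreal (completed_zeta (r + 1 / 2) - 1 / (r ^ 2 - 1 / 4)) = (\<Sum>k. ennreal (a k * r ^ (2 * k)))"
      using r2 eq[OF r] unfolding mul by (subst ennreal_minus[symmetric]) (auto simp: ennreal_minus_top)
    hence "(\<lambda>k. ennreal (a k * r ^ (2 * k))) sums ennreal (completed_zeta (r + 1 / 2) - 1 / (r ^ 2 - 1 / 4))"
      by (simp add: summable_sums)
    thus ?thesis
      using A(2) r le by (subst (asm) sums_ennreal) auto
  qed
  thus ?thesis using A(2) by blast
qed

text \<open>A power series is determined by its values on a ray, so the choice is unique: these are
  the normalised even moments of the kernel
  \<open>2 * exp (t / 4) * theta_tail (exp t)\<close>.\<close>

definition xi_coeff :: "nat \<Rightarrow> real" where
  "xi_coeff = (SOME a. (\<forall>k. a k \<ge> 0) \<and>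
     (\<forall>r>1/2. (\<lambda>k. a k * r ^ (2 * k)) sums (completed_zeta (r + 1 / 2) - 1 / (r ^ 2 - 1 / 4))))"

lemma xi_coeff: "xi_coeff k \<ge> 0"
    "r > 1 / 2 \<Longrightarrow> (\<lambda>k. xi_coeff k * r ^ (2 * k)) sums (completed_zeta (r + 1 / 2) - 1 / (r ^ 2 - 1 / 4))"
  using someI_ex[OF completed_zeta_power_series] unfolding xi_coeff_def[symmetric] by auto

definition xi_core :: "complex \<Rightarrow> complex" where
  "xi_core z = (\<Sum>k. of_real (xi_coeff k) * (z ^ 2) ^ k)"

text \<open>For \<open>s = 1/2 + z\<close> the factor \<open>z ^ 2 - 1/4\<close> is
  \<open>s * (s - 1)\<close>; the summand \<open>1/2\<close> is what it makes of the polar part that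
  \<open>xi_core\<close> leaves out.\<close>

definition centred_xi :: "complex \<Rightarrow> complex" where
  "centred_xi z = 1 / 2 + (z ^ 2 - 1 / 4) / 2 * xi_core z"

lemma xi_core_norm_summable: "summable (\<lambda>k. norm (of_real (xi_coeff k) * w ^ k :: complex))"
proof (rule summable_comparison_test')
  \<comment> \<open>Large enough both to lie where convergence is known and to dominate
    \<open>w\<close>, since the series at \<open>r\<close> has the argument
    \<open>r\<^sup>2\<close>.\<close>
  define r where "r = sqrt (norm w) + 1"
  have r: "r > 1 / 2" "sqrt (norm w) \<le> r" unfolding r_def using real_sqrt_ge_zero[OF norm_ge_zero[of w]] by linarith+
  show "summable (\<lambda>k. xi_coeff k * r ^ (2 * k))"
    using xi_coeff(2)[OF r(1)] by (rule sums_summable)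
  show "norm (norm (of_real (xi_coeff k) * w ^ k)) \<le> xi_coeff k * r ^ (2 * k)" for k
  proof -
    have "norm w = sqrt (norm w) ^ 2" by simp
    also have "\<dots> \<le> r ^ 2" using r by (intro power_mono) auto
    finally have "norm w ^ k \<le> (r ^ 2) ^ k" by (intro power_mono) auto
    thus ?thesis using xi_coeff(1)[of k]
      by (simp add: norm_mult norm_power power_mult mult_left_mono)
  qed
qed

lemma xi_core_sums: "(\<lambda>k. of_real (xi_coeff k) * (z ^ 2) ^ k) sums xi_core z"
  unfolding xi_core_def by (intro summable_sums summable_norm_cancel[OF xi_core_norm_summable])

lemma xi_core_of_real:
  assumes "r > 1 / 2"
  shows "xi_core (of_real r) = of_real (completed_zeta (r + 1 / 2) - 1 / (r ^ 2 - 1 / 4))"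
proof -
  have "(\<lambda>k. of_real (xi_coeff k * r ^ (2 * k))) sums
      (of_real (completed_zeta (r + 1 / 2) - 1 / (r ^ 2 - 1 / 4)) :: complex)"
    by (intro sums_of_real xi_coeff(2) assms)
  thus ?thesis
    using xi_core_sums[of "of_real r"] by (simp add: power_mult sums_iff)
qed

lemma xi_core_holomorphic: "xi_core holomorphic_on UNIV"
proof -
  define f where "f w = (\<Sum>k. of_real (xi_coeff k) * w ^ k)" for w :: complex
  have "f holomorphic_on UNIV"
  proof (subst holomorphic_on_open, goal_cases)
    case 2
    show ?case
    proof
      fix w :: complex
      have "f holomorphic_on ball 0 (norm w + 1)"
        by (rule power_series_holomorphic[where a = "\<lambda>k. of_real (xi_coeff k)"])
          (auto simp: f_def intro!: summable_sums summable_norm_cancel[OF xi_core_norm_summable])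
      thus "\<exists>f'. (f has_field_derivative f') (at w)"
        by (subst (asm) holomorphic_on_open) auto
    qed
  qed auto
  hence "(\<lambda>z. f (z ^ 2)) holomorphic_on UNIV"
    by (rule holomorphic_on_compose_gen[where g = f and t = UNIV and f = "\<lambda>z. z ^ 2", unfolded o_def, rotated])
      (auto intro!: holomorphic_intros)
  thus ?thesis by (simp add: f_def xi_core_def[abs_def])
qed

lemma centred_xi_holomorphic: "centred_xi holomorphic_on A"
proof (rule holomorphic_on_subset)
  show "centred_xi holomorphic_on UNIV"
    unfolding centred_xi_def[abs_def] by (intro holomorphic_intros xi_core_holomorphic) auto
qed auto

lemma centred_xi_minus: "centred_xi (- z) = centred_xi z"
  by (simp add: centred_xi_def xi_core_def)

lemma centred_xi_cnj: "centred_xi (cnj z) = cnj (centred_xi z)"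
proof -
  have "(\<lambda>k. cnj (of_real (xi_coeff k) * (z ^ 2) ^ k)) sums cnj (xi_core z)"
    using xi_core_sums by (simp only: sums_cnj)
  hence "xi_core (cnj z) = cnj (xi_core z)"
    using xi_core_sums[of "cnj z"] by (simp add: sums_iff)
  thus ?thesis by (simp add: centred_xi_def)
qed

section \<open>Special values and growth of the centred xi function\<close>

lemma centred_xi_of_real:
  assumes r: "r > 1 / 2"
  shows "centred_xi (of_real r) = of_real ((r ^ 2 - 1 / 4) / 2 * completed_zeta (r + 1 / 2))"
proof -
  have r2: "r ^ 2 > 1 / 4" using power_strict_mono[OF r, of 2] by (simp add: power2_eq_square)
  have *: "1 / 2 + (r ^ 2 - 1 / 4) / 2 * (c - 1 / (r ^ 2 - 1 / 4)) = (r ^ 2 - 1 / 4) / 2 * c" for c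
    using r2 by (simp add: right_diff_distrib)
  have "centred_xi (of_real r) =
      of_real (1 / 2 + (r ^ 2 - 1 / 4) / 2 * (completed_zeta (r + 1 / 2) - 1 / (r ^ 2 - 1 / 4)))"
    unfolding centred_xi_def xi_core_of_real[OF r] by simp
  thus ?thesis unfolding * .
qed

lemma centred_xi_half: "centred_xi (1 / 2) = 1 / 2"
  by (simp add: centred_xi_def power2_eq_square)

lemma real_zeta_2: "real_zeta 2 = pi ^ 2 / 6"
proof -
  have "real (Suc n) powr - 2 = 1 / (real n + 1) ^ 2" for n
    by (simp add: powr_minus powr_realpow divide_inverse add.commute)
  thus ?thesis
    using inverse_squares_sums by (simp add: real_zeta_def sums_iff add.commute)
qed

lemma completed_zeta_2: "completed_zeta 2 = pi / 6"
  by (simp add: completed_zeta_def real_zeta_2 powr_minus power2_eq_square field_simps)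

lemma centred_xi_three_halves: "centred_xi (3 / 2) = of_real (pi / 6)"
  using centred_xi_of_real[of "3 / 2"] by (simp add: completed_zeta_2 power2_eq_square)

text \<open>A zero at the origin would require \<open>xi_core 0 = 4\<close>, but the constant
  coefficient is at most the whole series at \<open>r = 3/2\<close>, whose value is
  \<open>pi / 6 - 1/2\<close>.\<close>

lemma centred_xi_0: "centred_xi 0 \<noteq> 0"
proof -
  have "xi_coeff 0 = (\<Sum>k\<in>{0}. xi_coeff k * (3 / 2) ^ (2 * k))" by simp
  also have "\<dots> \<le> completed_zeta (3 / 2 + 1 / 2) - 1 / ((3 / 2) ^ 2 - 1 / 4)"
    using xi_coeff(2)[of "3 / 2"] xi_coeff(1) sum_le_suminf[of "\<lambda>k. xi_coeff k * (3 / 2) ^ (2 * k)" "{0}"]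
    by (auto simp: sums_iff)
  also have "\<dots> < 4" using pi_less_4 by (simp add: completed_zeta_2 power2_eq_square)
  finally have "xi_coeff 0 < 4" .
  moreover have "xi_core 0 = of_real (xi_coeff 0)"
    unfolding xi_core_def by (subst suminf_finite[of "{0}"]) auto
  ultimately show ?thesis
    by (simp add: centred_xi_def complex_eq_iff)
qed

text \<open>The values of xi at 1 and 2 are \<open>1/2\<close> and \<open>pi / 6\<close>, which
  differ because \<open>pi > 3\<close>. Squares appear because the product formula for an even
  function describes its square.\<close>

lemma centred_xi_nonconst: "\<exists>w. centred_xi w ^ 2 \<noteq> centred_xi 0 ^ 2"
proof (rule ccontr)
  assume "\<not> ?thesis"
  hence "centred_xi (1 / 2) ^ 2 = centred_xi (3 / 2) ^ 2" by metis
  hence "complex_of_real ((1 / 2) ^ 2) = of_real ((pi / 6) ^ 2)"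
    by (simp add: centred_xi_half centred_xi_three_halves)
  hence "(1 / 2) ^ 2 = (pi / 6) ^ 2" by (simp only: of_real_eq_iff)
  hence "1 / 2 = pi / 6" by (simp add: power2_eq_iff_nonneg)
  thus False using pi_gt3 by simp
qed

text \<open>Nonnegative coefficients bound the modulus on a disc by the value at a real point to its
  right, where Stirling is replaced by the crude \<open>fact n \<le> n ^ n\<close>.\<close>

lemma centred_xi_bound:
  assumes "norm z \<le> r" "r \<ge> 1"
  shows "norm (centred_xi z) \<le> 1 / 2 + (r ^ 2 + 1) * (4 * exp ((r + 1) * ln (r + 1)))"
proof -
  define n where "n = nat \<lceil>r\<rceil>"
  have n: "real n \<ge> r" "real n \<le> r + 1" "n \<ge> 1" using assms unfolding n_def by linarith+
  \<comment> \<open>Chosen so that \<open>N + 1/2 = 2 * n\<close>: the Gamma factor is then a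
    factorial.\<close>
  define N where "N = 2 * real n - 1 / 2"
  have N: "N > 1 / 2" "N \<ge> r" using n assms by (auto simp: N_def)
  have N2: "N ^ 2 > 1 / 4" using power_strict_mono[OF N(1), of 2] by (simp add: power2_eq_square)
  have "norm (xi_core z) \<le> (\<Sum>k. norm (of_real (xi_coeff k) * (z ^ 2) ^ k))"
    unfolding xi_core_def by (intro summable_norm xi_core_norm_summable)
  also have "\<dots> \<le> completed_zeta (N + 1 / 2) - 1 / (N ^ 2 - 1 / 4)"
  proof (rule sums_le[OF _ summable_sums[OF xi_core_norm_summable] xi_coeff(2)[OF N(1)]])
    fix k
    have "norm z ^ (2 * k) \<le> N ^ (2 * k)" using assms N by (intro power_mono) auto
    thus "norm (of_real (xi_coeff k) * (z ^ 2) ^ k) \<le> xi_coeff k * N ^ (2 * k)"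
      using xi_coeff(1)[of k] by (simp add: norm_mult norm_power power_mult mult_left_mono)
  qed
  also have "\<dots> \<le> completed_zeta (N + 1 / 2)" using N2 by simp
  also have "\<dots> = pi powr (- real n) * Gamma (real n) * real_zeta (2 * real n)"
    by (simp add: completed_zeta_def N_def)
  also have "\<dots> \<le> 1 * exp ((r + 1) * ln (r + 1)) * 4"
  proof (intro mult_mono)
    show "pi powr (- real n) \<le> 1"
      using pi_gt3 by (simp add: powr_minus field_simps ge_one_powr_ge_zero)
    have "Gamma (1 + real (n - 1)) = fact (n - 1)" by (rule Gamma_fact)
    hence "Gamma (real n) = fact (n - 1)" using n by (simp add: of_nat_diff)
    also have "\<dots> \<le> fact n" by (intro fact_mono) auto
    also have "(fact n :: real) \<le> real n ^ n" using fact_le_power[of n] by simp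
    also have "\<dots> = real n powr real n" using n by (simp add: powr_realpow)
    also have "\<dots> \<le> (r + 1) powr (r + 1)"
      using n assms by (intro order_trans[OF powr_mono2 powr_mono]) auto
    also have "\<dots> = exp ((r + 1) * ln (r + 1))" using assms by (simp add: powr_def)
    finally show "Gamma (real n) \<le> exp ((r + 1) * ln (r + 1))" .
    have "real_zeta (2 * real n) \<le> real_zeta 2"
      using n by (intro sums_le[OF _ real_zeta_sums real_zeta_sums]) (auto intro!: powr_mono)
    also have "\<dots> \<le> 4 ^ 2 / 6"
      unfolding real_zeta_2 using pi_less_4 pi_gt3 by (intro divide_right_mono power_mono) auto
    finally show "real_zeta (2 * real n) \<le> 4" by simp
    show "0 \<le> real_zeta (2 * real n)"
      using n by (intro sums_le[OF _ sums_zero real_zeta_sums]) auto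
  qed (use n in auto)
  finally have core: "norm (xi_core z) \<le> 4 * exp ((r + 1) * ln (r + 1))" by simp
  have "norm (centred_xi z) \<le> norm (1 / 2 :: complex) + norm ((z ^ 2 - 1 / 4) / 2) * norm (xi_core z)"
    unfolding centred_xi_def norm_mult[symmetric] by (rule norm_triangle_ineq)
  also have "\<dots> \<le> 1 / 2 + (r ^ 2 + 1) * (4 * exp ((r + 1) * ln (r + 1)))"
  proof (intro add_mono mult_mono core)
    have "norm (z ^ 2 - 1 / 4) \<le> norm (z ^ 2) + norm (1 / 4 :: complex)" by (rule norm_triangle_ineq4)
    also have "\<dots> \<le> r ^ 2 + 1 / 4" using assms by (simp add: norm_power power_mono)
    finally show "norm ((z ^ 2 - 1 / 4) / 2) \<le> r ^ 2 + 1"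
      using zero_le_power2[of r] unfolding norm_divide norm_numeral by linarith
  qed auto
  finally show ?thesis .
qed

lemma centred_xi_growth:
  assumes "e > 0"
  shows "eventually (\<lambda>r. \<forall>z. norm z \<le> r \<longrightarrow> norm (centred_xi z) \<le> exp (e * r ^ 2)) at_top"
proof -
  have "eventually (\<lambda>r::real. 1 / 2 + (r ^ 2 + 1) * (4 * exp ((r + 1) * ln (r + 1))) \<le> exp (e * r ^ 2)) at_top"
    using assms by real_asymp
  thus ?thesis
    using eventually_ge_at_top[of 1]
    by eventually_elim (use centred_xi_bound order_trans in blast)
qed

section \<open>The zeta function and its zeros\<close>

lemma Suc_powr_eq_exp: "complex_of_nat (Suc n) powr - s = exp (- s * of_real (ln (real (Suc n))))"
  unfolding powr_def by (simp add: Ln_of_nat del: of_nat_Suc)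

lemma norm_Suc_powr: "norm (complex_of_nat (Suc n) powr - s) = real (Suc n) powr - Re s"
  unfolding Suc_powr_eq_exp by (simp add: powr_def)

text \<open>The index is shifted: \<open>c n\<close> is the coefficient of \<open>Suc n\<close>, so
  the base is never zero.\<close>

definition dirichlet_series :: "(nat \<Rightarrow> complex) \<Rightarrow> complex \<Rightarrow> complex" where
  "dirichlet_series c s = (\<Sum>n. c n * of_nat (Suc n) powr - s)"

locale abs_dirichlet_series =
  fixes c :: "nat \<Rightarrow> complex"
  assumes abs_summable: "\<sigma> > 1 \<Longrightarrow> summable (\<lambda>n. norm (c n) * real (Suc n) powr - \<sigma>)"
begin

lemma norm_summable:
  "Re s > 1 \<Longrightarrow> summable (\<lambda>n. norm (c n * of_nat (Suc n) powr - s))"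
  using abs_summable[of "Re s"] by (simp add: norm_mult norm_Suc_powr del: of_nat_Suc)

lemma sums: "Re s > 1 \<Longrightarrow> (\<lambda>n. c n * of_nat (Suc n) powr - s) sums dirichlet_series c s"
  unfolding dirichlet_series_def by (intro summable_sums summable_norm_cancel[OF norm_summable])

text \<open>Beyond differentiability, the derivative is wanted as a series, so that for zeta it can
  be identified with a convolution.\<close>

lemma has_deriv:
  assumes s: "Re s > 1"
  obtains d where "(dirichlet_series c has_field_derivative d) (at s)"
    "(\<lambda>n. - of_real (ln (real (Suc n))) * (c n * of_nat (Suc n) powr - s)) sums d"
proof -
  define \<sigma> where "\<sigma> = (Re s + 1) / 2"
  have \<sigma>: "\<sigma> > 1" "\<sigma> < Re s" using s by (auto simp: \<sigma>_def)
  define S where "S = {s. Re s > \<sigma>}"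
  have S: "open S" "s \<in> S" using \<sigma> by (auto simp: S_def open_halfspace_Re_gt)
  obtain g g' where g: "\<forall>x \<in> S. ((\<lambda>n. c n * of_nat (Suc n) powr - x) sums g x) \<and>
      ((\<lambda>n. - of_real (ln (real (Suc n))) * (c n * of_nat (Suc n) powr - x)) sums g' x) \<and>
      (g has_field_derivative g' x) (at x)"
  proof (rule series_and_derivative_comparison[OF S(1) abs_summable[OF \<sigma>(1)]])
    show "((\<lambda>x. c n * of_nat (Suc n) powr - x) has_field_derivative
        - of_real (ln (real (Suc n))) * (c n * of_nat (Suc n) powr - x)) (at x)" for n x
      unfolding Suc_powr_eq_exp by (auto intro!: derivative_eq_intros)
    show "\<forall>\<^sub>F n in sequentially. \<forall>x\<in>S. norm (c n * of_nat (Suc n) powr - x) \<le> norm (c n) * real (Suc n) powr - \<sigma>"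
    proof (intro always_eventually allI ballI)
      fix n x assume "x \<in> S"
      hence "real (Suc n) powr - Re x \<le> real (Suc n) powr - \<sigma>"
        by (intro powr_mono) (auto simp: S_def)
      thus "norm (c n * of_nat (Suc n) powr - x) \<le> norm (c n) * real (Suc n) powr - \<sigma>"
        unfolding norm_mult norm_Suc_powr by (rule mult_left_mono) auto
    qed
  qed blast
  have eq: "g x = dirichlet_series c x" if "x \<in> S" for x
    using g that by (auto simp: dirichlet_series_def sums_iff)
  have "(g has_field_derivative g' s) (at s)" using g S by blast
  hence "(dirichlet_series c has_field_derivative g' s) (at s)"
    by (rule has_field_derivative_transform_within_open[OF _ S]) (rule eq)
  thus ?thesis using that g S by blast
qed

lemma holomorphic: "dirichlet_series c holomorphic_on {s. Re s > 1}"
  by (subst holomorphic_on_open) (auto simp: open_halfspace_Re_gt elim: has_deriv)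

end

lemma summable_Suc_powr: "\<sigma> > 1 \<Longrightarrow> summable (\<lambda>n. real (Suc n) powr - \<sigma>)"
  using real_zeta_sums sums_summable by blast

interpretation one: abs_dirichlet_series "\<lambda>_. 1"
  by standard (use summable_Suc_powr in simp)

interpretation mangoldt: abs_dirichlet_series "\<lambda>n. mangoldt (Suc n)"
proof
  fix \<sigma> :: real assume \<sigma>: "\<sigma> > 1"
  \<comment> \<open>Half of the margin of \<open>\<sigma>\<close> above 1 absorbs the logarithm, the
    other half leaves an exponent of convergence.\<close>
  define d where "d = (\<sigma> - 1) / 2"
  have d: "d > 0" "\<sigma> - d > 1" using \<sigma> by (auto simp: d_def field_simps)
  show "summable (\<lambda>n. norm (mangoldt (Suc n) :: complex) * real (Suc n) powr - \<sigma>)"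
  proof (rule summable_comparison_test')
    show "summable (\<lambda>n. 1 / d * real (Suc n) powr - (\<sigma> - d))"
      by (intro summable_mult summable_Suc_powr d)
    fix n
    have "mangoldt (Suc n) \<le> ln (real (Suc n))" by (rule mangoldt_le) auto
    also have "\<dots> \<le> real (Suc n) powr d / d" by (rule ln_powr_bound) (use d in auto)
    finally have "mangoldt (Suc n) * real (Suc n) powr - \<sigma> \<le> real (Suc n) powr d / d * real (Suc n) powr - \<sigma>"
      by (rule mult_right_mono) auto
    also have "\<dots> = 1 / d * real (Suc n) powr - (\<sigma> - d)"
      by (simp add: powr_add[symmetric] del: of_nat_Suc)
    finally show "norm (norm (mangoldt (Suc n) :: complex) * real (Suc n) powr - \<sigma>) \<le> 1 / d * real (Suc n) powr - (\<sigma> - d)"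
      by (simp add: mangoldt_nonneg)
  qed
qed

text \<open>This is \<open>(s - 1) \<zeta> s\<close>.\<close>
definition xi_cofactor :: "complex \<Rightarrow> complex" where
  "xi_cofactor s = centred_xi (s - 1 / 2) * of_real pi powr (s / 2) * rGamma (s / 2 + 1)"

definition zeta_ext :: "complex \<Rightarrow> complex" where
  "zeta_ext s = (if s = 1 then 0 else xi_cofactor s / (s - 1))"

lemma xi_cofactor_holomorphic: "xi_cofactor holomorphic_on A"
proof -
  have "(\<lambda>s. centred_xi (s - 1 / 2)) holomorphic_on A"
    by (rule holomorphic_on_compose_gen[where g = centred_xi and t = UNIV, unfolded o_def])
      (auto intro!: holomorphic_intros centred_xi_holomorphic)
  thus ?thesis
    unfolding xi_cofactor_def[abs_def] by (intro holomorphic_intros) auto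
qed

lemma zeta_ext_holomorphic: "zeta_ext holomorphic_on - {1}"
proof -
  have "(\<lambda>s. xi_cofactor s / (s - 1)) holomorphic_on - {1}"
    by (intro holomorphic_intros xi_cofactor_holomorphic) auto
  thus ?thesis by (rule holomorphic_transform) (auto simp: zeta_ext_def)
qed

lemma zeta_ext_of_real:
  assumes x: "x > 1"
  shows "zeta_ext (of_real x) = of_real (real_zeta x)"
proof -
  have xi: "centred_xi (of_real x - 1 / 2) = of_real (x * (x - 1) / 2 * (pi powr (- x / 2) * Gamma (x / 2) * real_zeta x))"
  proof -
    have "((x - 1 / 2) ^ 2 - 1 / 4) / 2 = x * (x - 1) / 2"
      by (simp add: power2_eq_square field_simps)
    thus ?thesis
      using centred_xi_of_real[of "x - 1 / 2"] x unfolding completed_zeta_def by (simp del: of_real_mult)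
  qed
  have p: "(of_real pi :: complex) powr (of_real x / 2) = of_real (pi powr (x / 2))"
    using powr_of_real[of pi "x / 2"] by simp
  have r: "rGamma (of_real x / 2 + 1 :: complex) = of_real (rGamma (x / 2 + 1))"
    by (simp flip: rGamma_complex_of_real)
  have g: "x / 2 * rGamma (x / 2 + 1) * Gamma (x / 2) = 1"
  proof -
    have "x / 2 * rGamma (x / 2 + 1) = rGamma (x / 2)" by (rule rGamma_plus1)
    moreover have "Gamma (x / 2) > 0" using x by (intro Gamma_real_pos) auto
    ultimately show ?thesis by (simp add: rGamma_inverse_Gamma)
  qed
  have "xi_cofactor (of_real x) =
      of_real (x * (x - 1) / 2 * (pi powr (- x / 2) * Gamma (x / 2) * real_zeta x) * pi powr (x / 2) * rGamma (x / 2 + 1))"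
    unfolding xi_cofactor_def xi p r by (simp only: of_real_mult)
  also have "x * (x - 1) / 2 * (pi powr (- x / 2) * Gamma (x / 2) * real_zeta x) * pi powr (x / 2) * rGamma (x / 2 + 1) =
      (x / 2 * rGamma (x / 2 + 1) * Gamma (x / 2)) * (pi powr (- x / 2) * pi powr (x / 2)) * ((x - 1) * real_zeta x)"
    by simp
  also have "\<dots> = (x - 1) * real_zeta x"
    unfolding g by (simp add: powr_add[symmetric])
  finally show ?thesis using x by (simp add: zeta_ext_def complex_eq_iff)
qed

lemma one_dirichlet_of_real:
  assumes "x > 1"
  shows "dirichlet_series (\<lambda>_. 1) (of_real x) = of_real (real_zeta x)"
proof -
  have "(\<lambda>n. of_real (real (Suc n) powr - x) :: complex) sums of_real (real_zeta x)"
    by (intro sums_of_real real_zeta_sums assms)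
  moreover have "of_real (real (Suc n) powr - x) = complex_of_nat (Suc n) powr - of_real x" for n
    using powr_of_real[of "real (Suc n)" "- x"] by simp
  ultimately show ?thesis by (simp add: dirichlet_series_def sums_iff)
qed

text \<open>The theta argument gives equality on the real ray only; both sides are holomorphic on
  the half plane and the ray accumulates at 2, so the identity theorem extends it.\<close>

lemma zeta_ext_eq_dirichlet:
  assumes s: "Re s > 1"
  shows "zeta_ext s = dirichlet_series (\<lambda>_. 1) s"
proof -
  let ?S = "{s. Re s > 1}" and ?U = "complex_of_real ` {1<..}"
  have "zeta_ext s - dirichlet_series (\<lambda>_. 1) s = 0"
  proof (rule analytic_continuation[where f = "\<lambda>s. zeta_ext s - dirichlet_series (\<lambda>_. 1) s" and S = ?S and U = ?U and \<xi> = 2])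
    have "zeta_ext holomorphic_on ?S"
      by (rule holomorphic_on_subset[OF zeta_ext_holomorphic]) auto
    thus "(\<lambda>s. zeta_ext s - dirichlet_series (\<lambda>_. 1) s) holomorphic_on ?S"
      by (intro holomorphic_intros one.holomorphic)
    show "connected ?S" by (intro convex_connected convex_halfspace_Re_gt)
    show "2 islimpt ?U"
      unfolding islimpt_approachable
    proof (intro allI impI)
      fix e :: real assume "e > 0"
      moreover from this have "complex_of_real (2 + e / 2) \<in> ?U" by (intro imageI) auto
      ultimately show "\<exists>x'\<in>?U. x' \<noteq> 2 \<and> dist x' 2 < e"
        by (intro bexI[of _ "complex_of_real (2 + e / 2)"]) (auto simp: dist_norm)
    qed
  qed (use s in \<open>auto simp: open_halfspace_Re_gt zeta_ext_of_real one_dirichlet_of_real\<close>)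
  thus ?thesis by simp
qed

text \<open>Existence is the function built from xi. Uniqueness: two candidates agree on a half
  plane, hence on the connected punctured plane, and the value at 1 is prescribed.\<close>

lemma zeta_eq: "zeta = zeta_ext"
  unfolding zeta_def
proof (rule the_equality)
  show "zeta_ext holomorphic_on - {1} \<and>
      (\<forall>s. Re s > 1 \<longrightarrow> (\<lambda>n. of_nat (Suc n) powr - s) sums zeta_ext s) \<and> zeta_ext 1 = 0"
    using zeta_ext_holomorphic one.sums zeta_ext_eq_dirichlet by (auto simp: zeta_ext_def)
next
  fix f :: "complex \<Rightarrow> complex"
  assume f: "f holomorphic_on - {1} \<and>
      (\<forall>s. Re s > 1 \<longrightarrow> (\<lambda>n. of_nat (Suc n) powr - s) sums f s) \<and> f 1 = 0"
  have eq: "f s = zeta_ext s" if "Re s > 1" for s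
    using f one.sums[OF that] that by (auto simp: zeta_ext_eq_dirichlet sums_iff)
  have "f s - zeta_ext s = 0" if "s \<noteq> 1" for s
  proof (rule analytic_continuation_open[where s = "{s. Re s > 1}" and s' = "- {1}" and g = "\<lambda>_. 0" and f = "\<lambda>s. f s - zeta_ext s"])
    show "{s. Re s > 1} \<noteq> {}" by (auto intro!: exI[of _ 2])
    show "connected (- {1 :: complex})" by (rule connected_punctured_universe) simp
  qed (use f zeta_ext_holomorphic eq that in \<open>auto simp: open_halfspace_Re_gt intro!: holomorphic_intros\<close>)
  thus "f = zeta_ext" using f by (auto simp: fun_eq_iff zeta_ext_def)
qed

text \<open>The defining formula degenerates only at \<open>w = 1\<close> and at the zeros of
  \<open>rGamma (w / 2)\<close>. These are isolated, so equality elsewhere determines the limits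
  taken by \<open>remove_sings\<close>.\<close>

lemma riemann_xi_eq: "riemann_xi s = centred_xi (s - 1 / 2)"
proof -
  have "eventually (\<lambda>w. rGamma (w / 2) * (w - 1) \<noteq> 0) (at s)"
  proof -
    have "(\<lambda>w. rGamma (w / 2) * (w - 1)) holomorphic_on UNIV"
      by (intro holomorphic_intros) auto
    from non_zero_neighbour_alt[OF this open_UNIV connected_UNIV, of s 2] show ?thesis by simp
  qed
  hence "eventually (\<lambda>w. 1 / 2 * w * (w - 1) * of_real pi powr (- w / 2) * Gamma (w / 2) * zeta w =
      centred_xi (w - 1 / 2)) (at s)"
  proof eventually_elim
    case (elim w)
    hence w: "w \<noteq> 1" "rGamma (w / 2) \<noteq> 0" by auto
    have "w / 2 * rGamma (w / 2 + 1) = rGamma (w / 2)" by (rule rGamma_plus1)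
    hence g: "w / 2 * rGamma (w / 2 + 1) * Gamma (w / 2) = 1"
      using w(2) by (simp add: Gamma_def)
    have p: "of_real pi powr (- w / 2) * of_real pi powr (w / 2) = (1 :: complex)"
      by (simp add: powr_add[symmetric])
    have "1 / 2 * w * (w - 1) * of_real pi powr (- w / 2) * Gamma (w / 2) * zeta w =
      1 / 2 * w * of_real pi powr (- w / 2) * Gamma (w / 2) * ((w - 1) * zeta w)"
      by (simp only: mult_ac)
    also have "(w - 1) * zeta w = xi_cofactor w"
      using w by (simp add: zeta_eq zeta_ext_def)
    also have "1 / 2 * w * of_real pi powr (- w / 2) * Gamma (w / 2) * xi_cofactor w =
      (w / 2 * rGamma (w / 2 + 1) * Gamma (w / 2)) * (of_real pi powr (- w / 2) * of_real pi powr (w / 2)) *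
      centred_xi (w - 1 / 2)"
      by (simp add: xi_cofactor_def)
    finally show ?case unfolding g p by simp
  qed
  hence "riemann_xi s = remove_sings (\<lambda>w. centred_xi (w - 1 / 2)) s"
    unfolding riemann_xi_def by (rule remove_sings_cong) simp
  also have "\<dots> = centred_xi (s - 1 / 2)"
  proof (rule remove_sings_at_analytic)
    have "(\<lambda>s. centred_xi (s - 1 / 2)) holomorphic_on UNIV"
      by (rule holomorphic_on_compose_gen[where g = centred_xi and t = UNIV, unfolded o_def])
        (auto intro!: holomorphic_intros centred_xi_holomorphic)
    thus "(\<lambda>w. centred_xi (w - 1 / 2)) analytic_on {s}"
      using analytic_on_open analytic_on_subset by (metis open_UNIV subset_UNIV)
  qed
  finally show ?thesis .
qed

section \<open>Nonvanishing of zeta on the closed half plane\<close>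

lemma mangoldt_convolution:
  assumes s: "Re s > 1"
  shows "(\<lambda>n. of_real (ln (real (Suc n))) * of_nat (Suc n) powr - s) sums
     (dirichlet_series (\<lambda>_. 1) s * dirichlet_series (\<lambda>n. mangoldt (Suc n)) s)"
proof -
  define f where "f n = exp (- s * of_real (ln (real n)))" for n :: nat
  have f_Suc: "complex_of_nat (Suc n) powr - s = f (Suc n)" for n
    unfolding f_def by (rule Suc_powr_eq_exp)
  have f_mult: "f (m * n) = f m * f n" if "m > 0" "n > 0" for m n
    using that by (simp add: f_def ln_mult exp_add[symmetric] algebra_simps)
  have pos: "range Suc = {0<..}" by (auto simp: image_iff gr0_conv_Suc)
  have to_pos: "(g has_sum S) {0<..}"
    if "summable (\<lambda>n. norm (g (Suc n)))" "(\<lambda>n. g (Suc n)) sums S" for g :: "nat \<Rightarrow> complex" and S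
    using norm_summable_imp_has_sum[OF that] unfolding pos[symmetric]
    by (subst has_sum_reindex) (auto simp: o_def)
  let ?Z = "dirichlet_series (\<lambda>_. 1) s" and ?L = "dirichlet_series (\<lambda>n. mangoldt (Suc n)) s"
  have Z: "(f has_sum ?Z) {0<..}"
    using one.sums[OF s] one.norm_summable[OF s] unfolding f_Suc by (intro to_pos) auto
  have L: "((\<lambda>n. mangoldt n * f n) has_sum ?L) {0<..}"
    using mangoldt.sums[OF s] mangoldt.norm_summable[OF s] unfolding f_Suc by (intro to_pos) auto
  have abs_pos: "(\<lambda>n. norm (g n)) summable_on {0<..}" if "summable (\<lambda>n. norm (g (Suc n)))" for g :: "nat \<Rightarrow> complex"
    using norm_summable_imp_summable_on[of "\<lambda>n. norm (g (Suc n))"] that unfolding pos[symmetric]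
    by (subst summable_on_reindex) (auto simp: o_def)
  have f_abs: "(\<lambda>n. norm (f n)) summable_on {0<..}"
    using one.norm_summable[OF s] unfolding f_Suc by (intro abs_pos) auto
  have Lf_abs: "(\<lambda>n. norm (mangoldt n * f n)) summable_on {0<..}"
    using mangoldt.norm_summable[OF s] unfolding f_Suc by (intro abs_pos) auto
  \<comment> \<open>Absolute convergence permits regrouping the double series by
    \<open>n = m * d\<close>, where the von Mangoldt values of the divisors of \<open>n\<close> add
    up to \<open>ln n\<close>.\<close>
  have "((\<lambda>(m, d). f m * (mangoldt d * f d)) has_sum ?Z * ?L) ({0<..} \<times> {0<..})"
  proof (rule has_sum_SigmaI)
    show "((\<lambda>d. case (m, d) of (m, d) \<Rightarrow> f m * (mangoldt d * f d)) has_sum f m * ?L) {0<..}" for m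
      using has_sum_cmult_right[OF L] by simp
    show "((\<lambda>m. f m * ?L) has_sum ?Z * ?L) {0<..}"
      by (rule has_sum_cmult_left[OF Z])
    have "(\<lambda>x. norm (case x of (m, d) \<Rightarrow> f m * (mangoldt d * f d))) summable_on {0<..} \<times> {0<..}"
      unfolding Infinite_Sum.abs_summable_on_Sigma_iff using f_abs Lf_abs
      by (auto simp: norm_mult infsum_cmult_right' abs_mult intro!: summable_on_cmult_left summable_on_cmult_right
          simp del: norm_mangoldt)
    thus "(\<lambda>(m, d). f m * (mangoldt d * f d)) summable_on {0<..} \<times> {0<..}"
      by (rule abs_summable_summable)
  qed
  hence "((\<lambda>(n, d). mangoldt d * f n) has_sum ?Z * ?L) (SIGMA n:{0<..}. {d. d dvd n})"
  proof (rule has_sum_reindex_bij_witness[of _ "\<lambda>(n, d). (n div d, d)" "\<lambda>(m, d). (m * d, d)", THEN iffD1, rotated -1])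
  qed (auto simp: f_mult dvd_div_eq_0_iff elim!: dvdE)
  hence "((\<lambda>n. of_real (ln (real n)) * f n) has_sum ?Z * ?L) {0<..}"
  proof (rule has_sum_SigmaD)
    fix n :: nat assume "n \<in> {0<..}"
    hence n: "n > 0" by simp
    hence "(\<Sum>d | d dvd n. mangoldt d * f n) = of_real (ln (real n)) * f n"
      by (simp add: sum_distrib_right[symmetric] mangoldt_sum)
    thus "((\<lambda>d. case (n, d) of (n, d) \<Rightarrow> mangoldt d * f n) has_sum of_real (ln (real n)) * f n) {d. d dvd n}"
      using n by (intro has_sum_finiteI) auto
  qed
  hence "((\<lambda>n. of_real (ln (real (Suc n))) * f (Suc n)) has_sum ?Z * ?L) UNIV"
    unfolding pos[symmetric] by (subst (asm) has_sum_reindex) (auto simp: o_def)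
  thus ?thesis
    unfolding f_Suc by (rule has_sum_imp_sums)
qed

text \<open>The logarithmic derivative in multiplied form, since its nonvanishing consequence is
  derived from this equation.\<close>

lemma zeta_has_field_derivative:
  assumes s: "Re s > 1"
  shows "(zeta has_field_derivative - (zeta s * dirichlet_series (\<lambda>n. mangoldt (Suc n)) s)) (at s)"
proof -
  obtain d where d: "(dirichlet_series (\<lambda>_. 1) has_field_derivative d) (at s)"
    "(\<lambda>n. - of_real (ln (real (Suc n))) * (1 * of_nat (Suc n) powr - s)) sums d"
    using one.has_deriv[OF s] .
  have "d = - (dirichlet_series (\<lambda>_. 1) s * dirichlet_series (\<lambda>n. mangoldt (Suc n)) s)"
    using sums_minus[OF mangoldt_convolution[OF s]] d(2) by (simp add: sums_iff)
  moreover have "(zeta has_field_derivative d) (at s)"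
    by (rule has_field_derivative_transform_within_open[OF d(1), of "{s. Re s > 1}"])
      (use s in \<open>auto simp: open_halfspace_Re_gt zeta_eq zeta_ext_eq_dirichlet\<close>)
  ultimately show ?thesis
    using s by (simp add: zeta_eq zeta_ext_eq_dirichlet)
qed

text \<open>In place of the Euler product: zeta solves a linear differential equation on a convex
  set, so \<open>zeta x * exp (P x)\<close> is constant for a primitive \<open>P\<close> of the
  coefficient, and the constant is nonzero because \<open>zeta 2\<close> is.\<close>

lemma zeta_nonzero_Re_gt_1:
  assumes s: "Re s > 1"
  shows "zeta s \<noteq> 0"
proof -
  let ?S = "{s. Re s > 1}" and ?L = "dirichlet_series (\<lambda>n. mangoldt (Suc n))"
  have S: "open ?S" "convex ?S" by (auto simp: open_halfspace_Re_gt convex_halfspace_Re_gt)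
  have "\<exists>P. \<forall>x\<in>?S. (P has_field_derivative ?L x) (at x within ?S)"
  proof (rule holomorphic_convex_primitive'[OF S(2,1) mangoldt.holomorphic])
    fix P assume "\<And>x. x \<in> ?S \<Longrightarrow> (P has_field_derivative ?L x) (at x within ?S)"
    thus ?thesis by (intro exI[of _ P] ballI)
  qed
  then obtain P where P: "\<forall>x\<in>?S. (P has_field_derivative ?L x) (at x within ?S)" ..
  have "((\<lambda>x. zeta x * exp (P x)) has_field_derivative 0) (at x within ?S)" if "x \<in> ?S" for x
  proof -
    have z: "(zeta has_field_derivative - (zeta x * ?L x)) (at x within ?S)"
      by (rule has_field_derivative_at_within[OF zeta_has_field_derivative]) (use that in simp)
    have "((\<lambda>x. exp (P x)) has_field_derivative exp (P x) * ?L x) (at x within ?S)"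
      by (rule DERIV_chain2[OF DERIV_exp bspec[OF P that]])
    from DERIV_mult[OF z this] show ?thesis by (simp add: mult_ac)
  qed
  then have "\<exists>c. \<forall>x\<in>?S. zeta x * exp (P x) = c"
    by (rule has_field_derivative_zero_constant[OF S(2)])
  then obtain c where c: "\<forall>x\<in>?S. zeta x * exp (P x) = c" ..
  have "zeta 2 \<noteq> 0"
    using zeta_ext_of_real[of 2] by (auto simp: zeta_eq real_zeta_2)
  hence "c \<noteq> 0" using bspec[OF c, of 2] by auto
  thus ?thesis using bspec[OF c, of s] s by auto
qed

text \<open>Termwise, with \<open>\<tau> = t * ln (Suc n)\<close>, it is \<open>3 + 4 * cos \<tau> +
  cos (2 * \<tau>) = 2 * (1 + cos \<tau>)\<^sup>2\<close>, weighted by a nonnegative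
  coefficient.\<close>

lemma mangoldt_341:
  assumes \<sigma>: "\<sigma> > 1"
  defines "L \<equiv> dirichlet_series (\<lambda>n. mangoldt (Suc n))"
  shows "Re (3 * L (of_real \<sigma>) + 4 * L (Complex \<sigma> t) + L (Complex \<sigma> (2 * t))) \<ge> 0"
proof -
  let ?a = "\<lambda>n. mangoldt (Suc n) :: complex"
  have sums: "(\<lambda>n. Re (3 * (?a n * of_nat (Suc n) powr - of_real \<sigma>) + 4 * (?a n * of_nat (Suc n) powr - Complex \<sigma> t)
      + ?a n * of_nat (Suc n) powr - Complex \<sigma> (2 * t)))
      sums Re (3 * L (of_real \<sigma>) + 4 * L (Complex \<sigma> t) + L (Complex \<sigma> (2 * t)))"
    unfolding L_def using \<sigma> by (intro sums_Re sums_add sums_mult mangoldt.sums) auto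
  show ?thesis
  proof (rule sums_le[OF _ sums_zero sums])
    fix n
    define l where "l = ln (real (Suc n))"
    define \<tau> where "\<tau> = t * l"
    have Re_powr: "Re (of_nat (Suc n) powr - Complex \<sigma> u) = exp (- \<sigma> * l) * cos (u * l)" for u
      unfolding Suc_powr_eq_exp l_def[symmetric] by (simp add: Re_exp)
    have of_real: "complex_of_real \<sigma> = Complex \<sigma> 0" by (simp add: complex_eq_iff)
    have "Re (3 * (?a n * of_nat (Suc n) powr - of_real \<sigma>) + 4 * (?a n * of_nat (Suc n) powr - Complex \<sigma> t)
      + ?a n * of_nat (Suc n) powr - Complex \<sigma> (2 * t)) =
      mangoldt (Suc n) * (3 * Re (of_nat (Suc n) powr - Complex \<sigma> 0) + 4 * Re (of_nat (Suc n) powr - Complex \<sigma> t)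
        + Re (of_nat (Suc n) powr - Complex \<sigma> (2 * t)))"
      unfolding of_real_mangoldt[where ?'a = complex, of "Suc n", symmetric] of_real
      by (simp add: algebra_simps del: of_nat_Suc of_real_mangoldt)
    also have "\<dots> = mangoldt (Suc n) * (exp (- \<sigma> * l) * (2 * (1 + cos \<tau>)\<^sup>2))"
    proof -
      have "3 + 4 * cos \<tau> + cos (2 * \<tau>) = 2 * (1 + cos \<tau>)\<^sup>2"
        unfolding cos_double_cos by (simp add: power2_eq_square algebra_simps)
      hence "exp (- \<sigma> * l) * (3 + 4 * cos \<tau> + cos (2 * \<tau>)) = exp (- \<sigma> * l) * (2 * (1 + cos \<tau>)\<^sup>2)" by simp
      thus ?thesis unfolding Re_powr \<tau>_def by (simp add: algebra_simps)
    qed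
    also have "\<dots> \<ge> 0" by (intro mult_nonneg_nonneg mangoldt_nonneg) auto
    finally show "0 \<le> Re (3 * (?a n * of_nat (Suc n) powr - of_real \<sigma>) + 4 * (?a n * of_nat (Suc n) powr - Complex \<sigma> t)
      + ?a n * of_nat (Suc n) powr - Complex \<sigma> (2 * t))" .
  qed
qed

text \<open>
  By the 3-4-1 inequality the logarithmic derivative of \<open>K\<close> has nonpositive real part on the
  real axis.  A zero of \<open>\<zeta>\<close> at \<open>1 + i t\<close> would force \<open>K x \<rightarrow> 0\<close> as \<open>x \<rightarrow> 1\<close>.
\<close>
lemma zeta_341_antimono:
  fixes t :: real
  defines "K \<equiv> \<lambda>s. zeta s ^ 3 * zeta (s + \<i> * of_real t) ^ 4 * zeta (s + 2 * \<i> * of_real t)"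
  assumes "1 < a" "a \<le> b"
  shows "norm (K (of_real b)) \<le> norm (K (of_real a))"
proof -
  let ?L = "dirichlet_series (\<lambda>n. mangoldt (Suc n))"
  have K': "(K has_field_derivative - K s * (3 * ?L s + 4 * ?L (s + \<i> * of_real t) + ?L (s + 2 * \<i> * of_real t))) (at s)"
    if s: "Re s > 1" for s
  proof -
    have z: "((\<lambda>s. zeta (s + w)) has_field_derivative - (zeta (s + w) * ?L (s + w)) * 1) (at s)" if "Re w = 0" for w
      by (rule DERIV_chain2[OF zeta_has_field_derivative]) (use s that in \<open>auto intro!: derivative_eq_intros\<close>)
    have z0: "(zeta has_field_derivative - (zeta s * ?L s)) (at s)"
      by (rule zeta_has_field_derivative[OF s])
    show ?thesis
      unfolding K_def
      by (rule derivative_eq_intros z0 z refl | simp)+ (simp add: algebra_simps power4_eq_xxxx power3_eq_cube power2_eq_square)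
  qed
  \<comment> \<open>The squared modulus is a polynomial in real and imaginary part and satisfies
    \<open>N' = - 2 * Re D * N\<close>, which is nonpositive by the 3-4-1 inequality.\<close>
  define N where "N x = (Re (K (of_real x)))\<^sup>2 + (Im (K (of_real x)))\<^sup>2" for x
  have "N b \<le> N a"
  proof (rule DERIV_nonpos_imp_nonincreasing[OF assms(3)])
    fix x assume "a \<le> x" "x \<le> b"
    hence x: "x > 1" using assms by simp
    define D where "D = 3 * ?L (of_real x) + 4 * ?L (of_real x + \<i> * of_real t) + ?L (of_real x + 2 * \<i> * of_real t)"
    have "(K has_field_derivative - K (of_real x) * D) (at (of_real x))"
      using K'[of "of_real x"] x by (simp add: D_def)
    hence k: "((\<lambda>x. K (of_real x)) has_vector_derivative - K (of_real x) * D) (at x)"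
      by (rule has_vector_derivative_real_field)
    have "(N has_real_derivative 2 * Re (K (of_real x)) * Re (- K (of_real x) * D) + 2 * Im (K (of_real x)) * Im (- K (of_real x) * D)) (at x)"
      unfolding N_def
      by (rule derivative_eq_intros has_field_derivative_Re[OF k] has_field_derivative_Im[OF k] refl)+ simp
    also have "2 * Re (K (of_real x)) * Re (- K (of_real x) * D) + 2 * Im (K (of_real x)) * Im (- K (of_real x) * D) =
        - 2 * Re D * N x"
      by (simp add: N_def algebra_simps power2_eq_square)
    finally have "(N has_real_derivative - 2 * Re D * N x) (at x)" .
    moreover have "Re D \<ge> 0"
    proof -
      have "of_real x + \<i> * of_real t = Complex x t" "of_real x + 2 * \<i> * of_real t = Complex x (2 * t)"
        by (auto simp: complex_eq_iff)
      thus ?thesis using mangoldt_341[OF x, of t] by (simp add: D_def)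
    qed
    moreover have "N x \<ge> 0" by (simp add: N_def)
    ultimately show "\<exists>y. (N has_real_derivative y) (at x) \<and> y \<le> 0"
      by (intro exI[of _ "- 2 * Re D * N x"]) (auto intro: mult_nonneg_nonneg)
  qed
  hence "norm (K (of_real b)) ^ 2 \<le> norm (K (of_real a)) ^ 2"
    by (simp add: N_def cmod_power2)
  thus ?thesis by (rule power2_le_imp_le) auto
qed

theorem zeta_nonzero_Re_ge_1:
  assumes "Re s \<ge> 1" "s \<noteq> 1"
  shows "zeta s \<noteq> 0"
proof (cases "Re s > 1")
  case False
  define t where "t = Im s"
  have s: "s = 1 + \<i> * of_real t" and t: "t \<noteq> 0"
    using assms False by (auto simp: complex_eq_iff t_def)
  show ?thesis
  proof
    assume 0: "zeta s = 0"
    define K where "K s = zeta s ^ 3 * zeta (s + \<i> * of_real t) ^ 4 * zeta (s + 2 * \<i> * of_real t)" for s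
    have sw: "eventually (\<lambda>x::real. x > 1 \<and> x < 2) (at_right 1)"
      using eventually_at_right_real[of 1 2] by simp
    have lim_of_real: "((\<lambda>x. of_real x) \<longlongrightarrow> (1 :: complex)) (at_right 1)"
      by (intro tendsto_eq_intros) auto
    have zeta_diff: "zeta field_differentiable (at w)" if "w \<noteq> 1" for w
      using zeta_ext_holomorphic that unfolding zeta_eq
      by (intro holomorphic_on_imp_differentiable_at[of _ "- {1}"]) auto
    have cont: "isCont zeta (1 + 2 * \<i> * of_real t)"
      using t by (intro field_differentiable_imp_continuous_at zeta_diff) (auto simp: complex_eq_iff)
    have l1: "((\<lambda>x. xi_cofactor (of_real x)) \<longlongrightarrow> xi_cofactor 1) (at_right 1)"
    proof -
      have "isCont xi_cofactor 1"
        using xi_cofactor_holomorphic[of UNIV] holomorphic_on_imp_continuous_on continuous_on_eq_continuous_at by blast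
      thus ?thesis using lim_of_real by (rule isCont_tendsto_compose)
    qed
    have l2: "((\<lambda>x. zeta (of_real x + 2 * \<i> * of_real t)) \<longlongrightarrow> zeta (1 + 2 * \<i> * of_real t)) (at_right 1)"
      by (rule isCont_tendsto_compose[OF cont]) (intro tendsto_intros lim_of_real)
    have l3: "((\<lambda>x. zeta (of_real x + \<i> * of_real t) / (of_real x - 1)) \<longlongrightarrow> deriv zeta s) (at_right 1)"
    proof -
      have "(zeta has_field_derivative deriv zeta s) (at s)"
        using zeta_diff[of s] assms(2) by (simp add: DERIV_deriv_iff_field_differentiable)
      hence "((\<lambda>h. zeta (s + h) / h) \<longlongrightarrow> deriv zeta s) (at 0)"
        unfolding DERIV_def using 0 by simp
      moreover have "filterlim (\<lambda>x. complex_of_real x - 1) (at 0) (at_right 1)"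
        unfolding filterlim_at
      proof
        show "((\<lambda>x. complex_of_real x - 1) \<longlongrightarrow> 0) (at_right 1)"
          using tendsto_diff[OF lim_of_real tendsto_const[of 1]] by simp
        show "eventually (\<lambda>x. complex_of_real x - 1 \<in> UNIV \<and> complex_of_real x - 1 \<noteq> 0) (at_right 1)"
          using sw by eventually_elim (auto simp: complex_eq_iff)
      qed
      ultimately have "((\<lambda>x. zeta (s + (of_real x - 1)) / (of_real x - 1)) \<longlongrightarrow> deriv zeta s) (at_right 1)"
        by (rule filterlim_compose)
      thus ?thesis by (simp add: s algebra_simps)
    qed
    \<comment> \<open>The fourfold zero at \<open>1 + \<i> * t\<close> outweighs the triple pole at
      1 by one factor \<open>x - 1\<close>, which sends the product to 0.\<close>
    have "((\<lambda>x. xi_cofactor (of_real x) ^ 3 * (zeta (of_real x + \<i> * of_real t) / (of_real x - 1)) ^ 4 *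
        zeta (of_real x + 2 * \<i> * of_real t) * (of_real x - 1)) \<longlongrightarrow>
        xi_cofactor 1 ^ 3 * deriv zeta s ^ 4 * zeta (1 + 2 * \<i> * of_real t) * (1 - 1)) (at_right 1)"
      by (intro tendsto_intros l1 l2 l3 lim_of_real)
    hence "((\<lambda>x. K (of_real x)) \<longlongrightarrow>
        xi_cofactor 1 ^ 3 * deriv zeta s ^ 4 * zeta (1 + 2 * \<i> * of_real t) * (1 - 1)) (at_right 1)"
    proof (rule Lim_transform_eventually)
      show "eventually (\<lambda>x. xi_cofactor (of_real x) ^ 3 * (zeta (of_real x + \<i> * of_real t) / (of_real x - 1)) ^ 4 *
        zeta (of_real x + 2 * \<i> * of_real t) * (of_real x - 1) = K (of_real x)) (at_right 1)"
        using sw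
      proof eventually_elim
        case (elim x)
        hence nz: "complex_of_real x - 1 \<noteq> 0" "complex_of_real x \<noteq> 1" by (auto simp: complex_eq_iff)
        have "X ^ 3 * (Z / y) ^ 4 * W * y = (X / y) ^ 3 * Z ^ 4 * W" if "y \<noteq> 0" for X Z W y :: complex
          using that by (simp add: field_simps power4_eq_xxxx power3_eq_cube)
        thus ?case using nz unfolding K_def by (simp add: zeta_eq zeta_ext_def[of "of_real x"])
      qed
    qed
    hence "((\<lambda>x. norm (K (of_real x))) \<longlongrightarrow> norm (0 :: complex)) (at_right 1)"
      by (intro tendsto_norm) simp
    moreover have "eventually (\<lambda>x. norm (K (of_real 2)) \<le> norm (K (of_real x))) (at_right 1)"
      using sw
    proof eventually_elim
      case (elim x)
      thus ?case unfolding K_def by (intro zeta_341_antimono) auto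
    qed
    ultimately have "norm (K (of_real 2)) \<le> norm (0 :: complex)"
      by (intro tendsto_lowerbound) auto
    hence "K 2 = 0" by simp
    moreover have "K 2 \<noteq> 0"
      unfolding K_def by (auto simp: zeta_nonzero_Re_gt_1)
    ultimately show False by simp
  qed
qed (use zeta_nonzero_Re_gt_1 in auto)

section \<open>Even entire functions of slow growth\<close>

text \<open>The local cofactor near \<open>\<rho>\<close> and the quotient away from it agree on the
  overlap and glue to an entire function; \<open>n = 0\<close> occurs when
  \<open>G \<rho> \<noteq> 0\<close>.\<close>

lemma entire_factor_zero:
  fixes G :: "complex \<Rightarrow> complex"
  assumes "G holomorphic_on UNIV" "\<exists>w. G w \<noteq> 0"
  obtains n h where "h holomorphic_on UNIV" "h \<rho> \<noteq> 0" "\<And>z. G z = (z - \<rho>) ^ n * h z"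
proof -
  from zorder_exist_zero[OF assms(1), of \<rho>] assms(2)
  obtain r g n where r: "r > 0" "g holomorphic_on cball \<rho> r"
    "\<forall>w\<in>cball \<rho> r. G w = g w * (w - \<rho>) ^ n \<and> g w \<noteq> 0"
    by auto
  define h where "h w = (if w \<in> ball \<rho> r then g w else G w / (w - \<rho>) ^ n)" for w
  have h': "h w = G w / (w - \<rho>) ^ n" if "w \<noteq> \<rho>" for w
    using r that by (auto simp: h_def)
  have "h holomorphic_on (ball \<rho> r \<union> - {\<rho>})"
  proof (rule holomorphic_on_Un)
    have "g holomorphic_on ball \<rho> r"
      by (rule holomorphic_on_subset[OF r(2)]) auto
    thus "h holomorphic_on ball \<rho> r"
      by (rule holomorphic_transform) (auto simp: h_def)
    have "(\<lambda>w. G w / (w - \<rho>) ^ n) holomorphic_on - {\<rho>}"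
      by (intro holomorphic_intros holomorphic_on_subset[OF assms(1)]) auto
    thus "h holomorphic_on - {\<rho>}"
      by (rule holomorphic_transform) (auto simp: h')
  qed auto
  also have "ball \<rho> r \<union> - {\<rho>} = UNIV"
    using r(1) by auto
  finally have "h holomorphic_on UNIV" .
  moreover have "h \<rho> \<noteq> 0"
    using r by (auto simp: h_def)
  moreover have "G z = (z - \<rho>) ^ n * h z" for z
    using r by (cases "z = \<rho>") (auto simp: h' h_def)
  ultimately show ?thesis
    by (rule that)
qed

text \<open>Linear factors in the form \<open>1 - z / \<rho>\<close> equal 1 at the origin, so
  splitting them off leaves the value there unchanged.\<close>

lemma entire_factor_finite_zeros:
  fixes F :: "complex \<Rightarrow> complex"
  assumes F: "F holomorphic_on UNIV" "\<exists>w. F w \<noteq> 0" and Z: "finite Z" "0 \<notin> Z"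
  obtains G where "G holomorphic_on UNIV" "\<And>\<rho>. \<rho> \<in> Z \<Longrightarrow> G \<rho> \<noteq> 0"
    "\<And>z. F z = (\<Prod>\<rho>\<in>Z. (1 - z / \<rho>) ^ nat (zorder F \<rho>)) * G z"
proof -
  have "\<exists>n G. G holomorphic_on UNIV \<and> (\<forall>\<rho>\<in>Z. G \<rho> \<noteq> 0) \<and>
          (\<forall>z. F z = (\<Prod>\<rho>\<in>Z. (1 - z / \<rho>) ^ n \<rho>) * G z)"
    using Z
  proof (induction Z)
    case empty
    thus ?case using F by auto
  next
    case (insert \<rho> Z)
    then obtain n G where G: "G holomorphic_on UNIV" "\<forall>\<rho>\<in>Z. G \<rho> \<noteq> 0"
      "\<And>z. F z = (\<Prod>\<rho>\<in>Z. (1 - z / \<rho>) ^ n \<rho>) * G z" by auto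
    have "\<exists>w. G w \<noteq> 0"
      using F(2) G(3) by auto
    from entire_factor_zero[OF G(1) this, of \<rho>]
    obtain m h where h: "h holomorphic_on UNIV" "h \<rho> \<noteq> 0" "\<And>z. G z = (z - \<rho>) ^ m * h z"
      by metis
    have \<rho>: "\<rho> \<noteq> 0" using insert by auto
    have *: "(z - \<rho>) ^ m = (1 - z / \<rho>) ^ m * (- \<rho>) ^ m" for z
      using \<rho> by (simp flip: power_mult_distrib add: field_simps)
    have "F z = (\<Prod>x\<in>insert \<rho> Z. (1 - z / x) ^ (n(\<rho> := m)) x) * ((- \<rho>) ^ m * h z)" for z
    proof -
      have "(\<Prod>x\<in>Z. (1 - z / x) ^ (n(\<rho> := m)) x) = (\<Prod>\<rho>\<in>Z. (1 - z / \<rho>) ^ n \<rho>)"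
        using insert.hyps by (intro prod.cong) auto
      thus ?thesis
        using insert by (simp add: G(3) h(3) *)
    qed
    moreover have "h \<rho>' \<noteq> 0" if "\<rho>' \<in> Z" for \<rho>'
      using G(2) h(3)[of \<rho>'] that by auto
    ultimately show ?case
      using h \<rho> by (intro exI[of _ "n(\<rho> := m)"] exI[of _ "\<lambda>z. (- \<rho>) ^ m * h z"])
        (auto intro!: holomorphic_intros)
  qed
  then obtain n G where G: "G holomorphic_on UNIV" "\<And>\<rho>. \<rho> \<in> Z \<Longrightarrow> G \<rho> \<noteq> 0"
      "\<And>z. F z = (\<Prod>\<rho>\<in>Z. (1 - z / \<rho>) ^ n \<rho>) * G z" by blast
  \<comment> \<open>The induction yields unspecified exponents; they are the multiplicities because
    the remaining factors and \<open>G\<close> do not vanish at \<open>\<rho>\<close>.\<close>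
  have "zorder F \<rho> = int (n \<rho>)" if \<rho>: "\<rho> \<in> Z" for \<rho>
  proof (rule zorder_eqI[of UNIV])
    let ?g = "\<lambda>z. (- 1 / \<rho>) ^ n \<rho> * (\<Prod>\<rho>\<in>Z-{\<rho>}. (1 - z / \<rho>) ^ n \<rho>) * G z"
    show "?g holomorphic_on UNIV"
      using Z by (intro holomorphic_intros G) auto
    show "?g \<rho> \<noteq> 0"
      using Z \<rho> G(2)[OF \<rho>] by (auto simp: field_simps)
    have *: "(1 - w / \<rho>) = (- 1 / \<rho>) * (w - \<rho>)" for w
    proof -
      have "\<rho> \<noteq> 0" using \<rho> Z by auto
      thus ?thesis by (simp add: field_simps)
    qed
    have **: "(1 - w / \<rho>) ^ n \<rho> = (- 1 / \<rho>) ^ n \<rho> * (w - \<rho>) ^ n \<rho>" for w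
      by (simp only: * power_mult_distrib)
    show "F w = ?g w * (w - \<rho>) powi int (n \<rho>)" for w
      by (subst G(3), subst prod.remove[OF Z(1) \<rho>]) (simp only: ** power_int_of_nat mult_ac)
  qed auto
  hence "(\<Prod>\<rho>\<in>Z. (1 - z / \<rho>) ^ n \<rho>) = (\<Prod>\<rho>\<in>Z. (1 - z / \<rho>) ^ nat (zorder F \<rho>))" for z
    by (intro prod.cong) auto
  thus ?thesis
    using G by (intro that[of G]) auto
qed

text \<open>The Schwarz lemma applied twice: \<open>f z = z * h z\<close> with
  \<open>h 0 = deriv f 0 = 0\<close>. That \<open>h\<close> maps into the open disc is the equality
  case: equality at one point makes \<open>f\<close> a rotation, whose derivative at 0 has modulus
  1.\<close>

lemma Schwarz_double_zero:
  assumes holf: "f holomorphic_on ball 0 1" and "f 0 = 0" "deriv f 0 = 0"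
    and no: "\<And>z. norm z < 1 \<Longrightarrow> norm (f z) < 1"
    and z: "norm z < 1"
  shows "norm (f z) \<le> norm z ^ 2"
proof -
  obtain h where h: "h holomorphic_on ball 0 1" "\<And>z. norm z < 1 \<Longrightarrow> f z = z * h z" "deriv f 0 = h 0"
    by (rule Schwarz3[OF holf \<open>f 0 = 0\<close>]) auto
  have less: "norm (h w) < 1" if w: "norm w < 1" for w
  proof (cases "w = 0")
    case False
    have "norm (f w) \<noteq> norm w"
    proof
      assume "norm (f w) = norm w"
      then obtain \<alpha> where \<alpha>: "\<And>z. norm z < 1 \<Longrightarrow> f z = \<alpha> * z" "norm \<alpha> = 1"
        using Schwarz_Lemma(3)[OF holf \<open>f 0 = 0\<close> no z] w False by auto
      have "(f has_field_derivative \<alpha>) (at 0)"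
        by (rule has_field_derivative_transform_within_open[where f = "\<lambda>z. \<alpha> * z" and S = "ball 0 1"])
           (auto intro!: derivative_eq_intros simp: \<alpha>)
      hence "deriv f 0 = \<alpha>"
        by (rule DERIV_imp_deriv)
      thus False using \<alpha> assms by auto
    qed
    moreover have "norm (f w) \<le> norm w"
      by (rule Schwarz_Lemma(1)[OF holf \<open>f 0 = 0\<close> no w])
    ultimately have "norm w * norm (h w) < norm w * 1"
      using h(2)[OF w] by (simp add: norm_mult)
    thus ?thesis using False by simp
  qed (use h assms in auto)
  have "norm (h z) \<le> norm z"
    using h assms by (intro Schwarz_Lemma(1)[OF h(1) _ less z]) auto
  thus ?thesis
    by (simp add: h(2)[OF z] norm_mult power2_eq_square mult_left_mono)
qed

text \<open>The map taking \<open>v\<close> to \<open>v / (2 * M - v)\<close> sends the half plane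
  \<open>Re v < M\<close> into the unit disc and fixes 0. The double zero produces the factor
  \<open>norm z ^ 2 / R ^ 2\<close>, which for fixed \<open>z\<close> defeats any \<open>M\<close>
  that is small compared with \<open>R ^ 2\<close>.\<close>

lemma Borel_Caratheodory_double_zero:
  assumes g: "g holomorphic_on ball 0 R" and "g 0 = 0" "deriv g 0 = 0"
    and M: "\<And>z. norm z < R \<Longrightarrow> Re (g z) < M"
    and z: "norm z < R"
  shows "norm (g z) \<le> 2 * M * norm z ^ 2 / (R ^ 2 - norm z ^ 2)"
proof -
  have R: "R > 0" using z norm_ge_zero[of z] by linarith
  have Mpos: "M > 0" using M[of 0] R assms(2) by auto
  define \<phi> where "\<phi> w = g (of_real R * w) / (2 * of_real M - g (of_real R * w))" for w
  have in_ball: "of_real R * w \<in> ball 0 R" if "norm w < 1" for w :: complex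
    using that R by (simp add: norm_mult)
  have nz: "2 * of_real M - g (of_real R * w) \<noteq> 0" if "norm w < 1" for w
  proof
    assume "2 * of_real M - g (of_real R * w) = 0"
    hence "Re (g (of_real R * w)) = 2 * M" by (simp add: complex_eq_iff)
    thus False using M[of "of_real R * w"] in_ball[OF that] Mpos by auto
  qed
  have g': "(\<lambda>w. g (of_real R * w)) holomorphic_on ball 0 1"
    by (rule holomorphic_on_compose_gen[of "\<lambda>w. of_real R * w" "ball 0 1" g "ball 0 R", unfolded o_def])
       (use g in_ball in \<open>auto intro!: holomorphic_intros\<close>)
  have \<phi>_hol: "\<phi> holomorphic_on ball 0 1"
    unfolding \<phi>_def using nz by (intro holomorphic_intros g') auto
  have lt: "norm (\<phi> w) < 1" if w: "norm w < 1" for w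
  proof -
    let ?v = "g (of_real R * w)"
    have "Re ?v < M" using M in_ball[OF w] by auto
    have "(Re ?v)\<^sup>2 < (2 * M - Re ?v)\<^sup>2"
    proof -
      have "(2 * M - Re ?v)\<^sup>2 - (Re ?v)\<^sup>2 = 4 * M * (M - Re ?v)"
        by (simp add: power2_eq_square algebra_simps)
      also have "\<dots> > 0" using Mpos \<open>Re ?v < M\<close> by simp
      finally show ?thesis by simp
    qed
    hence "norm ?v < norm (2 * of_real M - ?v)"
      by (simp add: cmod_def)
    thus ?thesis using nz[OF w] by (simp add: \<phi>_def norm_divide)
  qed
  have "(g has_field_derivative 0) (at 0)"
    using holomorphic_derivI[OF g open_ball, of 0] R assms by auto
  hence g0: "((\<lambda>w. g (of_real R * w)) has_field_derivative 0) (at 0)"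
    using DERIV_chain2[of g 0 "\<lambda>w. of_real R * w" 0 "of_real R" UNIV]
    by (auto intro!: derivative_eq_intros)
  have "(\<phi> has_field_derivative 0) (at 0)"
    unfolding \<phi>_def using nz[of 0] assms(2)
    by (auto intro!: derivative_eq_intros g0)
  hence d: "deriv \<phi> 0 = 0" by (rule DERIV_imp_deriv)
  define w where "w = z / of_real R"
  have w: "norm w < 1" using z R by (simp add: w_def norm_divide)
  have zw: "of_real R * w = z" using R by (simp add: w_def)
  have \<phi>w: "norm (\<phi> w) \<le> norm w ^ 2"
    by (rule Schwarz_double_zero[OF \<phi>_hol _ d lt w]) (auto simp: \<phi>_def assms(2))
  have w2: "norm w ^ 2 < 1" using w by (simp add: power_less_one_iff abs_square_less_1)
  have eq: "g z * (1 + \<phi> w) = 2 * of_real M * \<phi> w"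
    using nz[OF w] unfolding \<phi>_def zw by (simp add: field_simps)
  have "norm (g z) * (1 - norm w ^ 2) \<le> norm (g z) * norm (1 + \<phi> w)"
  proof (intro mult_left_mono)
    have "norm (1::complex) \<le> norm (1 + \<phi> w) + norm (\<phi> w)"
      using norm_triangle_ineq4[of "1 + \<phi> w" "\<phi> w"] by simp
    thus "1 - norm w ^ 2 \<le> norm (1 + \<phi> w)" using \<phi>w by simp
  qed auto
  also have "\<dots> = 2 * M * norm (\<phi> w)"
    using arg_cong[OF eq, of norm] Mpos by (simp add: norm_mult)
  also have "\<dots> \<le> 2 * M * norm w ^ 2"
    using \<phi>w Mpos by (intro mult_left_mono) auto
  finally have "norm (g z) \<le> 2 * M * norm w ^ 2 / (1 - norm w ^ 2)"
    using w2 by (simp add: field_simps)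
  also have "\<dots> = 2 * M * norm z ^ 2 / (R ^ 2 - norm z ^ 2)"
    using R by (simp add: w_def norm_divide field_simps)
  finally show ?thesis .
qed

text \<open>Evenness makes the derivative of \<open>H\<close> vanish at 0, so the logarithm
  normalised by \<open>g 0 = 0\<close> has a double zero there.\<close>

lemma even_nonvanishing_near_1:
  assumes H: "H holomorphic_on ball 0 R" and even: "\<And>z. norm z < R \<Longrightarrow> H (-z) = H z"
    and "H 0 = 1" and nz: "\<And>z. norm z < R \<Longrightarrow> H z \<noteq> 0"
    and M: "\<And>z. norm z < R \<Longrightarrow> norm (H z) < exp M"
    and z: "norm z < R"
  shows "\<exists>u. H z = exp u \<and> norm u \<le> 2 * M * norm z ^ 2 / (R ^ 2 - norm z ^ 2)"
proof -
  have R: "R > 0" using z norm_ge_zero[of z] by linarith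
  obtain L where L: "L holomorphic_on ball 0 R" "\<And>z. z \<in> ball 0 R \<Longrightarrow> H z = exp (L z)"
    using holomorphic_logarithm_exists[of "ball 0 R" H 0] H nz R
    by (metis centre_in_ball convex_ball mem_ball_0 open_ball)
  define g where "g z = L z - L 0" for z
  have g: "g holomorphic_on ball 0 R" unfolding g_def by (intro holomorphic_intros L)
  have Hg: "H z = exp (g z)" if "norm z < R" for z
    using L(2)[of z] L(2)[of 0] that \<open>H 0 = 1\<close> R by (simp add: g_def exp_diff)
  have H0: "(H has_field_derivative deriv H 0) (at 0)"
    using holomorphic_derivI[OF H open_ball, of 0] R by auto
  have "((\<lambda>z. H (-z)) has_field_derivative - deriv H 0) (at 0)"
    using DERIV_chain2[of H "deriv H 0" "\<lambda>z. -z" 0 "-1" UNIV] H0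
      DERIV_minus[OF DERIV_ident, of 0 UNIV] by simp
  hence "(H has_field_derivative - deriv H 0) (at 0)"
    by (rule has_field_derivative_transform_within_open[where S = "ball 0 R"]) (use even R in auto)
  hence "deriv H 0 = - deriv H 0"
    using H0 DERIV_unique by blast
  hence dH: "deriv H 0 = 0" by simp
  have g0: "(g has_field_derivative deriv g 0) (at 0)"
    using holomorphic_derivI[OF g open_ball, of 0] R by auto
  have "((\<lambda>z. exp (g z)) has_field_derivative exp (g 0) * deriv g 0) (at 0)"
    by (auto intro!: derivative_eq_intros g0)
  hence "(H has_field_derivative exp (g 0) * deriv g 0) (at 0)"
    by (rule has_field_derivative_transform_within_open[where S = "ball 0 R"]) (use Hg R in auto)
  hence "deriv g 0 = 0"
    using DERIV_unique[OF H0] dH exp_not_eq_zero[of "g 0"] by (metis mult_eq_0_iff)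
  moreover have "Re (g z) < M" if "norm z < R" for z
    using M[OF that] by (simp add: Hg[OF that])
  ultimately have "norm (g z) \<le> 2 * M * norm z ^ 2 / (R ^ 2 - norm z ^ 2)"
    by (intro Borel_Caratheodory_double_zero[OF g _ _ _ z]) (auto simp: g_def)
  thus ?thesis using Hg[OF z] by blast
qed

text \<open>Symmetrising does the work of evenness: the factors at \<open>z\<close> and
  \<open>- z\<close> combine to \<open>1 - z ^ 2 / \<rho> ^ 2\<close>, and the cofactor
  \<open>G w * G (- w)\<close> is an even function to which the double zero estimate
  applies.\<close>

theorem even_product_tendsto:
  fixes F :: "complex \<Rightarrow> complex"
  assumes F: "F holomorphic_on UNIV" and F0: "F 0 \<noteq> 0"
    and growth: "\<And>e. e > 0 \<Longrightarrow>
      eventually (\<lambda>r. \<forall>z. norm z \<le> r \<longrightarrow> norm (F z) \<le> exp (e * r ^ 2)) at_top"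
  shows "((\<lambda>R. \<Prod>\<rho> | F \<rho> = 0 \<and> norm \<rho> < R. (1 - z ^ 2 / \<rho> ^ 2) ^ nat (zorder F \<rho>))
            \<longlongrightarrow> F z * F (-z) / F 0 ^ 2) at_top"
proof -
  define P where "P R = (\<Prod>\<rho> | F \<rho> = 0 \<and> norm \<rho> < R. (1 - z ^ 2 / \<rho> ^ 2) ^ nat (zorder F \<rho>))" for R
  define Q where "Q = F z * F (-z) / F 0 ^ 2"
  have *: "eventually (\<lambda>R. \<exists>u. P R = Q * exp u \<and> norm u \<le> e) at_top" if e: "e > 0" for e :: real
  proof -
    \<comment> \<open>\<open>K\<close> absorbs the division by \<open>F 0 ^ 2\<close> and makes the
      modulus bound strict. The constant 64 lets the growth term, \<open>8 * d * R ^ 2\<close> in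
      \<open>M\<close>, cost at most a quarter of \<open>e * R ^ 2\<close>; the last lower bound on
      \<open>R\<close> does the same for \<open>K\<close>.\<close>
    define K where "K = 1 + 2 * \<bar>ln (norm (F 0))\<bar>"
    define d where "d = e / (64 * (norm z ^ 2 + 1))"
    have d: "d > 0" using e unfolding d_def by (intro divide_pos_pos mult_pos_pos add_nonneg_pos) auto
    have "eventually (\<lambda>R. \<forall>w. norm w \<le> 2 * R \<longrightarrow> norm (F w) \<le> exp (d * (2 * R) ^ 2)) at_top"
    proof -
      have "filterlim (\<lambda>R::real. 2 * R) at_top at_top"
        by (intro filterlim_tendsto_pos_mult_at_top[OF tendsto_const] filterlim_ident) auto
      from eventually_compose_filterlim[OF growth[OF d] this] show ?thesis .
    qed
    moreover have "eventually (\<lambda>R. R > max 1 (norm z * 2)) at_top"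
      by (rule eventually_gt_at_top)
    moreover have "eventually (\<lambda>R. R > 8 * K * norm z ^ 2 / e) at_top"
      by (rule eventually_gt_at_top)
    ultimately show ?thesis
    proof eventually_elim
      case (elim R)
      have R: "R > 1" "norm z * 2 < R" using elim by auto
      define Z where "Z = {\<rho>. F \<rho> = 0 \<and> norm \<rho> < R}"
      have nc: "\<not> F constant_on UNIV" if "F w = 0" for w
        using F0 that unfolding constant_on_def by (metis UNIV_I)
      have finZ: "finite Z"
      proof (cases "Z = {}")
        case False
        then obtain w where "F w = 0" by (auto simp: Z_def)
        from holomorphic_compact_finite_zeros[OF F _ _ compact_cball _ nc[OF this], of 0 R]
        have "finite {z \<in> cball 0 R. F z = 0}" by auto
        thus ?thesis by (rule finite_subset[rotated]) (auto simp: Z_def)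
      qed auto
      have Z0: "0 \<notin> Z" using F0 by (auto simp: Z_def)
      obtain G where G: "G holomorphic_on UNIV" "\<And>\<rho>. \<rho> \<in> Z \<Longrightarrow> G \<rho> \<noteq> 0"
        "\<And>z. F z = (\<Prod>\<rho>\<in>Z. (1 - z / \<rho>) ^ nat (zorder F \<rho>)) * G z"
        using entire_factor_finite_zeros[OF F _ finZ Z0] F0 by metis
      have G0: "G 0 = F 0" using G(3)[of 0] by simp
      have Gnz: "G w \<noteq> 0" if "norm w < R" for w
        using G(2,3)[of w] that by (cases "w \<in> Z") (auto simp: Z_def)
      \<comment> \<open>On the circle of twice the radius every split-off factor has modulus at
        least 1, so \<open>G\<close> is bounded by \<open>F\<close> there; the maximum principle
        carries the bound inside.\<close>
      have sphere: "norm (G w) \<le> exp (d * (2 * R) ^ 2)" if w: "norm w = 2 * R" for w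
      proof -
        have "(\<Prod>\<rho>\<in>Z. (1::real)) \<le> (\<Prod>\<rho>\<in>Z. norm (1 - w / \<rho>) ^ nat (zorder F \<rho>))"
        proof (rule prod_mono)
          fix \<rho> assume \<rho>: "\<rho> \<in> Z"
          hence "\<rho> \<noteq> 0" "norm \<rho> < R" using Z0 by (auto simp: Z_def)
          hence "norm (w / \<rho>) \<ge> 2" using w by (simp add: norm_divide field_simps)
          moreover have "norm (w / \<rho>) \<le> norm (1 - w / \<rho>) + 1"
            using norm_triangle_ineq4[of 1 "1 - w / \<rho>"] by simp
          ultimately have "norm (1 - w / \<rho>) \<ge> 1" by linarith
          thus "0 \<le> (1::real) \<and> 1 \<le> norm (1 - w / \<rho>) ^ nat (zorder F \<rho>)"
            by (simp add: one_le_power)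
        qed
        hence "1 * norm (G w) \<le> norm (F w)"
          unfolding G(3)[of w] norm_mult prod_norm[symmetric] norm_power
          by (intro mult_right_mono) auto
        also have "\<dots> \<le> exp (d * (2 * R) ^ 2)" using elim w by auto
        finally show ?thesis by simp
      qed
      have G_le: "norm (G w) \<le> exp (d * (2 * R) ^ 2)" if w: "norm w < R" for w
      proof (rule maximum_modulus_frontier[where S = "ball 0 (2 * R)" and f = G])
        show "G holomorphic_on interior (ball 0 (2 * R))"
          by (rule holomorphic_on_subset[OF G(1)]) auto
        show "continuous_on (closure (ball 0 (2 * R))) G"
          by (rule holomorphic_on_imp_continuous_on, rule holomorphic_on_subset[OF G(1)]) auto
        show "norm (G v) \<le> exp (d * (2 * R) ^ 2)" if "v \<in> frontier (ball 0 (2 * R))" for v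
          using that R by (intro sphere) auto
        show "w \<in> ball 0 (2 * R)" using w R by auto
      qed auto
      define H where "H w = G w * G (-w) / F 0 ^ 2" for w
      define M where "M = d * (2 * R) ^ 2 + d * (2 * R) ^ 2 + K"
      have "(\<lambda>w. G (-w)) holomorphic_on UNIV"
        by (rule holomorphic_on_compose_gen[of uminus UNIV G UNIV, unfolded o_def])
          (auto intro!: holomorphic_intros G(1))
      hence Hhol: "H holomorphic_on ball 0 R"
        unfolding H_def using F0
        by (intro holomorphic_intros) (auto intro: holomorphic_on_subset G(1))
      have HM: "norm (H w) < exp M" if w: "norm w < R" for w
      proof -
        have "norm (H w) = norm (G w) * norm (G (-w)) * inverse (norm (F 0) ^ 2)"
          by (simp add: H_def norm_mult norm_divide norm_power field_simps)
        also have "inverse (norm (F 0) ^ 2) = exp (- 2 * ln (norm (F 0)))"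
          using F0 by (simp add: exp_minus exp_double)
        also have "norm (G w) * norm (G (-w)) * exp (- 2 * ln (norm (F 0))) \<le>
          exp (d * (2 * R) ^ 2) * exp (d * (2 * R) ^ 2) * exp (- 2 * ln (norm (F 0)))"
          using G_le w by (intro mult_mono) auto
        also have "\<dots> = exp (d * (2 * R) ^ 2 + d * (2 * R) ^ 2 - 2 * ln (norm (F 0)))"
          by (simp flip: exp_add)
        also have "\<dots> < exp M" by (auto simp: M_def K_def)
        finally show ?thesis .
      qed
      have "\<exists>u. H z = exp u \<and> norm u \<le> 2 * M * norm z ^ 2 / (R ^ 2 - norm z ^ 2)"
        by (rule even_nonvanishing_near_1[OF Hhol _ _ _ HM])
          (use Gnz F0 G0 R norm_ge_zero[of z] in \<open>auto simp: H_def power2_eq_square\<close>)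
      then obtain u where u: "H z = exp u" "norm u \<le> 2 * M * norm z ^ 2 / (R ^ 2 - norm z ^ 2)"
        by blast
      have "2 * M * norm z ^ 2 / (R ^ 2 - norm z ^ 2) \<le> e"
      proof -
        have "(norm z * 2) ^ 2 \<le> R ^ 2" using R by (intro power_mono) auto
        hence z2: "4 * norm z ^ 2 \<le> R ^ 2" by (simp add: power_mult_distrib)
        have R2: "R \<le> R ^ 2" "R ^ 2 > 0" using R by (auto simp: power2_eq_square)
        have "2 * M * norm z ^ 2 \<le> e * (R ^ 2 / 2)"
        proof -
          have "16 * d * norm z ^ 2 * R ^ 2 \<le> e / 4 * R ^ 2"
          proof (rule mult_right_mono)
            have "64 * d * norm z ^ 2 \<le> 64 * d * (norm z ^ 2 + 1)" using d by simp
            also have "\<dots> = e"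
            proof -
              have "norm z ^ 2 + 1 \<noteq> 0" using zero_le_power2[of "norm z"] by linarith
              thus ?thesis by (simp add: d_def field_simps)
            qed
            finally show "16 * d * norm z ^ 2 \<le> e / 4" by simp
          qed auto
          moreover have "2 * K * norm z ^ 2 \<le> e / 4 * R ^ 2"
          proof -
            have "8 * K * norm z ^ 2 < R * e" using elim e by (simp add: pos_divide_less_eq)
            also have "R * e \<le> R ^ 2 * e" using R2 e by (intro mult_right_mono) auto
            finally show ?thesis by (simp add: mult_ac)
          qed
          ultimately show ?thesis by (simp add: M_def algebra_simps power2_eq_square)
        qed
        also have "\<dots> \<le> e * (R ^ 2 - norm z ^ 2)"
          using z2 e zero_le_power2[of "norm z"] by (intro mult_left_mono) linarith+
        finally show ?thesis
          using z2 R2 zero_le_power2[of "norm z"] by (subst pos_divide_le_eq) linarith+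
      qed
      hence "norm (- u) \<le> e" using u by simp
      moreover have "P R = Q * exp (- u)"
      proof -
        have "F z * F (- z) = P R * (G z * G (- z))"
          unfolding G(3)[of z] G(3)[of "-z"] P_def Z_def[symmetric]
          by (simp add: prod.distrib[symmetric] power_mult_distrib[symmetric] mult_ac
              square_diff_one_factored power2_eq_square algebra_simps flip: prod.distrib)
        also have "G z * G (- z) = exp u * F 0 ^ 2"
          using u(1) F0 by (simp add: H_def field_simps)
        finally show ?thesis using F0 by (simp add: Q_def exp_minus field_simps)
      qed
      ultimately show ?case by blast
    qed
  qed
  have "(P \<longlongrightarrow> Q) at_top"
  proof (rule tendstoI)
    fix \<epsilon> :: real assume \<epsilon>: "\<epsilon> > 0"
    have "isCont (\<lambda>u. Q * exp u) 0" by (intro continuous_intros)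
    then obtain \<delta> where \<delta>: "\<delta> > 0" "\<And>u. dist u 0 < \<delta> \<Longrightarrow> dist (Q * exp u) (Q * exp 0) < \<epsilon>"
      using \<epsilon> unfolding continuous_at_eps_delta by blast
    show "eventually (\<lambda>R. dist (P R) Q < \<epsilon>) at_top"
      using *[OF half_gt_zero[OF \<delta>(1)]] by (rule eventually_mono) (use \<delta> in auto)
  qed
  thus ?thesis by (simp add: P_def[abs_def] Q_def)
qed

section \<open>Shifts of real even entire functions\<close>

locale even_real_entire =
  fixes F :: "complex \<Rightarrow> complex"
  assumes holo: "F holomorphic_on UNIV"
    and even [simp]: "F (- z) = F z"
    and cnj_F: "F (cnj z) = cnj (F z)"
    and F0: "F 0 \<noteq> 0"
    and nonconst: "\<exists>w. F w ^ 2 \<noteq> F 0 ^ 2"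
    and growth: "e > 0 \<Longrightarrow>
      eventually (\<lambda>r. \<forall>z. norm z \<le> r \<longrightarrow> norm (F z) \<le> exp (e * r ^ 2)) at_top"
begin

text \<open>Without zeros all the finite products are empty, and their limit would make
  \<open>F ^ 2\<close> constant.\<close>

lemma ex_zero: "\<exists>\<rho>. F \<rho> = 0"
proof (rule ccontr)
  assume *: "\<not> (\<exists>\<rho>. F \<rho> = 0)"
  obtain w where w: "F w ^ 2 \<noteq> F 0 ^ 2" using nonconst by blast
  have "((\<lambda>R::real. 1) \<longlongrightarrow> F w * F w / F 0 ^ 2) at_top"
    using even_product_tendsto[OF holo F0 growth, of w] * by simp
  hence "F w * F w / F 0 ^ 2 = 1"
    by (metis LIM_unique tendsto_const tendsto_unique trivial_limit_at_top_linorder)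
  thus False using w F0 by (simp add: power2_eq_square)
qed

lemma finite_zeros: "finite {\<rho>. F \<rho> = 0 \<and> norm \<rho> < R}"
proof -
  have "\<not> F constant_on UNIV"
    using nonconst unfolding constant_on_def by (metis UNIV_I)
  from holomorphic_compact_finite_zeros[OF holo _ _ compact_cball _ this, of 0 R]
  have "finite {z \<in> cball 0 R. F z = 0}" by auto
  thus ?thesis by (rule finite_subset[rotated]) auto
qed

lemma zorder_pos:
  assumes "F \<rho> = 0"
  shows "nat (zorder F \<rho>) > 0"
  using zorder_exist_zero[OF holo, of \<rho>] F0 assms by auto

text \<open>
  Multiplying the factors at \<open>z\<close> and \<open>cnj z\<close> makes the product symmetric in \<open>\<rho>\<close>
  and \<open>- cnj \<rho>\<close>, so the symmetry of the multiplicities is never needed.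
\<close>
lemma cmod_product_tendsto:
  "((\<lambda>R. \<Prod>\<rho> | F \<rho> = 0 \<and> norm \<rho> < R.
      (cmod (1 - z ^ 2 / \<rho> ^ 2) * cmod (1 - cnj z ^ 2 / \<rho> ^ 2)) ^ nat (zorder F \<rho>))
    \<longlongrightarrow> cmod (F z) ^ 4 / cmod (F 0) ^ 4) at_top"
proof -
  from tendsto_mult[OF tendsto_norm[OF even_product_tendsto[OF holo F0 growth, of z]]
      tendsto_norm[OF even_product_tendsto[OF holo F0 growth, of "cnj z"]]]
  show ?thesis
    by (simp add: norm_mult norm_divide norm_power prod_norm[symmetric] prod.distrib[symmetric]
        power_mult_distrib[symmetric] cnj_F power4_eq_xxxx power2_eq_square mult_ac
        flip: prod_norm prod.distrib)
qed

end

text \<open>Both numbers have the imaginary part \<open>Im z - Im r\<close>, and their real parts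
  are \<open>Re z + (h + Re r)\<close> and \<open>Re z - (h + Re r)\<close>.\<close>

lemma cmod_reflect_diff:
  "cmod (z + of_real h + cnj r) ^ 2 - cmod (z - of_real h - r) ^ 2 = 4 * Re z * (h + Re r)"
  unfolding cmod_power2 by (simp add: power2_eq_square algebra_simps)

lemma cmod_reflect_le:
  assumes "Re z \<ge> 0" "\<bar>Re r\<bar> \<le> h"
  shows "cmod (z - of_real h - r) \<le> cmod (z + of_real h + cnj r)"
proof (rule power2_le_imp_le)
  have "4 * Re z * (h + Re r) \<ge> 0" using assms by (intro mult_nonneg_nonneg) auto
  thus "cmod (z - of_real h - r) ^ 2 \<le> cmod (z + of_real h + cnj r) ^ 2"
    using cmod_reflect_diff[of z h r] by linarith
qed auto

text \<open>The four distances are those from \<open>z\<close> to the orbit of \<open>r\<close>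
  under negation and conjugation, an orbit that is symmetric about the imaginary axis.\<close>

lemma factor_expand:
  assumes "r \<noteq> 0"
  shows "cmod (1 - z ^ 2 / r ^ 2) * cmod (1 - cnj z ^ 2 / r ^ 2) =
    cmod (z - r) * cmod (z + r) * cmod (z - cnj r) * cmod (z + cnj r) / cmod r ^ 4"
proof -
  have 1: "1 - w ^ 2 / r ^ 2 = - (w - r) * (w + r) / r ^ 2" for w
    using assms by (simp add: field_simps power2_eq_square)
  have 2: "cmod (cnj z - r) = cmod (z - cnj r)" "cmod (cnj z + r) = cmod (z + cnj r)"
    by (metis complex_cnj_cnj complex_cnj_diff complex_mod_cnj,
        metis complex_cnj_cnj complex_cnj_add complex_mod_cnj)
  show ?thesis
    unfolding 1 norm_mult norm_divide norm_minus_cancel norm_power 2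
    by (simp add: power2_eq_square power4_eq_xxxx)
qed

locale even_real_entire_strip = even_real_entire +
  fixes h :: real
  assumes h: "h > 0"
    and strip: "F \<rho> = 0 \<Longrightarrow> \<bar>Re \<rho>\<bar> \<le> h"
    and nonzero: "F (Complex h y) \<noteq> 0"
begin

text \<open>The zero whose gain is kept explicit in the limit; the nonnegative real part ensures
  \<open>h + Re \<rho>\<^sub>0 > 0\<close>.\<close>

definition \<rho>\<^sub>0 where "\<rho>\<^sub>0 = (SOME \<rho>. F \<rho> = 0 \<and> Re \<rho> \<ge> 0)"

lemma \<rho>\<^sub>0: "F \<rho>\<^sub>0 = 0" "Re \<rho>\<^sub>0 \<ge> 0"
proof -
  obtain \<rho> where "F \<rho> = 0" using ex_zero by blast
  hence "F \<rho> = 0 \<and> Re \<rho> \<ge> 0 \<or> F (- \<rho>) = 0 \<and> Re (- \<rho>) \<ge> 0" by auto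
  hence "\<exists>\<rho>. F \<rho> = 0 \<and> Re \<rho> \<ge> 0" by blast
  from someI_ex[OF this] show "F \<rho>\<^sub>0 = 0" "Re \<rho>\<^sub>0 \<ge> 0"
    unfolding \<rho>\<^sub>0_def by auto
qed

text \<open>All factors but one distance at \<open>\<rho>\<^sub>0\<close> are compared weakly. That
  distance is cross-multiplied with its counterpart, which makes this part an equality and lets the
  explicit ratio pass to the limit.\<close>

lemma growth_right_aux:
  assumes z: "Re z \<ge> 0"
  shows "cmod (F (z - of_real h)) ^ 4 * cmod (z + of_real h + cnj \<rho>\<^sub>0)
       \<le> cmod (F (z + of_real h)) ^ 4 * cmod (z - of_real h - \<rho>\<^sub>0)"
proof -
  define k where "k z \<rho> = cmod (1 - z ^ 2 / \<rho> ^ 2) * cmod (1 - cnj z ^ 2 / \<rho> ^ 2)" for z \<rho>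
  define T where "T z R = (\<Prod>\<rho> | F \<rho> = 0 \<and> norm \<rho> < R. k z \<rho> ^ nat (zorder F \<rho>))" for z R
  have k_nonneg: "k z \<rho> \<ge> 0" for z \<rho> by (simp add: k_def)
  have T_lim: "(T z \<longlongrightarrow> cmod (F z) ^ 4 / cmod (F 0) ^ 4) at_top" for z
    using cmod_product_tendsto[of z] by (simp add: T_def[abs_def] k_def)
  let ?B = "cmod (z + of_real h + cnj \<rho>\<^sub>0)" and ?A = "cmod (z - of_real h - \<rho>\<^sub>0)"
  have k_le_gen: "k (z - of_real h) \<rho> * cmod (z + of_real h + cnj \<rho>) \<le>
         k (z + of_real h) \<rho> * cmod (z - of_real h - \<rho>)"
       "k (z - of_real h) \<rho> \<le> k (z + of_real h) \<rho>" if \<rho>: "F \<rho> = 0" for \<rho>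
  proof -
    have nz: "\<rho> \<noteq> 0" using \<rho> F0 by auto
    have le: "\<bar>Re \<rho>\<bar> \<le> h" by (rule strip[OF \<rho>])
    \<comment> \<open>Each distance from \<open>z - h\<close> is paired with the distance from
      \<open>z + h\<close> to the mirror image of the same point in the imaginary axis.\<close>
    let ?a1 = "cmod (z - of_real h - \<rho>)" and ?a2 = "cmod (z - of_real h + \<rho>)"
      and ?a3 = "cmod (z - of_real h - cnj \<rho>)" and ?a4 = "cmod (z - of_real h + cnj \<rho>)"
    let ?b1 = "cmod (z + of_real h + cnj \<rho>)" and ?b2 = "cmod (z + of_real h - cnj \<rho>)"
      and ?b3 = "cmod (z + of_real h + \<rho>)" and ?b4 = "cmod (z + of_real h - \<rho>)"
    have a1: "?a1 \<le> ?b1" using cmod_reflect_le[OF z le] .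
    have a2: "?a2 \<le> ?b2" using cmod_reflect_le[OF z, of "-\<rho>" h] le by simp
    have a3: "?a3 \<le> ?b3" using cmod_reflect_le[OF z, of "cnj \<rho>" h] le by simp
    have a4: "?a4 \<le> ?b4" using cmod_reflect_le[OF z, of "-cnj \<rho>" h] le by simp
    note ab = a1 a2 a3 a4
    have le3: "?a2 * ?a3 * ?a4 \<le> ?b2 * ?b3 * ?b4"
      by (intro mult_mono mult_nonneg_nonneg ab norm_ge_zero)
    have ka: "k (z - of_real h) \<rho> = ?a1 * (?a2 * ?a3 * ?a4) / cmod \<rho> ^ 4"
      unfolding k_def factor_expand[OF nz] by (simp add: mult_ac)
    have kb: "k (z + of_real h) \<rho> = ?b1 * (?b2 * ?b3 * ?b4) / cmod \<rho> ^ 4"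
      unfolding k_def factor_expand[OF nz] by (simp add: mult_ac)
    have "(?a1 * ?b1) * (?a2 * ?a3 * ?a4) \<le> (?a1 * ?b1) * (?b2 * ?b3 * ?b4)"
      by (intro mult_left_mono le3) auto
    thus "k (z - of_real h) \<rho> * ?b1 \<le> k (z + of_real h) \<rho> * ?a1"
      unfolding ka kb by (simp add: divide_right_mono mult_ac)
    have "?a1 * (?a2 * ?a3 * ?a4) \<le> ?b1 * (?b2 * ?b3 * ?b4)"
      by (intro mult_mono le3 ab(1) mult_nonneg_nonneg norm_ge_zero)
    thus "k (z - of_real h) \<rho> \<le> k (z + of_real h) \<rho>"
      unfolding ka kb by (intro divide_right_mono) auto
  qed
  have "eventually (\<lambda>R. T (z - of_real h) R * ?B \<le> T (z + of_real h) R * ?A) at_top"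
    using eventually_gt_at_top[of "norm \<rho>\<^sub>0"]
  proof eventually_elim
    case (elim R)
    define Z where "Z = {\<rho>. F \<rho> = 0 \<and> norm \<rho> < R}"
    have Z: "finite Z" "\<rho>\<^sub>0 \<in> Z" using finite_zeros elim \<rho>\<^sub>0 by (auto simp: Z_def)
    \<comment> \<open>The multiplicity is positive, so one copy of the factor at
      \<open>\<rho>\<^sub>0\<close> can be split off for the exact comparison.\<close>
    obtain m where m: "nat (zorder F \<rho>\<^sub>0) = Suc m"
      using zorder_pos[OF \<rho>\<^sub>0(1)] not0_implies_Suc by blast
    let ?P = "\<lambda>z. \<Prod>\<rho>\<in>Z-{\<rho>\<^sub>0}. k z \<rho> ^ nat (zorder F \<rho>)"
    have T: "T z R = ?P z * (k z \<rho>\<^sub>0 ^ m * k z \<rho>\<^sub>0)" for z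
      unfolding T_def Z_def[symmetric] by (subst prod.remove[OF Z]) (simp add: m)
    have P: "?P (z - of_real h) \<le> ?P (z + of_real h)"
      using k_le_gen(2) k_nonneg by (intro prod_mono conjI power_mono) (auto simp: Z_def)
    have k: "k (z - of_real h) \<rho>\<^sub>0 ^ m \<le> k (z + of_real h) \<rho>\<^sub>0 ^ m"
      using k_le_gen(2)[OF \<rho>\<^sub>0(1)] k_nonneg by (intro power_mono)
    have "?P (z - of_real h) * (k (z - of_real h) \<rho>\<^sub>0 ^ m * (k (z - of_real h) \<rho>\<^sub>0 * ?B)) \<le>
          ?P (z + of_real h) * (k (z + of_real h) \<rho>\<^sub>0 ^ m * (k (z + of_real h) \<rho>\<^sub>0 * ?A))"
      using k_nonneg
      by (intro mult_mono[OF P mult_mono[OF k k_le_gen(1)[OF \<rho>\<^sub>0(1)]]])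
        (auto intro!: prod_nonneg mult_nonneg_nonneg)
    thus ?case unfolding T by (simp add: mult_ac)
  qed
  hence "cmod (F (z - of_real h)) ^ 4 / cmod (F 0) ^ 4 * ?B
       \<le> cmod (F (z + of_real h)) ^ 4 / cmod (F 0) ^ 4 * ?A"
    by (intro tendsto_le[OF _ tendsto_mult_right[OF T_lim] tendsto_mult_right[OF T_lim]]) auto
  thus ?thesis using F0 by (simp add: divide_simps)
qed

text \<open>Squaring replaces the distances by polynomials and exposes the gain
  \<open>4 * Re z * (h + Re \<rho>\<^sub>0)\<close>. The exponent 8 is the 4 of the symmetrised
  product formula, doubled.\<close>

lemma growth_right:
  assumes z: "Re z \<ge> 0"
  shows "cmod (F (z - of_real h)) ^ 8 * cmod (z + of_real h + cnj \<rho>\<^sub>0) ^ 2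
       \<le> cmod (F (z + of_real h)) ^ 8 * (cmod (z + of_real h + cnj \<rho>\<^sub>0) ^ 2 - 4 * Re z * (h + Re \<rho>\<^sub>0))"
proof -
  have "(cmod (F (z - of_real h)) ^ 4 * cmod (z + of_real h + cnj \<rho>\<^sub>0)) ^ 2
       \<le> (cmod (F (z + of_real h)) ^ 4 * cmod (z - of_real h - \<rho>\<^sub>0)) ^ 2"
    by (rule power_mono[OF growth_right_aux[OF z]]) auto
  thus ?thesis
    unfolding cmod_reflect_diff[symmetric] by (simp add: power_mult_distrib flip: power_mult)
qed

lemma nonzero_right: "Re z > h \<Longrightarrow> F z \<noteq> 0"
  using strip[of z] by auto

lemma strict_right:
  assumes z: "Re z > 0"
  shows "cmod (F (z - of_real h)) < cmod (F (z + of_real h))"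
proof -
  let ?B = "cmod (z + of_real h + cnj \<rho>\<^sub>0)"
  have "Re (z + of_real h + cnj \<rho>\<^sub>0) > 0" using z h \<rho>\<^sub>0 by simp
  hence B: "?B > 0" using complex_Re_le_cmod[of "z + of_real h + cnj \<rho>\<^sub>0"] by linarith
  have "cmod (F (z - of_real h)) ^ 8 * ?B ^ 2 \<le>
      cmod (F (z + of_real h)) ^ 8 * (?B ^ 2 - 4 * Re z * (h + Re \<rho>\<^sub>0))"
    using growth_right[of z] z by simp
  also have "\<dots> < cmod (F (z + of_real h)) ^ 8 * ?B ^ 2"
    using nonzero_right[of "z + of_real h"] z h \<rho>\<^sub>0 by (intro mult_strict_left_mono) auto
  finally have "cmod (F (z - of_real h)) ^ 8 < cmod (F (z + of_real h)) ^ 8"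
    using B by simp
  thus ?thesis by (rule power_less_imp_less_base) auto
qed

lemma F_deriv: "(F has_field_derivative deriv F z) (at z)"
  using holomorphic_derivI[OF holo open_UNIV] by auto

lemma deriv_F_minus: "deriv F (- z) = - deriv F z"
proof -
  have "((\<lambda>z. F (- z)) has_field_derivative (deriv F (- z) * (- 1))) (at z)"
    by (rule DERIV_chain2[OF F_deriv]) (auto intro!: derivative_eq_intros)
  hence "(F has_field_derivative - deriv F (- z)) (at z)" by simp
  thus ?thesis using DERIV_unique[OF F_deriv] by force
qed

lemma deriv_cnj_F: "deriv F (cnj z) = cnj (deriv F z)"
proof -
  have "F = cnj \<circ> F \<circ> cnj" by (auto simp: fun_eq_iff cnj_F)
  have "((cnj \<circ> F \<circ> cnj) has_field_derivative cnj (deriv F z)) (at (cnj z))"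
    using has_field_derivative_cnj_cnj[of F "deriv F z" "cnj z"] F_deriv by simp
  thus ?thesis
    using \<open>F = cnj \<circ> F \<circ> cnj\<close> by (metis DERIV_imp_deriv)
qed

lemma cmod_power8_deriv:
  "((\<lambda>x. cmod (F (of_real x + w)) ^ 8) has_real_derivative
      8 * cmod (F w) ^ 6 * Re (cnj (F w) * deriv F w)) (at 0)"
proof -
  have "((\<lambda>x. F (x + w)) has_field_derivative (deriv F (0 + w) * 1)) (at 0)"
    by (rule DERIV_chain2[OF F_deriv]) (auto intro!: derivative_eq_intros)
  hence d: "((\<lambda>x. F (of_real x + w)) has_vector_derivative deriv F w) (at 0)"
    using has_vector_derivative_real_field[of "\<lambda>x. F (x + w)" "deriv F w" 0 UNIV] by simp
  have "((\<lambda>x. (Re (F (of_real x + w)) ^ 2 + Im (F (of_real x + w)) ^ 2) ^ 4) has_real_derivative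
      8 * (Re (F w) ^ 2 + Im (F w) ^ 2) ^ 3 * Re (cnj (F w) * deriv F w)) (at 0)"
    by (rule derivative_eq_intros has_field_derivative_Re[OF d] has_field_derivative_Im[OF d] refl)+
       (simp add: algebra_simps)
  thus ?thesis by (simp flip: cmod_power2 power_mult)
qed

text \<open>
  As in Hopf's boundary point lemma: the inequality of \<open>growth_right\<close> is an equality at
  \<open>Re z = 0\<close>, so it can be differentiated there.
\<close>
lemma Re_log_deriv_pos: "Re (deriv F (Complex h y) / F (Complex h y)) > 0"
proof -
  define w where "w = Complex h y"
  define r where "r = h + Re \<rho>\<^sub>0"
  define B where "B x = (x + r) ^ 2 + (y - Im \<rho>\<^sub>0) ^ 2" for x
  \<comment> \<open>The right side minus the left side of \<open>growth_right\<close> at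
    \<open>Complex x y\<close>. Both shifted points have equal moduli under \<open>F\<close> at
    \<open>x = 0\<close>, so \<open>b\<close> has a one-sided minimum 0 there and its derivative
    cannot be negative.\<close>
  define b where "b x = cmod (F (of_real x + w)) ^ 8 * (B x - 4 * x * r)
      - cmod (F (of_real x + (- cnj w))) ^ 8 * B x" for x
  define D where "D = Re (cnj (F w) * deriv F w)"
  have r: "r > 0" using h \<rho>\<^sub>0 by (simp add: r_def)
  have Fw: "F w \<noteq> 0" using nonzero by (simp add: w_def)
  have b_nonneg: "b x \<ge> 0" if "x \<ge> 0" for x
  proof -
    have "Complex x y + of_real h = of_real x + w" "Complex x y - of_real h = of_real x + (- cnj w)"
      by (auto simp: w_def complex_eq_iff)
    moreover have "cmod (Complex x y + of_real h + cnj \<rho>\<^sub>0) ^ 2 = B x"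
      by (simp add: cmod_power2 B_def r_def algebra_simps)
    ultimately show ?thesis
      using growth_right[of "Complex x y"] that by (simp add: b_def r_def)
  qed
  have w': "F (- cnj w) = cnj (F w)" "deriv F (- cnj w) = - cnj (deriv F w)"
    by (simp_all add: cnj_F deriv_F_minus deriv_cnj_F)
  have b0: "b 0 = 0"
    by (simp add: b_def w' cnj_F)
  have B': "(B has_real_derivative (2 * r)) (at 0)"
    unfolding B_def by (auto intro!: derivative_eq_intros)
  \<comment> \<open>By evenness and reality, \<open>F\<close> has opposite modulus rates at
    \<open>w\<close> and \<open>- cnj w\<close>; the two contributions add up,
    \<open>16 = 8 + 8\<close>.\<close>
  have "(b has_real_derivative
      (16 * cmod (F w) ^ 6 * D * B 0 - cmod (F w) ^ 8 * 4 * r)) (at 0)"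
    unfolding b_def
    by (rule derivative_eq_intros cmod_power8_deriv B' refl)+
       (simp add: w' cnj_F D_def algebra_simps)
  moreover have "\<not> (16 * cmod (F w) ^ 6 * D * B 0 - cmod (F w) ^ 8 * 4 * r) < 0"
  proof
    assume "16 * cmod (F w) ^ 6 * D * B 0 - cmod (F w) ^ 8 * 4 * r < 0"
    from DERIV_neg_dec_right[OF calculation this] obtain d
      where d: "d > 0" "\<And>h. 0 < h \<Longrightarrow> h < d \<Longrightarrow> b (0 + h) < b 0" by blast
    from d(2)[of "d / 2"] d(1) b_nonneg[of "d / 2"] b0 show False by simp
  qed
  ultimately have "cmod (F w) ^ 8 * 4 * r \<le> 16 * cmod (F w) ^ 6 * D * B 0" by simp
  moreover have "cmod (F w) ^ 8 * 4 * r > 0" using r Fw by simp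
  ultimately have "16 * cmod (F w) ^ 6 * D * B 0 > 0" by linarith
  moreover have "B 0 \<ge> 0" by (simp add: B_def)
  ultimately have "D > 0"
    using mult_nonneg_nonpos[of "16 * cmod (F w) ^ 6 * B 0" D]
    by (cases "D > 0") (auto simp: mult_ac)
  moreover have "deriv F w / F w = cnj (F w) * deriv F w / of_real (cmod (F w) ^ 2)"
    using Fw by (simp add: complex_norm_square field_simps del: of_real_power)
  ultimately show ?thesis
    using Fw by (simp add: D_def w_def)
qed

end

section \<open>The argument along the line and the zeros of the rotated sums\<close>

context even_real_entire_strip
begin

lemma deriv_on_line:
  "((\<lambda>y. F (Complex h y)) has_vector_derivative \<i> * deriv F (Complex h y)) (at y)"
proof -
  have "((\<lambda>y. F (of_real h + \<i> * y)) has_field_derivative (deriv F (of_real h + \<i> * of_real y) * \<i>)) (at (of_real y))"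
    by (rule DERIV_chain2[OF F_deriv]) (auto intro!: derivative_eq_intros)
  from has_vector_derivative_real_field[OF this]
  show ?thesis by (simp add: Complex_eq mult_ac)
qed

text \<open>Integrating \<open>\<i> * q\<close>, with \<open>q\<close> the logarithmic derivative of
  \<open>F\<close>, gives a global logarithm \<open>g\<close> of \<open>F\<close> along the line up
  to a constant factor. Its imaginary part is the continuous argument, with derivative
  \<open>Re q > 0\<close>.\<close>

lemma ex_argument:
  "\<exists>p :: real \<Rightarrow> real. continuous_on UNIV p \<and> strict_mono p \<and>
     (\<forall>y. F (Complex h y) = of_real (cmod (F (Complex h y))) * cis (p y))"
proof -
  define E where "E y = F (Complex h y)" for y
  define q where "q y = deriv F (Complex h y) / F (Complex h y)" for y
  have E': "(E has_vector_derivative \<i> * q y * E y) (at y)" for y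
    using deriv_on_line[of y] nonzero[of y] by (simp add: E_def[abs_def] q_def)
  have nz: "E y \<noteq> 0" for y using nonzero by (simp add: E_def)
  have "deriv F holomorphic_on UNIV"
    by (rule holomorphic_deriv[OF holo]) auto
  hence "continuous_on UNIV (deriv F)" by (rule holomorphic_on_imp_continuous_on)
  hence c1: "continuous_on UNIV (\<lambda>y. deriv F (of_real h + \<i> * of_real y))"
    by (rule continuous_on_compose2) (auto intro!: continuous_intros)
  have c2: "continuous_on UNIV (\<lambda>y. F (of_real h + \<i> * of_real y))"
    by (rule continuous_on_compose2[OF holomorphic_on_imp_continuous_on[OF holo]]) (auto intro!: continuous_intros)
  have "continuous_on UNIV (\<lambda>y. \<i> * q y)"
    unfolding q_def Complex_eq
    by (intro continuous_intros c1 c2) (use nonzero in \<open>auto simp: Complex_eq\<close>)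
  hence "isCont (\<lambda>y. \<i> * q y) y" for y
    by (simp add: continuous_on_eq_continuous_at)
  hence "\<exists>g. \<forall>y. - \<infinity> < ereal y \<longrightarrow> ereal y < \<infinity> \<longrightarrow> (g has_vector_derivative \<i> * q y) (at y)"
    by (intro einterval_antiderivative) auto
  then obtain g where g: "\<And>y. (g has_vector_derivative \<i> * q y) (at y)"
    by auto
  have exp_g: "((\<lambda>y. exp (- g y)) has_vector_derivative (- (\<i> * q y)) * exp (- g y)) (at y)" for y
    using field_vector_diff_chain_at[of "\<lambda>y. - g y" "- (\<i> * q y)" y exp "exp (- g y)"]
      has_vector_derivative_minus[OF g[of y]] by (auto simp: o_def)
  have "((\<lambda>y. E y * exp (- g y)) has_vector_derivative 0) (at y within UNIV)" for y
    using has_vector_derivative_mult[OF E'[of y] exp_g[of y]] by (simp add: algebra_simps)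
  then obtain c where "\<And>y. E y * exp (- g y) = c"
    using has_vector_derivative_zero_constant[of UNIV "\<lambda>y. E y * exp (- g y)"] by auto
  hence Ec: "E y = c * exp (g y)" for y
    by (simp add: exp_minus field_simps)
  define p where "p y = Arg c + Im (g y)" for y
  have "E y = of_real (cmod (E y)) * cis (p y)" for y
  proof -
    have "c = of_real (cmod c) * cis (Arg c)"
      by (metis rcis_cmod_Arg rcis_def)
    moreover have "exp (g y) = of_real (exp (Re (g y))) * cis (Im (g y))"
      by (simp add: exp_eq_polar)
    ultimately show ?thesis
      unfolding Ec p_def cis_mult[symmetric] norm_mult by (simp add: norm_mult)
  qed
  moreover have p': "(p has_real_derivative Re (q y)) (at y)" for y
    unfolding p_def
    by (rule derivative_eq_intros has_field_derivative_Im[OF g[of y]] refl)+ simp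
  moreover have "strict_mono p"
  proof (rule strict_monoI)
    fix x y :: real assume "x < y"
    show "p x < p y"
      by (rule DERIV_pos_imp_increasing[OF \<open>x < y\<close>])
        (use p' Re_log_deriv_pos in \<open>auto simp: q_def intro!: exI\<close>)
  qed
  moreover have "continuous_on UNIV p"
    using p' by (meson DERIV_isCont continuous_at_imp_continuous_on)
  ultimately show ?thesis by (auto simp: E_def)
qed

definition rotated_sum :: "real \<Rightarrow> complex \<Rightarrow> complex" where
  "rotated_sum \<phi> z = (cis \<phi> * F (z + of_real h) + cis (- \<phi>) * F (z - of_real h)) / 2"

text \<open>A zero forces equal moduli at \<open>z + h\<close> and \<open>z - h\<close>; off the
  imaginary axis this contradicts \<open>strict_right\<close> at \<open>z\<close> or at
  \<open>- z\<close>.\<close>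

lemma rotated_sum_zero_imp_imaginary:
  assumes "rotated_sum \<phi> z = 0"
  shows "Re z = 0"
proof -
  have "cis \<phi> * F (z + of_real h) = - (cis (- \<phi>) * F (z - of_real h))"
    using assms by (simp add: rotated_sum_def eq_neg_iff_add_eq_0)
  from arg_cong[OF this, of cmod] have eq: "cmod (F (z + of_real h)) = cmod (F (z - of_real h))"
    by (simp add: norm_mult)
  have "\<not> Re z > 0" using strict_right[of z] eq by auto
  moreover have "\<not> Re z < 0"
  proof
    assume "Re z < 0"
    moreover have "- z - of_real h = - (z + of_real h)" "- z + of_real h = - (z - of_real h)"
      by auto
    ultimately show False
      using strict_right[of "-z"] eq by (simp only: even) simp
  qed
  ultimately show ?thesis by linarith
qed

text \<open>On the imaginary axis \<open>z - h\<close> is \<open>- cnj (z + h)\<close>, so the two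
  summands are complex conjugates.\<close>

lemma rotated_sum_on_line: "rotated_sum \<phi> (Complex 0 y) = of_real (Re (cis \<phi> * F (Complex h y)))"
proof -
  have "Complex 0 y + of_real h = Complex h y" "Complex 0 y - of_real h = - cnj (Complex h y)"
    by (auto simp: complex_eq_iff)
  hence "rotated_sum \<phi> (Complex 0 y) = (cis \<phi> * F (Complex h y) + cnj (cis \<phi> * F (Complex h y))) / 2"
    by (simp add: rotated_sum_def cnj_F cis_cnj)
  thus ?thesis by (simp only: complex_add_cnj) simp
qed

lemma rotated_sum_holo: "rotated_sum \<phi> holomorphic_on UNIV"
proof -
  have "(\<lambda>z. F (z + of_real h)) holomorphic_on UNIV" "(\<lambda>z. F (z - of_real h)) holomorphic_on UNIV"
    by (rule holomorphic_on_compose_gen[where g = F and t = UNIV, unfolded o_def];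
        auto intro!: holomorphic_intros holo)+
  thus ?thesis unfolding rotated_sum_def by (intro holomorphic_intros) auto
qed

text \<open>At a zero, \<open>e = cis \<phi> * F w\<close> is purely imaginary, so the derivative
  reduces to \<open>\<i> * Im e\<close> times the real part of the logarithmic derivative, and
  neither factor vanishes.\<close>

lemma rotated_sum_simple:
  assumes "rotated_sum \<phi> z = 0"
  shows "zorder (rotated_sum \<phi>) z = 1"
proof -
  obtain y where z: "z = Complex 0 y"
    using rotated_sum_zero_imp_imaginary[OF assms] by (metis complex.collapse)
  define w where "w = Complex h y"
  define e where "e = cis \<phi> * F w"
  have zh: "z + of_real h = w" "z - of_real h = - cnj w"
    by (auto simp: complex_eq_iff z w_def)
  have "complex_of_real (Re e) = 0"
    using assms unfolding z rotated_sum_on_line e_def w_def .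
  hence Re_e: "Re e = 0" by (simp only: of_real_eq_0_iff)
  have Fw: "F w \<noteq> 0" using nonzero by (simp add: w_def)
  have "(rotated_sum \<phi> has_field_derivative
      (cis \<phi> * deriv F (z + of_real h) + cis (- \<phi>) * deriv F (z - of_real h)) / 2) (at z)"
  proof -
    have "((\<lambda>z. F (z + of_real h)) has_field_derivative deriv F (z + of_real h) * 1) (at z)"
         "((\<lambda>z. F (z - of_real h)) has_field_derivative deriv F (z - of_real h) * 1) (at z)"
      by (rule DERIV_chain2[OF F_deriv]; auto intro!: derivative_eq_intros)+
    thus ?thesis unfolding rotated_sum_def
      by (auto intro!: derivative_eq_intros)
  qed
  hence "deriv (rotated_sum \<phi>) z = (cis \<phi> * deriv F w - cnj (cis \<phi> * deriv F w)) / 2"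
    by (simp add: DERIV_imp_deriv zh deriv_F_minus deriv_cnj_F cis_cnj)
  hence "deriv (rotated_sum \<phi>) z = \<i> * of_real (Im (cis \<phi> * deriv F w))"
    by (simp only: complex_diff_cnj) simp
  also have "cis \<phi> * deriv F w = e * (deriv F w / F w)"
    using Fw by (simp add: e_def)
  also have "Im (e * (deriv F w / F w)) = Im e * Re (deriv F w / F w)"
    using Re_e by (subst times_complex.sel) simp
  finally have d: "deriv (rotated_sum \<phi>) z = \<i> * of_real (Im e * Re (deriv F w / F w))" .
  have "e \<noteq> 0" using Fw by (simp add: e_def)
  hence "Im e \<noteq> 0" using Re_e by (auto simp: complex_eq_iff)
  hence nz: "deriv (rotated_sum \<phi>) z \<noteq> 0"
    unfolding d using Re_log_deriv_pos[of y] by (auto simp: w_def)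
  show ?thesis
    by (rule zorder_zero_eqI[OF rotated_sum_holo open_UNIV]) (use assms nz in auto)
qed

end

section \<open>Numbering the zeros\<close>

text \<open>The \<open>n\<close>-th zero is where \<open>p\<close> reaches the level
  \<open>c + n * pi\<close>. The range of \<open>p\<close> is an interval, bounded or not, so the
  levels attained form a block of indices. Leaving \<open>c\<close> free lets two functions be
  numbered compatibly.\<close>

lemma zero_numbering_of_argument:
  fixes p :: "real \<Rightarrow> real"
  assumes p: "strict_mono p" "continuous_on UNIV p"
    and zeros: "\<And>s. A s = 0 \<longleftrightarrow> Re s = 1 / 2 \<and> cos (p (Im s) + \<phi>) = 0"
    and simple: "\<And>s. A s = 0 \<Longrightarrow> zorder A s = 1"
    and c: "cos (c + \<phi>) = 0"
  shows "zero_numbering A {n. c + of_int n * pi \<in> range p} (\<lambda>n. inv p (c + of_int n * pi))"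
proof -
  define I where "I = {n. c + of_int n * pi \<in> range p}"
  define \<gamma> where "\<gamma> n = inv p (c + of_int n * pi)" for n :: int
  have inj: "inj p" using p(1) by (rule strict_mono_imp_inj_on)
  have p\<gamma>: "p (\<gamma> n) = c + of_int n * pi" if "n \<in> I" for n
    using that unfolding \<gamma>_def I_def by (auto intro: f_inv_into_f)
  have "connected (range p)"
    by (rule connected_continuous_image[OF p(2)]) auto
  hence conv: "x \<in> range p" if "a \<in> range p" "b \<in> range p" "a \<le> x" "x \<le> b" for a b x
    using that connectedD_interval by blast
  have block: "{m..n} \<subseteq> I" if "m \<in> I" "n \<in> I" for m n
  proof
    fix k assume "k \<in> {m..n}"
    hence "c + of_int m * pi \<le> c + of_int k * pi" "c + of_int k * pi \<le> c + of_int n * pi"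
      by auto
    thus "k \<in> I"
      using conv[of "c + of_int m * pi" "c + of_int n * pi"] that by (simp add: I_def)
  qed
  have mono: "mono_on I \<gamma>"
  proof (rule mono_onI)
    fix m n assume *: "m \<in> I" "n \<in> I" "m \<le> n"
    hence "p (\<gamma> m) \<le> p (\<gamma> n)" by (simp add: p\<gamma>)
    thus "\<gamma> m \<le> \<gamma> n" using p(1) by (simp add: strict_mono_less_eq)
  qed
  have zero_iff: "A z = 0 \<longleftrightarrow> (\<exists>n\<in>I. z = Complex (1 / 2) (\<gamma> n))" for z
  proof
    assume "A z = 0"
    hence z: "Re z = 1 / 2" "cos (p (Im z) + \<phi>) = 0" using zeros by auto
    from z(2) c obtain i j :: int where ij: "p (Im z) + \<phi> = of_int i * pi + pi / 2"
      "c + \<phi> = of_int j * pi + pi / 2"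
      unfolding cos_zero_iff_int2 by blast
    hence eq: "p (Im z) = c + of_int (i - j) * pi" by (simp add: algebra_simps)
    hence I: "i - j \<in> I" unfolding I_def by (metis mem_Collect_eq rangeI)
    hence "p (\<gamma> (i - j)) = p (Im z)" using eq p\<gamma> by simp
    hence "\<gamma> (i - j) = Im z" using inj by (simp add: inj_eq)
    thus "\<exists>n\<in>I. z = Complex (1 / 2) (\<gamma> n)" using z(1) I by (metis complex.collapse)
  next
    assume "\<exists>n\<in>I. z = Complex (1 / 2) (\<gamma> n)"
    then obtain n where n: "n \<in> I" "z = Complex (1 / 2) (\<gamma> n)" by blast
    obtain j :: int where j: "c + \<phi> = of_int j * pi + pi / 2"
      using c unfolding cos_zero_iff_int2 by blast
    have "p (Im z) + \<phi> = of_int (n + j) * pi + pi / 2"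
      using n p\<gamma>[OF n(1)] j by (simp add: algebra_simps)
    hence "cos (p (Im z) + \<phi>) = 0" unfolding cos_zero_iff_int2 by blast
    thus "A z = 0" using zeros n by simp
  qed
  have \<gamma>_inj: "m = n" if "m \<in> I" "n \<in> I" "\<gamma> m = \<gamma> n" for m n
  proof -
    have "c + of_int m * pi = c + of_int n * pi"
      using p\<gamma>[OF that(1)] p\<gamma>[OF that(2)] that(3) by metis
    thus "m = n" by simp
  qed
  have card: "finite {n\<in>I. Complex (1 / 2) (\<gamma> n) = z} \<and>
      card {n\<in>I. Complex (1 / 2) (\<gamma> n) = z} = (if A z = 0 then nat (zorder A z) else 0)" for z
  proof (cases "A z = 0")
    case True
    then obtain n where n: "n \<in> I" "z = Complex (1 / 2) (\<gamma> n)" using zero_iff by blast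
    hence "{n\<in>I. Complex (1 / 2) (\<gamma> n) = z} = {n}" using \<gamma>_inj by auto
    thus ?thesis using simple[OF True] True by simp
  next
    case False
    hence "{n\<in>I. Complex (1 / 2) (\<gamma> n) = z} = {}" using zero_iff by auto
    thus ?thesis using False by (metis (mono_tags) card.empty finite.emptyI)
  qed
  show ?thesis
    unfolding zero_numbering_def I_def[symmetric] \<gamma>_def[symmetric]
    using block mono card by auto
qed

text \<open>The levels for cosine and sine alternate with gap \<open>pi / 2\<close>, and the
  increasing inverse of \<open>p\<close> carries their order to the zeros. A level between two
  attained levels is attained, which gives the conditions on the index sets.\<close>

lemma zeros_interlace_of_argument:
  fixes p :: "real \<Rightarrow> real"
  assumes p: "strict_mono p" "continuous_on UNIV p"
    and A: "\<And>s. A s = 0 \<longleftrightarrow> Re s = 1 / 2 \<and> cos (p (Im s) + \<phi>) = 0"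
      "\<And>s. A s = 0 \<Longrightarrow> zorder A s = 1"
    and B: "\<And>s. B s = 0 \<longleftrightarrow> Re s = 1 / 2 \<and> sin (p (Im s) + \<phi>) = 0"
      "\<And>s. B s = 0 \<Longrightarrow> zorder B s = 1"
  shows "zeros_interlace A B"
proof -
  \<comment> \<open>This puts \<open>p + \<phi>\<close> at \<open>pi / 2\<close> for index 0 of the
    first function and at \<open>pi\<close> for index 0 of the second, so equal indices are in the
    required order.\<close>
  define c where "c = pi / 2 - \<phi>"
  let ?I = "{n::int. c + of_int n * pi \<in> range p}" and ?J = "{n::int. (c + pi / 2) + of_int n * pi \<in> range p}"
  have "connected (range p)"
    by (rule connected_continuous_image[OF p(2)]) auto
  hence conv: "x \<in> range p" if "a \<in> range p" "b \<in> range p" "a \<le> x" "x \<le> b" for a b x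
    using that connectedD_interval by blast
  have nA: "zero_numbering A ?I (\<lambda>n. inv p (c + of_int n * pi))"
    by (rule zero_numbering_of_argument[OF p A]) (auto simp: c_def)
  have "B s = 0 \<longleftrightarrow> Re s = 1 / 2 \<and> cos (p (Im s) + (\<phi> - pi / 2)) = 0" for s
    by (simp add: B(1) cos_diff add_diff_eq)
  hence nB: "zero_numbering B ?J (\<lambda>n. inv p ((c + pi / 2) + of_int n * pi))"
    by (rule zero_numbering_of_argument[OF p _ B(2)]) (auto simp: c_def)
  have inv_le: "inv p a \<le> inv p b" if "a \<in> range p" "b \<in> range p" "a \<le> b" for a b
    using that p(1) by (metis f_inv_into_f strict_mono_less_eq)
  show ?thesis
    unfolding zeros_interlace_def
  proof (intro exI conjI allI impI)
    show "zero_numbering A ?I (\<lambda>n. inv p (c + of_int n * pi))" by fact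
    show "zero_numbering B ?J (\<lambda>n. inv p ((c + pi / 2) + of_int n * pi))" by fact
    fix n :: int
    have le: "c + of_int n * pi \<le> (c + pi / 2) + of_int n * pi"
      "(c + pi / 2) + of_int n * pi \<le> c + of_int (n + 1) * pi"
      "c + of_int (n + 1) * pi \<le> (c + pi / 2) + of_int (n + 1) * pi"
      by (simp_all add: algebra_simps)
    show "n \<in> ?J" if "n \<in> ?I \<and> n + 1 \<in> ?I"
      using that conv[OF _ _ le(1,2)] by simp
    show "n + 1 \<in> ?I" if "n \<in> ?J \<and> n + 1 \<in> ?J"
      using that conv[OF _ _ le(2,3)] by simp
    show "inv p (c + of_int n * pi) \<le> inv p ((c + pi / 2) + of_int n * pi)" if "n \<in> ?I \<and> n \<in> ?J"
      using that inv_le[OF _ _ le(1)] by simp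
    show "inv p ((c + pi / 2) + of_int n * pi) \<le> inv p (c + of_int (n + 1) * pi)" if "n \<in> ?J \<and> n + 1 \<in> ?I"
      using that inv_le[OF _ _ le(2)] by simp
  qed
qed

context even_real_entire_strip
begin

text \<open>A quarter turn either way makes cosine into sine up to sign. \<open>B'\<close> serves
  negative shifts: replacing \<open>h\<close> by \<open>- h\<close> negates the angle, so a positive
  quarter turn becomes a negative one.\<close>

lemma rotated_sum_conclusion:
  fixes \<phi> :: real
  defines "A \<equiv> \<lambda>s. rotated_sum \<phi> (s - 1 / 2)" and "B \<equiv> \<lambda>s. rotated_sum (\<phi> + pi / 2) (s - 1 / 2)"
    and "B' \<equiv> \<lambda>s. rotated_sum (\<phi> - pi / 2) (s - 1 / 2)"
  shows "zeros_on_critical_line A" "all_zeros_simple A" "zeros_interlace A B" "zeros_interlace A B'"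
proof -
  obtain p where p: "continuous_on UNIV p" "strict_mono p"
    "\<And>y. F (Complex h y) = of_real (cmod (F (Complex h y))) * cis (p y)"
    using ex_argument by blast
  have zero_iff: "rotated_sum \<psi> (s - 1 / 2) = 0 \<longleftrightarrow> Re s = 1 / 2 \<and> cos (p (Im s) + \<psi>) = 0" for \<psi> s
  proof (cases "Re s = 1 / 2")
    case True
    have "s - 1 / 2 = Complex 0 (Im s)" using True by (simp add: complex_eq_iff)
    moreover have "Re (cis \<psi> * F (Complex h (Im s))) = cmod (F (Complex h (Im s))) * cos (p (Im s) + \<psi>)"
      by (subst p(3)) (simp add: cos_add algebra_simps)
    ultimately show ?thesis
      using True nonzero[of "Im s"] by (simp add: rotated_sum_on_line del: times_complex.sel)
  next
    case False
    thus ?thesis using rotated_sum_zero_imp_imaginary[of \<psi> "s - 1 / 2"] by auto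
  qed
  have simple: "zorder (\<lambda>s. rotated_sum \<psi> (s - 1 / 2)) s = 1" if "rotated_sum \<psi> (s - 1 / 2) = 0" for \<psi> s
  proof -
    have "zorder (\<lambda>s. rotated_sum \<psi> (s - 1 / 2)) s = zorder (rotated_sum \<psi>) (s - 1 / 2)"
      by (subst (1 2) zorder_shift) (simp add: algebra_simps)
    thus ?thesis using rotated_sum_simple[OF that] by simp
  qed
  show "zeros_on_critical_line A" "all_zeros_simple A"
    using zero_iff simple by (auto simp: A_def zeros_on_critical_line_def all_zeros_simple_def)
  show "zeros_interlace A B"
    unfolding A_def B_def
    by (rule zeros_interlace_of_argument[OF p(2,1) zero_iff simple _ simple])
      (auto simp: zero_iff cos_add add.assoc[symmetric])
  show "zeros_interlace A B'"
    unfolding A_def B'_def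
    by (rule zeros_interlace_of_argument[OF p(2,1) zero_iff simple _ simple])
      (auto simp: zero_iff cos_diff add_diff_eq)
qed

end

section \<open>Application to the xi function\<close>

text \<open>The point \<open>1/2\<close> corresponds to the pole of zeta and is settled by the
  explicit value; everywhere else a zero of xi would be a zero of zeta with real part at least
  1.\<close>

lemma centred_xi_nonzero_right:
  assumes "Re z \<ge> 1 / 2"
  shows "centred_xi z \<noteq> 0"
proof (cases "z = 1 / 2")
  case False
  have "zeta (z + 1 / 2) \<noteq> 0"
    using assms False by (intro zeta_nonzero_Re_ge_1) (auto simp: field_simps)
  thus ?thesis unfolding zeta_eq zeta_ext_def xi_cofactor_def by (auto split: if_splits)
next
  case True
  show ?thesis unfolding True centred_xi_half by simp
qed

lemma centred_xi_zero_strip: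
  assumes "centred_xi \<rho> = 0"
  shows "\<bar>Re \<rho>\<bar> < 1 / 2"
proof -
  have "\<not> Re \<rho> \<ge> 1 / 2" "\<not> Re (- \<rho>) \<ge> 1 / 2"
    using centred_xi_nonzero_right[of \<rho>] centred_xi_nonzero_right[of "- \<rho>"] assms
    by (auto simp: centred_xi_minus)
  thus ?thesis by simp
qed

lemma RH_imp_centred_xi_zero_imaginary:
  assumes riemann_hypothesis "centred_xi \<rho> = 0"
  shows "Re \<rho> = 0"
proof -
  have "zeta (\<rho> + 1 / 2) = 0"
    using assms(2) by (simp add: zeta_eq zeta_ext_def xi_cofactor_def)
  moreover have "0 < Re (\<rho> + 1 / 2)" "Re (\<rho> + 1 / 2) < 1"
    using centred_xi_zero_strip[OF assms(2)] by auto
  ultimately have "Re (\<rho> + 1 / 2) = 1 / 2"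
    using assms(1) unfolding riemann_hypothesis_def by blast
  thus ?thesis by simp
qed

interpretation centred_xi: even_real_entire centred_xi
proof
  show "\<exists>w. (centred_xi w)\<^sup>2 \<noteq> (centred_xi 0)\<^sup>2"
    by (rule centred_xi_nonconst)
qed (simp_all add: centred_xi_holomorphic centred_xi_minus centred_xi_cnj centred_xi_0 centred_xi_growth)

lemma A_fun_eq: "A_fun h \<theta> s = (cis \<theta> * riemann_xi (s + of_real h) + cis (- \<theta>) * riemann_xi (s - of_real h)) / 2"
proof -
  have cis: "cis t = of_real (cos t) + \<i> * of_real (sin t)" for t
    by (simp add: complex_eq_iff)
  have i: "1 / (2 * \<i>) = - \<i> / 2" by (simp add: complex_eq_iff)
  show ?thesis
    unfolding A_fun_def cis i by (simp add: field_simps)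
qed

lemma B_fun_eq: "B_fun h \<theta> s = A_fun h (\<theta> + pi / 2) s"
  by (simp add: A_fun_def B_fun_def cos_add sin_add)

lemma A_fun_minus: "A_fun (- h) \<theta> s = A_fun h (- \<theta>) s"
  by (simp add: A_fun_eq add.commute)

lemma shifted_xi_conclusion:
  fixes h \<theta> :: real
  assumes h: "h \<noteq> 0" and strip: "\<And>\<rho>. centred_xi \<rho> = 0 \<Longrightarrow> \<bar>Re \<rho>\<bar> \<le> \<bar>h\<bar>"
    and nonzero: "\<And>y. centred_xi (Complex \<bar>h\<bar> y) \<noteq> 0"
  shows "zeros_on_critical_line (A_fun h \<theta>) \<and> zeros_on_critical_line (B_fun h \<theta>) \<and>
    all_zeros_simple (A_fun h \<theta>) \<and> all_zeros_simple (B_fun h \<theta>) \<and>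
    zeros_interlace (A_fun h \<theta>) (B_fun h \<theta>)"
proof -
  interpret even_real_entire_strip centred_xi "\<bar>h\<bar>"
    by unfold_locales (use assms in auto)
  have A: "A_fun \<bar>h\<bar> \<phi> = (\<lambda>s. rotated_sum \<phi> (s - 1 / 2))" for \<phi>
    by (simp add: fun_eq_iff A_fun_eq rotated_sum_def riemann_xi_eq algebra_simps)
  show ?thesis
  proof (cases "h > 0")
    case True
    hence "A_fun h \<theta> = (\<lambda>s. rotated_sum \<theta> (s - 1 / 2))" "B_fun h \<theta> = (\<lambda>s. rotated_sum (\<theta> + pi / 2) (s - 1 / 2))"
      using A by (auto simp: fun_eq_iff B_fun_eq)
    thus ?thesis using rotated_sum_conclusion(1-3)[of \<theta>] rotated_sum_conclusion(1,2)[of "\<theta> + pi / 2"] by simp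
  next
    case False
    hence "h = - \<bar>h\<bar>" by simp
    hence "A_fun h \<theta>' = A_fun \<bar>h\<bar> (- \<theta>')" for \<theta>'
      using A_fun_minus[of "\<bar>h\<bar>" \<theta>'] by (auto simp: fun_eq_iff)
    hence "A_fun h \<theta> = (\<lambda>s. rotated_sum (- \<theta>) (s - 1 / 2))" "B_fun h \<theta> = (\<lambda>s. rotated_sum (- \<theta> - pi / 2) (s - 1 / 2))"
      using A by (auto simp: fun_eq_iff B_fun_eq)
    thus ?thesis using rotated_sum_conclusion(1,2,4)[of "- \<theta>"] rotated_sum_conclusion(1,2)[of "- \<theta> - pi / 2"] by simp
  qed
qed

theorem theorem2p1:
  shows "(\<forall>h \<theta> :: real. \<bar>h\<bar> \<ge> 1 / 2 \<and> 0 \<le> \<theta> \<and> \<theta> < 2 * pi \<longrightarrow>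
            zeros_on_critical_line (A_fun h \<theta>) \<and> zeros_on_critical_line (B_fun h \<theta>) \<and>
            all_zeros_simple (A_fun h \<theta>) \<and> all_zeros_simple (B_fun h \<theta>) \<and>
            zeros_interlace (A_fun h \<theta>) (B_fun h \<theta>))
       \<and> (riemann_hypothesis \<longrightarrow>
          (\<forall>h \<theta> :: real. 0 < \<bar>h\<bar> \<and> \<bar>h\<bar> < 1 / 2 \<and> 0 \<le> \<theta> \<and> \<theta> < 2 * pi \<longrightarrow>
            zeros_on_critical_line (A_fun h \<theta>) \<and> zeros_on_critical_line (B_fun h \<theta>) \<and>
            all_zeros_simple (A_fun h \<theta>) \<and> all_zeros_simple (B_fun h \<theta>) \<and>
            zeros_interlace (A_fun h \<theta>) (B_fun h \<theta>)))"
proof -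
  have 1: "zeros_on_critical_line (A_fun h \<theta>) \<and> zeros_on_critical_line (B_fun h \<theta>) \<and>
            all_zeros_simple (A_fun h \<theta>) \<and> all_zeros_simple (B_fun h \<theta>) \<and>
            zeros_interlace (A_fun h \<theta>) (B_fun h \<theta>)" if "\<bar>h\<bar> \<ge> 1 / 2" for h \<theta> :: real
    using that centred_xi_zero_strip
    by (intro shifted_xi_conclusion centred_xi_nonzero_right) force+
  have 2: "zeros_on_critical_line (A_fun h \<theta>) \<and> zeros_on_critical_line (B_fun h \<theta>) \<and>
            all_zeros_simple (A_fun h \<theta>) \<and> all_zeros_simple (B_fun h \<theta>) \<and>
            zeros_interlace (A_fun h \<theta>) (B_fun h \<theta>)"
    if riemann_hypothesis "\<bar>h\<bar> > 0" for h \<theta> :: real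
  proof (rule shifted_xi_conclusion)
    show "\<bar>Re \<rho>\<bar> \<le> \<bar>h\<bar>" if "centred_xi \<rho> = 0" for \<rho>
      using RH_imp_centred_xi_zero_imaginary[OF \<open>riemann_hypothesis\<close> that] by simp
    show "centred_xi (Complex \<bar>h\<bar> y) \<noteq> 0" for y
      using RH_imp_centred_xi_zero_imaginary[OF \<open>riemann_hypothesis\<close>, of "Complex \<bar>h\<bar> y"] \<open>\<bar>h\<bar> > 0\<close> by auto
  qed (use that in auto)
  show ?thesis using 1 2 by blast
qed

end
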